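(* Let $k\ge2$ be an integer, $\frac{\pi}{k+1}\le a<\frac{\pi}{k}$, and $\Upsilon_k=\Upsilon_k(a)\subset\mathbb{C}^3$. The only classes in $H_2(\mathbb{C}^3,\Upsilon_k)$ which may contain holomorphic disks (with respect to the standard complex structure $J_0$) of Maslov index $2$ are $\alpha$ and $\beta_1-k\alpha+n\beta_2$ for integers $0\le n\le k$. That is, if $u\colon(B^2,\partial B^2)\to(\mathbb{C}^3,\Upsilon_k)$ is a $J_0$-holomorphic disk of Maslov index $2$, then $[u]\in\{\alpha\}\cup\{\beta_1-k\alpha+n\beta_2:0\le n\le k\}$.
   Context: Brendel tori. $\mathbb{C}^3$ carries $\omega=\sum dx_j\wedge dy_j$. Let $\Gamma\subset\{z\in\mathbb{C}:0<|z|^2<1/k\}$ be a smooth simple closed curve, contractible in this punctured disk, bounding a closed disk $D$ (so $0\notin D$, $\partial D=\Gamma$) of area $a$. With $S^1=\mathbb{R}/\mathbb{Z}$, put $$\Upsilon_k(a)=\Big\{\big(\sqrt{1-k|z|^2}\,e^{2\pi i\theta_1},|z|e^{2\pi i\theta_2},e^{2\pi i(k\theta_1-\theta_2)}z\big) : \theta_1,\theta_2\in S^1,\ z\in\Gamma\Big\}\subset\mathbb{C}^3 ,$$ a Lagrangian torus. Relative classes. Fix $w_0\in\Gamma$ and let $\overline{B}(\pi)$ be the closed unit disk in $\mathbb{C}$. The classes $\alpha,\beta_1,\beta_2\in H_2(\mathbb{C}^3,\Upsilon_k)$ are those represented by the disks $$\alpha:\ w\in D\mapsto\big(\sqrt{1-k|w|^2},|w|,w\big),$$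 $$\beta_1:\ z\in\overline{B}(\pi)\mapsto\big(\sqrt{1-k|w_0|^2}\,z,|w_0|,w_0z^k\big),$$ $$\beta_2:\ z\in\overline{B}(\pi)\mapsto\big(\sqrt{1-k|w_0|^2},|w_0|z,w_0\bar z\big).$$ They span $H_2(\mathbb{C}^3,\Upsilon_k)$; their symplectic areas are $a,\pi,0$ and their Maslov indices are $2,2k+2,0$ respectively. *)

theory Defs
  imports
    "HOL-Complex_Analysis.Complex_Analysis"
    "HOL-Homology.Homology"
begin

section \<open>Tangent spaces and the Maslov index\<close>

text \<open>Velocities at \<open>p\<close> of curves in \<open>L\<close>. For an embedded submanifold \<open>L\<close> this is the usual tangent
  space, and it is enough that the curves are differentiable at the parameter \<open>0\<close>.\<close>

definition tangent_space :: "'a::real_normed_vector set \<Rightarrow> 'a \<Rightarrow> 'a set" where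
  "tangent_space L p =
     {v. \<exists>c :: real \<Rightarrow> 'a. c 0 = p \<and> (\<forall>\<^sub>F t in nhds 0. c t \<in> L) \<and> (c has_vector_derivative v) (at 0)}"

text \<open>The columns of \<open>A\<close> form a basis over the reals (\<open>independent\<close> and \<open>span\<close> are the notions over
  the reals) of the tangent space.\<close>

definition tangent_frame :: "(complex^'n) set \<Rightarrow> complex^'n \<Rightarrow> complex^'n^'n \<Rightarrow> bool" where
  "tangent_frame L p A \<longleftrightarrow>
     inj (\<lambda>j. column j A) \<and> independent (columns A) \<and> span (columns A) = tangent_space L p"

text \<open>The value at \<open>p\<close> of the squared phase map to the unit circle. Two frames of the same totally
  real tangent space differ by an invertible real matrix, so the square of the unit complex number
  \<open>sgn (det A)\<close> does not depend on the choice of the frame.\<close>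

definition maslov_phase :: "(complex^'n) set \<Rightarrow> complex^'n \<Rightarrow> complex" where
  "maslov_phase L p = (sgn (det (SOME A. tangent_frame L p A)))\<^sup>2"

text \<open>The Maslov index of a disk with boundary on \<open>L\<close> is the degree of the squared phase map along the
  boundary loop. The tangent bundle of the ambient space is already trivial, so the disk enters only
  through its boundary. The value is a complex number because \<open>winding_number\<close> is complex-valued.\<close>

definition maslov_index :: "(complex^'n) set \<Rightarrow> (complex \<Rightarrow> complex^'n) \<Rightarrow> complex" where
  "maslov_index L u = winding_number (maslov_phase L \<circ> u \<circ> circlepath 0 1) 0"

section \<open>Holomorphic disks and their relative homology classes\<close>

text \<open>Only continuity is required up to the boundary; smoothness there is automatic for a disk with
  boundary on a smooth Lagrangian submanifold.\<close>

definition holomorphic_disk :: "(complex^'n) set \<Rightarrow> (complex \<Rightarrow> complex^'n) \<Rightarrow> bool" where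
  "holomorphic_disk L u \<longleftrightarrow>
     continuous_on (cball 0 1) u \<and> (\<forall>i. (\<lambda>z. u z $ i) holomorphic_on ball 0 1) \<and>
     u ` sphere 0 1 \<subseteq> L"

abbreviation H2_disk where
  "H2_disk \<equiv> relative_homology_group 2 (top_of_set (cball 0 1 :: complex set)) (sphere 0 1)"

abbreviation H2 :: "(complex^'n) set \<Rightarrow> _" where
  "H2 L \<equiv> relative_homology_group 2 (euclidean :: (complex^'n) topology) L"

text \<open>A generator of the infinite cyclic group \<open>H2_disk\<close>, that is, an orientation of the disk. The
  other generator changes the sign of all classes \<open>disk_class \<iota> L u\<close> simultaneously.\<close>

definition fundamental_class where
  "fundamental_class \<iota> \<longleftrightarrow> \<iota> \<in> carrier H2_disk \<and> generate H2_disk {\<iota>} = carrier H2_disk"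

definition disk_class where
  "disk_class \<iota> (L :: (complex^'n) set) u =
     hom_induced 2 (top_of_set (cball 0 1 :: complex set)) (sphere 0 1) euclidean L u \<iota>"

section \<open>Plane curves and the disks they bound\<close>

text \<open>The sequence \<open>\<gamma>\<close> consists of a smooth 1-periodic regular parametrisation \<open>\<gamma> 0\<close> and its
  successive derivatives.\<close>

definition smooth_simple_closed_curve :: "complex set \<Rightarrow> bool" where
  "smooth_simple_closed_curve \<Gamma> \<longleftrightarrow>
     (\<exists>\<gamma> :: nat \<Rightarrow> real \<Rightarrow> complex.
        (\<forall>n t. (\<gamma> n has_vector_derivative \<gamma> (Suc n) t) (at t)) \<and>
        (\<forall>t. \<gamma> 0 (t + 1) = \<gamma> 0 t) \<and> inj_on (\<gamma> 0) {0..<1} \<and> (\<forall>t. \<gamma> 1 t \<noteq> 0) \<and>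
        \<Gamma> = range (\<gamma> 0))"

definition contractible_in :: "'a::topological_space set \<Rightarrow> 'a set \<Rightarrow> bool" where
  "contractible_in S T \<longleftrightarrow> (\<exists>c. homotopic_with_canon (\<lambda>_. True) S T id (\<lambda>_. c))"

definition bounded_disk :: "complex set \<Rightarrow> complex set" where
  "bounded_disk \<Gamma> = \<Gamma> \<union> inside \<Gamma>"

text \<open>Orientation-preserving homeomorphisms from the closed unit disk. A map defined on
  \<open>bounded_disk \<Gamma>\<close> becomes a disk in the sense of \<open>disk_class\<close> by composition with such a \<open>\<phi>\<close>.\<close>

definition oriented_disk_param :: "complex set \<Rightarrow> (complex \<Rightarrow> complex) \<Rightarrow> bool" where
  "oriented_disk_param \<Gamma> \<phi> \<longleftrightarrow>
     (\<exists>\<psi>. homeomorphism (cball 0 1) (bounded_disk \<Gamma>) \<phi> \<psi>) \<and>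
     (\<forall>w\<in>inside \<Gamma>. winding_number (\<phi> \<circ> circlepath 0 1) w = 1)"

section \<open>Brendel tori\<close>

definition punctured_disk :: "nat \<Rightarrow> complex set" where
  "punctured_disk k = {z. 0 < (cmod z)\<^sup>2 \<and> (cmod z)\<^sup>2 < 1 / real k}"

definition brendel_torus :: "nat \<Rightarrow> complex set \<Rightarrow> (complex^3) set" where
  "brendel_torus k \<Gamma> =
     {vector [of_real (sqrt (1 - real k * (cmod z)\<^sup>2)) * cis (2 * pi * \<theta>\<^sub>1),
              of_real (cmod z) * cis (2 * pi * \<theta>\<^sub>2),
              cis (2 * pi * (real k * \<theta>\<^sub>1 - \<theta>\<^sub>2)) * z] | \<theta>\<^sub>1 \<theta>\<^sub>2 z. z \<in> \<Gamma>}"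

definition alpha_disk :: "nat \<Rightarrow> complex \<Rightarrow> complex^3" where
  "alpha_disk k w = vector [of_real (sqrt (1 - real k * (cmod w)\<^sup>2)), of_real (cmod w), w]"

definition beta1_disk :: "nat \<Rightarrow> complex \<Rightarrow> complex \<Rightarrow> complex^3" where
  "beta1_disk k w\<^sub>0 z =
     vector [of_real (sqrt (1 - real k * (cmod w\<^sub>0)\<^sup>2)) * z, of_real (cmod w\<^sub>0), w\<^sub>0 * z ^ k]"

definition beta2_disk :: "nat \<Rightarrow> complex \<Rightarrow> complex \<Rightarrow> complex^3" where
  "beta2_disk k w\<^sub>0 z =
     vector [of_real (sqrt (1 - real k * (cmod w\<^sub>0)\<^sup>2)), of_real (cmod w\<^sub>0) * z, w\<^sub>0 * cnj z]"

end

theory Submission imports Defs begin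

text \<open>The torus is parametrised by two angles and by the parameter of \<open>\<Gamma>\<close>, traversed counterclockwise. Along the
  boundary of a disk the lifted parameters grow by integers \<open>q\<close>, \<open>n\<close> and \<open>p\<close>. They determine the relative class,
  because the boundary map from \<open>H2 \<Upsilon>\<close> to the first homology of \<open>\<Upsilon>\<close> is injective and the class of a
  boundary loop depends on the increments of a lift alone (\<open>disk_classes_by_period\<close>). The disks \<open>\<alpha>\<close>, \<open>\<beta>\<^sub>1\<close>, \<open>\<beta>\<^sub>2\<close> have
  increments \<open>(0, 0, 1)\<close>, \<open>(1, 0, 0)\<close>, \<open>(0, 1, 0)\<close>, so a disk has, in additive notation, the class
  \<open>p \<alpha> + q \<beta>\<^sub>1 + n \<beta>\<^sub>2\<close>.

  The integers are restricted by the Maslov index and by the argument principle. The Maslov index is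
  \<open>2 (k + 1) q + 2 p\<close>: the determinant of the tangent frame of the torus is a positive multiple of
  \<open>- exp (2 \<pi> \<i> (k + 1) \<theta>\<^sub>1) \<sigma>'\<close>, where \<open>\<sigma>\<close> is the simple closed curve traced by the function
  \<open>z\<^sub>2 z\<^sub>3 / z\<^sub>1 ^ k\<close>, which is constant in the two angles, and the tangent \<open>\<sigma>'\<close> turns once along the curve
  (\<open>det_torus_frame\<close>, \<open>turning_number\<close>). So index two means \<open>p = 1 - (k + 1) q\<close>.

  A holomorphic function on the disk has nonnegative winding number along the boundary if it does not vanish
  there (\<open>winding_number_holomorphic_nonneg\<close>). For the coordinates of a holomorphic disk this gives \<open>0 \<le> q\<close>,
  \<open>0 \<le> n\<close> and \<open>n \<le> k q\<close>; here \<open>\<Gamma>\<close> has winding number \<open>0\<close> around the origin, as it is contractible in the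
  punctured disk. If \<open>C\<close> is a point enclosed by \<open>\<sigma>\<close>, the function \<open>z\<^sub>2 z\<^sub>3 - C z\<^sub>1 ^ k\<close> has winding number
  \<open>k q + p = 1 - q\<close>, hence \<open>q \<le> 1\<close>. For \<open>q = 0\<close> this leaves \<open>n = 0\<close>, \<open>p = 1\<close> and the class \<open>\<alpha>\<close>; for \<open>q = 1\<close> it leaves
  \<open>p = - k\<close> and \<open>0 \<le> n \<le> k\<close>.\<close>

section \<open>Winding numbers and continuous logarithms\<close>

lemma path_continuous_logarithm:
  assumes "path f" "0 \<notin> path_image f"
  obtains g where "path g" "\<And>t. t \<in> {0..1} \<Longrightarrow> f t = exp (g t)"
    "winding_number f 0 = (g 1 - g 0) / (2 * of_real pi * \<i>)"
proof -
  obtain q where q: "path q" "pathfinish q - pathstart q = 2 * of_real pi * \<i> * winding_number f 0"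
      "\<And>t. t \<in> {0..1} \<Longrightarrow> f t = 0 + exp (q t)"
    using winding_number_as_continuous_log[OF assms] by blast
  show thesis
    by (rule that[of q]) (use q in \<open>auto simp: pathfinish_def pathstart_def field_simps\<close>)
qed

lemma winding_number_from_log:
  assumes "continuous_on {0..1} g" "\<And>t. t \<in> {0..1} \<Longrightarrow> f t = exp (g t)"
  shows "winding_number f 0 = (g 1 - g 0) / (2 * of_real pi * \<i>)"
proof -
  have "winding_number f 0 = winding_number (exp \<circ> g) 0"
    using assms by (intro winding_number_cong) auto
  also have "\<dots> = (g 1 - g 0) / (2 * of_real pi * \<i>)"
    using winding_number_compose_exp[of g] assms(1) by (simp add: path_def pathfinish_def pathstart_def)
  finally show ?thesis .
qed

lemma winding_number_times:
  assumes "path f" "0 \<notin> path_image f" "path g" "0 \<notin> path_image g"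
  shows "winding_number (\<lambda>t. f t * g t) 0 = winding_number f 0 + winding_number g 0"
proof -
  obtain a where a: "path a" "\<And>t. t \<in> {0..1} \<Longrightarrow> f t = exp (a t)"
    "winding_number f 0 = (a 1 - a 0) / (2 * of_real pi * \<i>)"
    using path_continuous_logarithm assms(1,2) by blast
  obtain b where b: "path b" "\<And>t. t \<in> {0..1} \<Longrightarrow> g t = exp (b t)"
    "winding_number g 0 = (b 1 - b 0) / (2 * of_real pi * \<i>)"
    using path_continuous_logarithm assms(3,4) by blast
  have "winding_number (\<lambda>t. f t * g t) 0 = ((a 1 + b 1) - (a 0 + b 0)) / (2 * of_real pi * \<i>)"
    by (rule winding_number_from_log) (use a b in \<open>auto simp: path_def exp_add intro!: continuous_intros\<close>)
  then show ?thesis by (simp add: a b add_divide_distrib diff_divide_distrib)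
qed

lemma winding_number_power:
  assumes "path f" "0 \<notin> path_image f"
  shows "winding_number (\<lambda>t. f t ^ n) 0 = of_nat n * winding_number f 0"
proof (induction n)
  case 0
  show ?case by (simp add: winding_number_zero_const)
next
  case (Suc n)
  have "path (\<lambda>t. f t ^ n)" "0 \<notin> path_image (\<lambda>t. f t ^ n)"
    using assms by (auto simp: path_def path_image_def intro!: continuous_intros)
  then show ?case using winding_number_times[OF assms, of "\<lambda>t. f t ^ n"] Suc by (simp add: distrib_right)
qed

lemma winding_number_positive_real:
  assumes "continuous_on {0..1} f" "\<And>t. t \<in> {0..1} \<Longrightarrow> f t > 0" "f 0 = f 1"
  shows "winding_number (\<lambda>t. of_real (f t)) 0 = 0"
proof -
  have "winding_number (\<lambda>t. of_real (f t)) 0 = (of_real (ln (f 1)) - of_real (ln (f 0))) / (2 * of_real pi * \<i>)"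
    by (rule winding_number_from_log) (use assms in \<open>auto simp: exp_of_real intro!: continuous_intros, (metis atLeastAtMost_iff less_irrefl)?\<close>)
  then show ?thesis using assms(3) by simp
qed

lemma winding_number_sgn:
  assumes "path f" "0 \<notin> path_image f" "f 0 = f 1"
  shows "winding_number (\<lambda>t. sgn (f t)) 0 = winding_number f 0"
proof -
  have nz: "f t \<noteq> 0" if "t \<in> {0..1}" for t using assms that by (auto simp: path_image_def)
  have cf: "continuous_on {0..1} f" using assms by (simp add: path_def)
  have c: "continuous_on {0..1} (\<lambda>t. sgn (f t))"
    unfolding sgn_div_norm using nz by (auto intro!: continuous_intros cf)
  have "winding_number f 0 = winding_number (\<lambda>t. of_real (norm (f t)) * sgn (f t)) 0"
    by (intro winding_number_cong) (use nz in \<open>auto simp: sgn_div_norm scaleR_conv_of_real\<close>)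
  also have "\<dots> = winding_number (\<lambda>t. of_real (norm (f t))) 0 + winding_number (\<lambda>t. sgn (f t)) 0"
    by (rule winding_number_times) (use c nz in \<open>auto simp: path_def path_image_def sgn_eq_0_iff intro!: continuous_intros cf\<close>)
  also have "winding_number (\<lambda>t. of_real (norm (f t))) 0 = 0"
    by (rule winding_number_positive_real) (use nz assms in \<open>auto intro!: continuous_intros cf\<close>)
  finally show ?thesis by simp
qed

lemma winding_number_unit_exp:
  assumes "continuous_on {0..1} x"
  shows "winding_number (\<lambda>t. exp (2 * of_real pi * \<i> * of_real (x t))) 0 = of_real (x 1 - x 0)"
proof -
  have "winding_number (\<lambda>t. exp (2 * of_real pi * \<i> * of_real (x t))) 0
     = (2 * of_real pi * \<i> * of_real (x 1) - 2 * of_real pi * \<i> * of_real (x 0)) / (2 * of_real pi * \<i>)"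
    by (rule winding_number_from_log) (auto intro!: continuous_intros assms)
  then show ?thesis by (simp add: diff_divide_distrib)
qed

lemma periodic_int:
  fixes f :: "real \<Rightarrow> 'a"
  assumes "\<And>t. f (t + 1) = f t"
  shows "f (t + of_int n) = f t"
proof (induction n arbitrary: t rule: int_induct[where k=0])
  case base
  then show ?case by simp
next
  case (step1 i)
  have "f (t + of_int (i + 1)) = f ((t + of_int i) + 1)" by (simp add: add.assoc)
  then show ?case using assms step1 by simp
next
  case (step2 i)
  have "f (t + of_int i) = f ((t + of_int (i - 1)) + 1)" by (simp add: add.assoc)
  then show ?case using assms[of "t + of_int (i - 1)"] step2 by simp
qed

text \<open>A continuous logarithm of the periodic function \<open>f\<close> grows over every interval \<open>{t..t + 1}\<close> by a multiple of
  \<open>2 * pi * \<i>\<close> that depends continuously on \<open>t\<close>, hence by a constant \<open>c\<close>. A path whose end points differ by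
  \<open>n\<close> collects \<open>n\<close> times this growth.\<close>

lemma winding_number_reparametrized_loop:
  fixes f :: "real \<Rightarrow> complex"
  assumes f: "continuous_on UNIV f" "\<And>t. f t \<noteq> 0" "\<And>t. f (t + 1) = f t"
    and \<tau>: "continuous_on {0..1} \<tau>" "\<tau> 1 = \<tau> 0 + of_int n"
  shows "winding_number (\<lambda>s. f (\<tau> s)) 0 = of_int n * winding_number f 0"
proof -
  obtain g where g: "continuous_on UNIV g" "\<And>t. f t = exp (g t)"
    using continuous_logarithm_on_contractible[OF f(1)] f(2) by (auto simp: convex_imp_contractible)
  define c where "c = g 1 - g 0"
  have "(\<lambda>t. g (t + 1) - g t) constant_on UNIV"
  proof (rule continuous_discrete_range_constant)
    show "continuous_on UNIV (\<lambda>t. g (t + 1) - g t)"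
      by (intro continuous_intros continuous_on_compose2[OF g(1)]) auto
    fix x :: real assume "x \<in> UNIV"
    show "\<exists>e>0. \<forall>y. y \<in> UNIV \<and> g (y + 1) - g y \<noteq> g (x + 1) - g x \<longrightarrow> e \<le> norm (g (y + 1) - g y - (g (x + 1) - g x))"
    proof (intro exI[of _ "2*pi"] conjI allI impI)
      fix y assume y: "y \<in> UNIV \<and> g (y + 1) - g y \<noteq> g (x + 1) - g x"
      have "exp (g (t+1)) = exp (g t)" for t using f(3)[of t] g(2) by simp
      then have "\<exists>n::int. g (t + 1) = g t + of_real (of_int (2 * n) * pi) * \<i>" for t using exp_eq by blast
      then obtain m n :: int where "g (y + 1) = g y + of_real (of_int (2 * m) * pi) * \<i>" "g (x + 1) = g x + of_real (of_int (2 * n) * pi) * \<i>"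
        by metis
      then have *: "g (y + 1) - g y - (g (x + 1) - g x) = of_real (of_int (m - n) * 2 * pi) * \<i>"
        by (simp add: algebra_simps)
      with y have "m - n \<noteq> 0" by auto
      then have "\<bar>real_of_int (m - n)\<bar> \<ge> 1" by linarith
      then show "2*pi \<le> norm (g (y + 1) - g y - (g (x + 1) - g x))"
        unfolding * norm_mult norm_of_real abs_mult by simp
    qed auto
  qed auto
  then have c: "g (t + 1) = g t + c" for t
    unfolding constant_on_def c_def by (metis UNIV_I add_0 add.commute diff_add_cancel)
  have cn: "g (t + of_int n) = g t + of_int n * c" for t n
    using periodic_int[of "\<lambda>t. g t - of_real t * c" t n] c by (simp add: algebra_simps)
  have "winding_number (\<lambda>s. f (\<tau> s)) 0 = (g (\<tau> 1) - g (\<tau> 0)) / (2 * of_real pi * \<i>)"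
    by (rule winding_number_from_log) (use g \<tau>(1) in \<open>auto intro!: continuous_on_compose2[OF g(1)]\<close>)
  moreover have "winding_number f 0 = c / (2 * of_real pi * \<i>)" unfolding c_def
    by (rule winding_number_from_log) (use g in \<open>auto intro: continuous_on_subset\<close>)
  ultimately show ?thesis using cn \<tau>(2) by simp
qed

text \<open>The diagonal of the unit square is homotopic to its left edge followed by its top edge, and \<open>f\<close> takes the
  same values on the top and on the bottom edge. In terms of a logarithm of \<open>f\<close> on the plane this is a
  telescoping sum.\<close>

lemma winding_number_torus_diagonal:
  fixes f :: "real \<times> real \<Rightarrow> complex"
  assumes f: "continuous_on UNIV f" "\<And>p. f p \<noteq> 0" "\<And>s t. f (s, t + 1) = f (s, t)"
  shows "winding_number (\<lambda>t. f (t, t)) 0 = winding_number (\<lambda>t. f (t, 0)) 0 + winding_number (\<lambda>t. f (0, t)) 0"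
proof -
  obtain g where g: "continuous_on UNIV g" "\<And>p. f p = exp (g p)"
    using continuous_logarithm_on_contractible[OF f(1)] f(2) by (auto simp: convex_imp_contractible)
  have "winding_number (\<lambda>t. f (t, t)) 0 = (g (1,1) - g (0,0)) / (2 * of_real pi * \<i>)"
    by (rule winding_number_from_log) (use g in \<open>auto intro!: continuous_on_compose2[OF g(1)] continuous_intros\<close>)
  moreover have "winding_number (\<lambda>t. f (0, t)) 0 = (g (0,1) - g (0,0)) / (2 * of_real pi * \<i>)"
    by (rule winding_number_from_log) (use g in \<open>auto intro!: continuous_on_compose2[OF g(1)] continuous_intros\<close>)
  moreover have "winding_number (\<lambda>t. f (t, 0)) 0 = (g (1,1) - g (0,1)) / (2 * of_real pi * \<i>)"
    by (rule winding_number_from_log) (use g f(3)[of _ 0] in \<open>auto intro!: continuous_on_compose2[OF g(1)] continuous_intros\<close>)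
  ultimately show ?thesis by (simp only: flip: add_divide_distrib) simp
qed

section \<open>Holomorphic functions on the disk\<close>

text \<open>By the argument principle the winding number counts the zeros of \<open>f\<close>. As \<open>f\<close> is only continuous up to the
  unit circle, the principle is applied to a smaller circle that still encloses all zeros; the images of the
  two circles are homotopic in the complement of \<open>0\<close>, because \<open>f\<close> has no zero between the circles.\<close>

lemma winding_number_holomorphic_nonneg:
  assumes cont: "continuous_on (cball 0 1) f" and hol: "f holomorphic_on ball 0 1"
    and nz: "\<And>z. z \<in> sphere 0 1 \<Longrightarrow> f z \<noteq> 0"
  shows "Re (winding_number (f \<circ> circlepath 0 1) 0) \<ge> 0"
proof -
  define Z where "Z = {z \<in> cball 0 1. f z = 0}"
  have "compact Z"
  proof -
    have "closed Z" unfolding Z_def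
      by (rule continuous_closed_preimage_constant[OF cont]) auto
    then show ?thesis unfolding compact_eq_bounded_closed
      by (intro conjI bounded_subset[OF bounded_cball[of 0 1]]) (auto simp: Z_def)
  qed
  have Zb: "Z \<subseteq> ball 0 1" using nz by (auto simp: Z_def less_le)
  obtain r where r: "0 < r" "r < 1" "Z \<subseteq> ball 0 r"
  proof (cases "Z = {}")
    case True
    then show ?thesis using that[of "1/2"] by auto
  next
    case False
    then obtain z where z: "z \<in> Z" "\<And>w. w \<in> Z \<Longrightarrow> norm w \<le> norm z"
      using continuous_attains_sup[OF \<open>compact Z\<close> False, of norm] by (auto intro!: continuous_intros)
    then have "norm z < 1" using Zb by auto
    then obtain s where "norm z < s" "s < 1" using dense by blast
    show ?thesis
      by (rule that[of s]) (use z \<open>norm z < s\<close> \<open>s < 1\<close> in \<open>auto, smt (verit) norm_ge_zero, smt (verit)\<close>)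
  qed
  have fin: "finite Z"
  proof (cases "f constant_on ball 0 1")
    case True
    have "f (of_real r) \<noteq> 0" using r by (auto simp: Z_def dest!: subsetD[where c = "of_real r"])
    moreover have "of_real r \<in> ball (0::complex) 1" using r by auto
    moreover obtain C where "\<And>x. x \<in> ball 0 1 \<Longrightarrow> f x = C" using True unfolding constant_on_def by blast
    ultimately have "f x \<noteq> 0" if "x \<in> ball 0 1" for x using that by metis
    then have "Z = {}" using Zb by (auto simp: Z_def)
    then show ?thesis by simp
  next
    case False
    have "finite {z \<in> Z. f z = 0}"
      by (rule holomorphic_compact_finite_zeros[OF hol _ _ \<open>compact Z\<close> Zb False]) auto
    then show ?thesis by (simp add: Z_def)
  qed
  have eqZ: "{w \<in> ball 0 1. f w = 0 \<or> w \<in> {}} = Z" using Zb by (auto simp: Z_def)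
  have img: "path_image (circlepath 0 r) \<subseteq> ball 0 1 - Z"
    using r by (auto simp: path_image_circlepath_nonneg)
  have AP: "contour_integral (circlepath 0 r) (\<lambda>x. deriv f x * 1 / f x) =
      2 * pi * \<i> * (\<Sum>p\<in>Z. winding_number (circlepath 0 r) p * 1 * zorder f p)"
    unfolding eqZ[symmetric]
  proof (rule argument_principle)
    show "\<forall>z. z \<notin> ball 0 1 \<longrightarrow> winding_number (circlepath 0 r) z = 0"
      using r by (auto intro!: winding_number_zero_outside[where s="cball 0 r"] simp: path_image_circlepath_nonneg)
    show "path_image (circlepath 0 r) \<subseteq> ball 0 1 - {w \<in> ball 0 1. f w = 0 \<or> w \<in> {}}"
      unfolding eqZ by (rule img)
    show "finite {w \<in> ball 0 1. f w = 0 \<or> w \<in> {}}" unfolding eqZ by (rule fin)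
  qed (use hol in auto)
  have an: "f analytic_on ball 0 1" using hol by (simp add: analytic_on_open)
  have vp: "valid_path (f \<circ> circlepath 0 r)"
    by (rule valid_path_compose_analytic[OF _ an]) (use img in auto)
  have z0: "0 \<notin> path_image (f \<circ> circlepath 0 r)"
    using img r by (auto simp: path_image_compose Z_def)
  have "winding_number (f \<circ> circlepath 0 r) 0 = 1/(2*pi*\<i>) * contour_integral (f \<circ> circlepath 0 r) (\<lambda>w. 1/w)"
    using winding_number_valid_path[OF vp z0] by simp
  also have "contour_integral (f \<circ> circlepath 0 r) (\<lambda>w. 1/w) = contour_integral (circlepath 0 r) (\<lambda>w. deriv f w * (1 / f w))"
    by (rule contour_integral_comp_analyticW[OF an]) (use img in auto)
  also have "\<dots> = 2 * pi * \<i> * (\<Sum>p\<in>Z. winding_number (circlepath 0 r) p * 1 * zorder f p)"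
    using AP by simp
  also have "(\<Sum>p\<in>Z. winding_number (circlepath 0 r) p * 1 * zorder f p) = of_int (\<Sum>p\<in>Z. zorder f p)"
    unfolding of_int_sum
  proof (rule sum.cong)
    fix p assume "p \<in> Z"
    then have "winding_number (circlepath 0 r) p = 1"
      using r by (intro winding_number_circlepath) auto
    then show "winding_number (circlepath 0 r) p * 1 * zorder f p = of_int (zorder f p)" by simp
  qed simp
  finally have w: "winding_number (f \<circ> circlepath 0 r) 0 = of_int (\<Sum>p\<in>Z. zorder f p)" by (simp add: o_def)
  have "zorder f p \<ge> 0" if "p \<in> Z" for p
  proof -
    have p: "p \<in> ball 0 1" using that Zb by auto
    have "eventually (\<lambda>z. z \<in> - (Z - {p})) (at p)"
      by (intro eventually_at_in_open' open_Compl finite_imp_closed) (use fin in auto)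
    moreover have "eventually (\<lambda>z. z \<in> ball 0 1) (at p)"
      by (intro eventually_at_in_open') (use p in auto)
    moreover have "eventually (\<lambda>z. z \<noteq> p) (at p)" by (simp add: eventually_at_filter)
    ultimately have "eventually (\<lambda>z. f z \<noteq> 0) (at p)"
      by eventually_elim (auto simp: Z_def)
    then have "frequently (\<lambda>z. f z \<noteq> 0) (at p)" by (simp add: eventually_frequently)
    moreover have "f analytic_on {p}" using an p by (auto intro: analytic_on_subset)
    ultimately show ?thesis by (intro zorder_ge_0)
  qed
  then have nn: "(\<Sum>p\<in>Z. zorder f p) \<ge> 0" by (intro sum_nonneg)
  have "homotopic_loops (cball 0 1 - Z) (circlepath 0 r) (circlepath 0 1)"
  proof (rule homotopic_loops_linear)
    fix t :: real assume "t \<in> {0..1}"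
    show "closed_segment (circlepath 0 r t) (circlepath 0 1 t) \<subseteq> cball 0 1 - Z"
    proof
      fix z assume "z \<in> closed_segment (circlepath 0 r t) (circlepath 0 1 t)"
      then obtain u where u: "0 \<le> u" "u \<le> 1" "z = (1 - u) *\<^sub>R circlepath 0 r t + u *\<^sub>R circlepath 0 1 t"
        by (auto simp: in_segment)
      have "z = of_real ((1 - u) * r + u) * exp (2 * of_real pi * \<i> * of_real t)"
        unfolding u(3) by (simp add: circlepath scaleR_conv_of_real algebra_simps)
      then have nz: "norm z = \<bar>(1 - u) * r + u\<bar>" by (simp only: norm_mult norm_of_real) (simp add: norm_exp_eq_Re)
      have "0 \<le> (1 - u) * (1 - r)" "0 \<le> u * (1 - r)" "0 \<le> (1-u)*r" using u r by auto
      then have "r \<le> norm z" "norm z \<le> 1" using nz u(1,2) r by (simp_all add: algebra_simps abs_if)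
      then show "z \<in> cball 0 1 - Z" using r by auto
    qed
  qed auto
  then have "homotopic_loops (-{0}) (f \<circ> circlepath 0 r) (f \<circ> circlepath 0 1)"
    by (rule homotopic_loops_continuous_image) (use cont in \<open>auto simp: Z_def intro: continuous_on_subset\<close>)
  then have "winding_number (f \<circ> circlepath 0 r) 0 = winding_number (f \<circ> circlepath 0 1) 0"
    by (rule winding_number_homotopic_loops)
  then have "winding_number (f \<circ> circlepath 0 1) 0 = of_int (\<Sum>p\<in>Z. zorder f p)" using w by (simp only:)
  then show ?thesis using nn by (simp only: complex_Re_of_int of_int_0_le_iff)
qed

section \<open>The turning number of a simple closed curve\<close>

text \<open>Secants degenerate continuously into tangents: \<open>D (s, t)\<close> is the mean value of \<open>f'\<close> over the segment from
  \<open>s\<close> to \<open>t\<close>, an integral that depends continuously on its parameters also across the diagonal.\<close>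

lemma divided_difference:
  fixes f f' :: "real \<Rightarrow> complex"
  assumes der: "\<And>t. (f has_vector_derivative f' t) (at t)" and cont: "continuous_on UNIV f'"
  obtains D where "continuous_on UNIV D" "\<And>s t. f t - f s = of_real (t - s) * D (s, t)" "\<And>t. D (t, t) = f' t"
proof
  define D where "D = (\<lambda>p. integral (cbox 0 1) (\<lambda>u. f' (fst p + u * (snd p - fst p))))"
  show "continuous_on UNIV D" unfolding D_def
    by (rule integral_continuous_on_param)
       (auto simp: case_prod_unfold intro!: continuous_on_compose2[OF cont] continuous_intros)
  show "D (t, t) = f' t" for t unfolding D_def by simp
  show "f t - f s = of_real (t - s) * D (s, t)" for s t
  proof -
    have "((\<lambda>u. f (s + u * (t - s))) has_vector_derivative (t - s) *\<^sub>R f' (s + u * (t - s))) (at u)" for u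
    proof -
      have "((\<lambda>u. s + u * (t - s)) has_vector_derivative (t - s)) (at u)"
        by (auto intro!: derivative_eq_intros simp: has_real_derivative_iff_has_vector_derivative[symmetric])
      from vector_diff_chain_at[OF this der] show ?thesis by (simp add: o_def)
    qed
    then have "((\<lambda>u. (t - s) *\<^sub>R f' (s + u * (t - s))) has_integral f (s + 1 * (t - s)) - f (s + 0 * (t - s))) {0..1}"
      by (intro fundamental_theorem_of_calculus) (auto intro: has_vector_derivative_at_within)
    from integral_unique[OF this] show ?thesis by (simp add: D_def scaleR_conv_of_real)
  qed
qed

lemma exp_unit_eq_iff: "exp (2 * of_real pi * \<i> * of_real s) = exp (2 * of_real pi * \<i> * of_real t) \<longleftrightarrow> s - t \<in> \<int>"
proof -
  have "exp (2 * of_real pi * \<i> * of_real s) = exp (2 * of_real pi * \<i> * of_real t) \<longleftrightarrow>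
      (\<exists>n::int. 2 * of_real pi * \<i> * of_real s = 2 * of_real pi * \<i> * complex_of_real t + of_real (of_int (2 * n) * pi) * \<i>)"
    by (rule exp_eq)
  also have "\<dots> \<longleftrightarrow> (\<exists>n::int. s = t + of_int n)"
  proof (rule ex_cong1)
    fix n :: int
    have "2 * of_real pi * \<i> * of_real s = 2 * of_real pi * \<i> * complex_of_real t + of_real (of_int (2 * n) * pi) * \<i>
       \<longleftrightarrow> 2 * of_real pi * \<i> * of_real s = 2 * of_real pi * \<i> * (complex_of_real (t + of_int n))"
      by (simp add: algebra_simps)
    also have "\<dots> \<longleftrightarrow> complex_of_real s = complex_of_real (t + of_int n)" by (subst mult_left_cancel) auto
    finally show "2 * of_real pi * \<i> * of_real s = 2 * of_real pi * \<i> * complex_of_real t + of_real (of_int (2 * n) * pi) * \<i>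
       \<longleftrightarrow> s = t + of_int n" by (simp only: of_real_eq_iff)
  qed
  also have "\<dots> \<longleftrightarrow> s - t \<in> \<int>" unfolding Ints_def by (auto simp: algebra_simps)
  finally show ?thesis .
qed

lemma periodic_inj_eq_iff:
  fixes \<sigma> :: "real \<Rightarrow> 'a"
  assumes per: "\<And>t. \<sigma> (t + 1) = \<sigma> t" and inj: "inj_on \<sigma> {0..<1}"
  shows "\<sigma> s = \<sigma> t \<longleftrightarrow> s - t \<in> \<int>"
proof
  assume "\<sigma> s = \<sigma> t"
  moreover have "\<sigma> (frac x) = \<sigma> x" for x
    using periodic_int[of \<sigma> "frac x" "\<lfloor>x\<rfloor>"] per by (simp add: frac_def)
  ultimately have "\<sigma> (frac s) = \<sigma> (frac t)" by simp
  then have "frac s = frac t" using inj by (auto simp: inj_on_def frac_lt_1)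
  then have "s - t = of_int (\<lfloor>s\<rfloor> - \<lfloor>t\<rfloor>)" by (simp add: frac_def)
  then show "s - t \<in> \<int>" by (metis Ints_of_int)
next
  assume "s - t \<in> \<int>"
  then obtain n :: int where "s = t + of_int n" by (auto elim!: Ints_cases simp: algebra_simps)
  then show "\<sigma> s = \<sigma> t" using periodic_int[of \<sigma> t n] per by simp
qed

lemma has_vector_derivative_periodic:
  fixes f :: "real \<Rightarrow> 'a::real_normed_vector"
  assumes "\<And>t. (f has_vector_derivative f' t) (at t)" "\<And>t. f (t + 1) = f t"
  shows "f' (t + 1) = f' t"
proof -
  have "((\<lambda>t::real. t + 1) has_vector_derivative 1) (at t)"
    by (auto intro!: derivative_eq_intros simp flip: has_real_derivative_iff_has_vector_derivative)
  from vector_diff_chain_at[OF this assms(1)]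
  have "((\<lambda>t. f (t + 1)) has_vector_derivative f' (t + 1)) (at t)"
    by (simp add: o_def)
  then show ?thesis using assms by (auto intro: vector_derivative_unique_at)
qed

text \<open>This is Hopf's theorem that the tangent of a positively oriented simple closed curve turns exactly once. The
  secants of \<open>\<sigma>\<close> are compared with those of the unit circle \<open>e\<close>. The quotient
  \<open>Q (s, t) = (\<sigma> t - \<sigma> s) / (e t - e s)\<close> extends to a continuous nowhere vanishing function that is 1-periodic
  in both variables, with value \<open>\<sigma>' t / e' t\<close> at \<open>(t, t)\<close>. It is symmetric, so it turns \<open>2 * m\<close> times along the
  diagonal, where \<open>m\<close> is the winding number of \<open>q = (\<lambda>t. Q (0, t))\<close>; therefore \<open>\<sigma>'\<close> turns \<open>2 * m + 1\<close> times.

  It remains to see that \<open>m = 0\<close>. Replace the common base points \<open>\<sigma> 0\<close> and \<open>e 0 = 1\<close> of the secants by points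
  \<open>w\<close> and \<open>\<zeta>\<close> close to them but not on the curves. If they are chosen suitably,
  \<open>(\<sigma> t - w) / (e t - \<zeta>)\<close> stays close to \<open>q t\<close>, so \<open>m\<close> is the winding number of \<open>\<sigma>\<close> around \<open>w\<close> minus that of
  \<open>e\<close> around \<open>\<zeta>\<close>. For \<open>\<zeta>\<close> inside and outside the unit circle this exhibits \<open>m + 1\<close> and \<open>m\<close> as winding numbers
  of the positively oriented curve \<open>\<sigma>\<close>, which are \<open>0\<close> or \<open>1\<close>.\<close>

theorem turning_number:
  fixes \<sigma> \<sigma>' :: "real \<Rightarrow> complex"
  assumes der: "\<And>t. (\<sigma> has_vector_derivative \<sigma>' t) (at t)" and cont: "continuous_on UNIV \<sigma>'"
    and per: "\<And>t. \<sigma> (t + 1) = \<sigma> t" and inj: "inj_on \<sigma> {0..<1}" and reg: "\<And>t. \<sigma>' t \<noteq> 0"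
    and c: "c \<notin> range \<sigma>" "winding_number \<sigma> c = 1"
  shows "winding_number \<sigma>' 0 = 1"
proof -
  define e :: "real \<Rightarrow> complex" where "e = (\<lambda>t. exp (2 * of_real pi * \<i> * of_real t))"
  define e' where "e' = (\<lambda>t. 2 * of_real pi * \<i> * e t)"
  have e_der: "(e has_vector_derivative e' t) (at t)" for t
  proof -
    have "((\<lambda>t. exp (2 * of_real pi * \<i> * t)) has_field_derivative e' t) (at (of_real t))"
      unfolding e'_def e_def by (auto intro!: derivative_eq_intros simp: mult_ac)
    from has_vector_derivative_real_field[OF this] show ?thesis by (simp add: e_def o_def)
  qed
  have e'_cont: "continuous_on UNIV e'" unfolding e'_def e_def by (intro continuous_intros)
  have e_cont: "continuous_on A e" for A unfolding e_def by (intro continuous_intros)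
  have \<sigma>_cont: "continuous_on A \<sigma>" for A
    using der by (meson continuous_at_imp_continuous_on has_vector_derivative_continuous)
  have e_norm: "norm (e t) = 1" for t by (simp add: e_def norm_exp_eq_Re)
  have e'_nz: "e' t \<noteq> 0" for t by (simp add: e'_def e_def)
  have e_eq: "e t = e s \<longleftrightarrow> t - s \<in> \<int>" for s t unfolding e_def by (rule exp_unit_eq_iff)
  have \<sigma>_eq: "\<sigma> t = \<sigma> s \<longleftrightarrow> t - s \<in> \<int>" for s t by (rule periodic_inj_eq_iff[OF per inj])
  have e_per: "e (t + 1) = e t" for t by (simp add: e_eq)
  have \<sigma>'_per: "\<sigma>' (t + 1) = \<sigma>' t" for t by (rule has_vector_derivative_periodic[OF der per])
  have e'_per: "e' (t + 1) = e' t" for t by (simp add: e'_def e_per)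
  obtain D\<sigma> where D\<sigma>: "continuous_on UNIV D\<sigma>" "\<And>s t. \<sigma> t - \<sigma> s = of_real (t - s) * D\<sigma> (s, t)" "\<And>t. D\<sigma> (t, t) = \<sigma>' t"
    using divided_difference[OF der cont] by blast
  obtain De where De: "continuous_on UNIV De" "\<And>s t. e t - e s = of_real (t - s) * De (s, t)" "\<And>t. De (t, t) = e' t"
    using divided_difference[OF e_der e'_cont] by blast
  define Q where "Q = (\<lambda>(s, t). if t - s \<in> \<int> then \<sigma>' t / e' t else (\<sigma> t - \<sigma> s) / (e t - e s))"
  \<comment> \<open>On the strip around the line \<open>t - s = n\<close> the divided differences based at \<open>s + n\<close> extend \<open>Q\<close> across the line.\<close>
  define U where "U = (\<lambda>n::int. {p::real \<times> real. \<bar>snd p - fst p - of_int n\<bar> < 1})"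
  have U_int: "t = s + of_int n" if st: "(s, t) \<in> U n" "t - s \<in> \<int>" for s t n
  proof -
    obtain m :: int where m: "t - s = of_int m" using st(2) by (auto elim: Ints_cases)
    then have "\<bar>real_of_int (m - n)\<bar> < 1" using st(1) by (simp add: U_def)
    then have "m = n" by linarith
    then show ?thesis using m by simp
  qed
  have Q_U: "Q (s, t) = D\<sigma> (s + of_int n, t) / De (s + of_int n, t)" "De (s + of_int n, t) \<noteq> 0" if "(s, t) \<in> U n" for s t n
  proof -
    have "Q (s, t) = D\<sigma> (s + of_int n, t) / De (s + of_int n, t) \<and> De (s + of_int n, t) \<noteq> 0"
    proof (cases "t - s \<in> \<int>")
      case True
      then show ?thesis using U_int[OF that True] D\<sigma>(3) De(3) e'_nz by (simp add: Q_def)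
    next
      case False
      then have ne: "t - (s + of_int n) \<noteq> 0" by (auto simp: algebra_simps)
      have \<sigma>s: "\<sigma> (s + of_int n) = \<sigma> s" "e (s + of_int n) = e s" by (simp_all add: \<sigma>_eq e_eq)
      have "e t \<noteq> e s" using False e_eq by simp
      then have De0: "De (s + of_int n, t) \<noteq> 0" using De(2)[of t "s + of_int n"] \<sigma>s by auto
      have "Q (s, t) = (of_real (t - (s + of_int n)) * D\<sigma> (s + of_int n, t)) / (of_real (t - (s + of_int n)) * De (s + of_int n, t))"
        using False D\<sigma>(2)[of t "s + of_int n"] De(2)[of t "s + of_int n"] \<sigma>s by (simp add: Q_def)
      also have "\<dots> = D\<sigma> (s + of_int n, t) / De (s + of_int n, t)"
        using ne by (simp only: mult_divide_mult_cancel_left of_real_eq_0_iff not_False_eq_True)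
      finally show ?thesis using De0 by simp
    qed
    then show "Q (s, t) = D\<sigma> (s + of_int n, t) / De (s + of_int n, t)" "De (s + of_int n, t) \<noteq> 0" by auto
  qed
  have Q_cont: "continuous_on UNIV Q"
  proof -
    have "continuous_on (\<Union>n\<in>UNIV. U n) Q"
    proof (rule continuous_on_open_UN)
      fix n show "open (U n)" unfolding U_def by (intro open_Collect_less continuous_intros)
      have "continuous_on (U n) (\<lambda>p. D\<sigma> (fst p + of_int n, snd p) / De (fst p + of_int n, snd p))"
        by (intro continuous_intros continuous_on_compose2[OF D\<sigma>(1)] continuous_on_compose2[OF De(1)])
           (use Q_U(2) in auto)
      then show "continuous_on (U n) Q"
        by (rule continuous_on_eq) (use Q_U(1) in auto)
    qed
    moreover have "(\<Union>n\<in>UNIV. U n) = UNIV"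
    proof -
      have "p \<in> U (round (snd p - fst p))" for p
        using of_int_round_abs_le[of "snd p - fst p"] by (simp add: U_def abs_minus_commute)
      then show ?thesis by auto
    qed
    ultimately show ?thesis by simp
  qed
  have Q_nz: "Q p \<noteq> 0" for p
    using e_eq \<sigma>_eq reg e'_nz by (auto simp: Q_def split: prod.splits)
  have int1: "t + 1 - s \<in> \<int> \<longleftrightarrow> t - s \<in> \<int>" for s t :: real
  proof -
    have "t + 1 - s = (t - s) + 1" by simp
    then show ?thesis by (metis Ints_1 Ints_add Ints_diff add_diff_cancel_right')
  qed
  have Q_per: "Q (s, t + 1) = Q (s, t)" for s t
    by (simp add: Q_def int1 \<sigma>'_per e'_per per e_per)
  define q where "q = (\<lambda>t. Q (0, t))"
  define m where "m = winding_number q 0"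
  have q_cont: "continuous_on A q" for A unfolding q_def
    by (intro continuous_on_compose2[OF Q_cont] continuous_intros) auto
  have q_path: "path q" "0 \<notin> path_image q" "q 1 = q 0"
    using q_cont Q_nz Q_per[of 0 0] by (auto simp: path_def path_image_def q_def)
  have q_sym: "Q (t, 0) = q t" for t
  proof (cases "t \<in> \<int>")
    case True
    then obtain n :: int where n: "t = of_int n" by (auto elim: Ints_cases)
    have "\<sigma>' t = \<sigma>' 0" "e' t = e' 0"
      using periodic_int[of \<sigma>' 0 n] periodic_int[of e' 0 n] \<sigma>'_per e'_per n by auto
    then show ?thesis using True by (simp add: q_def Q_def)
  next
    case False
    then show ?thesis by (simp add: q_def Q_def) (metis minus_diff_eq minus_divide_divide)
  qed
  have diag: "winding_number (\<lambda>t. Q (t, t)) 0 = 2 * m"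
    using winding_number_torus_diagonal[OF Q_cont Q_nz Q_per] by (simp add: q_sym m_def q_def)
  have we': "winding_number e' 0 = 1"
    by (subst winding_number_from_log[of "\<lambda>t. Ln (2 * of_real pi * \<i>) + 2 * of_real pi * \<i> * of_real t"])
       (auto simp: e'_def e_def exp_add exp_Ln intro!: continuous_intros)
  have "winding_number \<sigma>' 0 = winding_number (\<lambda>t. Q (t, t) * e' t) 0"
    by (intro winding_number_cong) (use e'_nz in \<open>auto simp: Q_def\<close>)
  also have "\<dots> = 2 * m + 1"
    by (subst winding_number_times)
       (use diag we' Q_nz e'_nz in \<open>auto simp: path_def path_image_def intro!: continuous_on_compose2[OF Q_cont]
          continuous_on_subset[OF e'_cont] continuous_intros\<close>)
  finally have turn: "winding_number \<sigma>' 0 = 2 * m + 1" .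

  \<comment> \<open>The point \<open>w = \<sigma> 0 + M * (\<zeta> - 1)\<close> lies relative to \<open>\<sigma> 0\<close>, to first order, as \<open>\<zeta>\<close> relative to \<open>1\<close>. With this choice
    the difference of \<open>(\<sigma> t - w) / (e t - \<zeta>)\<close> and \<open>q t\<close> is \<open>(q t - M) * (\<zeta> - 1) / (e t - \<zeta>)\<close>. It is small near
    \<open>t = 0\<close> and \<open>t = 1\<close> because \<open>q t\<close> is close to \<open>M\<close> and the other factor is bounded by \<open>1\<close>, and elsewhere
    because \<open>\<zeta>\<close> is close to \<open>1\<close>.\<close>
  define M where "M = q 0"
  obtain \<mu> where \<mu>: "0 < \<mu>" "\<And>t. t \<in> {0..1} \<Longrightarrow> \<mu> \<le> norm (q t)"
  proof -
    have "continuous_on {0..1} (\<lambda>t. norm (q t))" by (intro continuous_intros q_cont e_cont)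
    then obtain x where x: "x \<in> {0..1}" "\<And>t. t \<in> {0..1} \<Longrightarrow> norm (q x) \<le> norm (q t)"
      using continuous_attains_inf[of "{0..1::real}" "\<lambda>t. norm (q t)"] by force
    then show ?thesis using that[of "norm (q x)"] Q_nz by (auto simp: q_def)
  qed
  obtain K where K: "0 \<le> K" "\<And>t. t \<in> {0..1} \<Longrightarrow> norm (q t - M) \<le> K"
  proof -
    have "continuous_on {0..1} (\<lambda>t. norm (q t - M))" by (intro continuous_intros q_cont e_cont)
    then obtain x where x: "x \<in> {0..1}" "\<And>t. t \<in> {0..1} \<Longrightarrow> norm (q t - M) \<le> norm (q x - M)"
      using continuous_attains_sup[of "{0..1::real}" "\<lambda>t. norm (q t - M)"] by force
    then show ?thesis using that[of "norm (q x - M)"] by auto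
  qed
  obtain \<eta> where \<eta>: "0 < \<eta>" "\<eta> < 1/2" "\<And>t. \<bar>t\<bar> < \<eta> \<or> \<bar>t - 1\<bar> < \<eta> \<Longrightarrow> norm (q t - M) < \<mu>"
  proof -
    have "isCont q 0" "isCont q 1" using q_cont[of UNIV] by (auto simp: continuous_on_eq_continuous_at)
    then obtain d0 d1 where "d0 > 0" "d1 > 0"
       "\<And>t. dist t 0 < d0 \<Longrightarrow> dist (q t) (q 0) < \<mu>" "\<And>t. dist t 1 < d1 \<Longrightarrow> dist (q t) (q 1) < \<mu>"
      using \<mu>(1) unfolding continuous_at_eps_delta by blast
    moreover have "min (1/3) (min d0 d1) < 1/2" by linarith
    ultimately show ?thesis using that[of "min (1/3) (min d0 d1)"] q_path(3) by (auto simp: dist_norm M_def)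
  qed
  obtain d where d: "0 < d" "\<And>t. t \<in> {\<eta>..1-\<eta>} \<Longrightarrow> d \<le> norm (e t - 1)"
  proof -
    have "continuous_on {\<eta>..1-\<eta>} (\<lambda>t. norm (e t - 1))" by (intro continuous_intros q_cont e_cont)
    then obtain x where x: "x \<in> {\<eta>..1-\<eta>}" "\<And>t. t \<in> {\<eta>..1-\<eta>} \<Longrightarrow> norm (e x - 1) \<le> norm (e t - 1)"
      using continuous_attains_inf[of "{\<eta>..1-\<eta>}" "\<lambda>t. norm (e t - 1)"] \<eta> by force
    moreover have "e x \<noteq> 1"
    proof
      assume "e x = 1"
      then have "e x = e 0" by (simp add: e_def)
      then have "x \<in> \<int>" using e_eq[of x 0] by simp
      then obtain n :: int where "x = of_int n" by (auto elim: Ints_cases)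
      then show False using x(1) \<eta> by (auto, smt (verit) of_int_0_less_iff of_int_less_1_iff)
    qed
    ultimately show ?thesis using that[of "norm (e x - 1)"] by auto
  qed
  have side: "winding_number \<sigma> (\<sigma> 0 + M * (\<zeta> - 1)) = m + winding_number e \<zeta> \<and> \<sigma> 0 + M * (\<zeta> - 1) \<notin> range \<sigma>"
    if \<zeta>: "0 < norm (\<zeta> - 1)" "norm (\<zeta> - 1) < \<mu> * d / (K + \<mu>)" "\<And>t. norm (\<zeta> - 1) \<le> norm (e t - \<zeta>)" for \<zeta>
  proof -
    define R where "R = (\<lambda>t. q t + (q t - M) * (\<zeta> - 1) / (e t - \<zeta>))"
    have e\<zeta>: "e t - \<zeta> \<noteq> 0" for t using \<zeta>(1) \<zeta>(3)[of t] by auto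
    have near: "norm (R t - q t) < norm (q t)" if t: "t \<in> {0..1}" for t
    proof -
      have "norm (q t - M) * norm (\<zeta> - 1) < norm (q t) * norm (e t - \<zeta>)"
      proof (cases "t \<in> {\<eta>..1-\<eta>}")
        case False
        then have "norm (q t - M) < \<mu>" using \<eta>(3)[of t] t by auto
        then have "norm (q t - M) * norm (\<zeta> - 1) < \<mu> * norm (\<zeta> - 1)" using \<zeta>(1) by (intro mult_strict_right_mono)
        also have "\<dots> \<le> norm (q t) * norm (e t - \<zeta>)"
          by (intro mult_mono) (use \<mu> t \<zeta>(3) in auto)
        finally show ?thesis .
      next
        case True
        have "norm (\<zeta> - 1) * (K + \<mu>) < \<mu> * d" using \<zeta>(2) K(1) \<mu>(1) by (simp add: pos_less_divide_eq)
        then have "K * norm (\<zeta> - 1) < \<mu> * (d - norm (\<zeta> - 1))" by (simp add: algebra_simps)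
        moreover have "norm (q t - M) * norm (\<zeta> - 1) \<le> K * norm (\<zeta> - 1)" using K t by (intro mult_right_mono) auto
        moreover have "d - norm (\<zeta> - 1) \<le> norm (e t - \<zeta>)"
          using d(2)[OF True] norm_triangle_ineq[of "e t - \<zeta>" "\<zeta> - 1"] by simp
        then have "\<mu> * (d - norm (\<zeta> - 1)) \<le> \<mu> * norm (e t - \<zeta>)" using \<mu>(1) by (intro mult_left_mono) auto
        moreover have "\<mu> * norm (e t - \<zeta>) \<le> norm (q t) * norm (e t - \<zeta>)" using \<mu>(2)[OF t] by (intro mult_right_mono) auto
        ultimately show ?thesis by linarith
      qed
      then show ?thesis using e\<zeta>[of t] by (simp add: R_def norm_mult norm_divide divide_simps)
    qed
    have R_nz: "R t \<noteq> 0" if "t \<in> {0..1}" for t using near[OF that] by auto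
    have R_cont: "continuous_on {0..1} R" unfolding R_def using e\<zeta> by (intro continuous_intros q_cont e_cont) auto
    have e01: "e 1 = e 0" using e_per[of 0] by simp
    have wR: "winding_number R 0 = m" unfolding m_def
      by (rule winding_number_nearby_loops_eq)
         (use q_path R_cont near e01 in \<open>auto simp: path_def pathfinish_def pathstart_def R_def\<close>)
    have qe: "\<sigma> t - \<sigma> 0 = q t * (e t - 1)" for t
    proof (cases "t \<in> \<int>")
      case True
      then show ?thesis using \<sigma>_eq[of t 0] e_eq[of t 0] by (simp add: e_def)
    next
      case False
      then show ?thesis using e_eq[of t 0] by (simp add: q_def Q_def) (simp add: e_def)
    qed
    have fac: "\<sigma> t - (\<sigma> 0 + M * (\<zeta> - 1)) = R t * (e t - \<zeta>)" for t
    proof -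
      have "R t * (e t - \<zeta>) = q t * (e t - \<zeta>) + (q t - M) * (\<zeta> - 1)"
        using e\<zeta>[of t] by (simp add: R_def distrib_right)
      also have "\<dots> = (\<sigma> t - \<sigma> 0) - M * (\<zeta> - 1)" unfolding qe by (simp add: algebra_simps)
      finally show ?thesis by simp
    qed
    have out: "\<sigma> 0 + M * (\<zeta> - 1) \<notin> range \<sigma>"
    proof
      assume "\<sigma> 0 + M * (\<zeta> - 1) \<in> range \<sigma>"
      then obtain t where "\<sigma> t = \<sigma> 0 + M * (\<zeta> - 1)" by auto
      moreover have "\<sigma> (frac t) = \<sigma> t" using periodic_int[of \<sigma> "frac t" "\<lfloor>t\<rfloor>"] per by (simp add: frac_def)
      ultimately have "R (frac t) * (e (frac t) - \<zeta>) = 0" using fac[of "frac t"] by simp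
      then show False using R_nz[of "frac t"] e\<zeta>[of "frac t"] by (simp add: frac_lt_1 less_imp_le)
    qed
    have "winding_number \<sigma> (\<sigma> 0 + M * (\<zeta> - 1)) = winding_number (\<lambda>t. \<sigma> t - (\<sigma> 0 + M * (\<zeta> - 1))) 0"
      by (rule winding_number_offset)
    also have "\<dots> = winding_number (\<lambda>t. R t * (e t - \<zeta>)) 0" by (simp only: fac)
    also have "\<dots> = m + winding_number (\<lambda>t. e t - \<zeta>) 0"
      by (subst winding_number_times)
         (use R_cont R_nz e\<zeta> wR in \<open>auto simp: path_def path_image_def intro!: continuous_intros e_cont\<close>)
    finally show ?thesis using out by (simp flip: winding_number_offset)
  qed
  have pos: "winding_number \<sigma> w \<in> {0, 1}" if "w \<notin> range \<sigma>" for w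
  proof -
    have img: "path_image \<sigma> \<subseteq> range \<sigma>" by (auto simp: path_image_def)
    have "loop_free \<sigma>" unfolding loop_free_def
    proof (intro ballI impI)
      fix x y :: real assume xy: "x \<in> {0..1}" "y \<in> {0..1}" "\<sigma> x = \<sigma> y"
      then obtain n :: int where n: "x - y = of_int n" using \<sigma>_eq by (auto elim: Ints_cases)
      then have "real_of_int n \<le> 1" "real_of_int n \<ge> -1" using xy by auto
      then have "n = 0 \<or> n = 1 \<or> n = -1" by linarith
      then show "x = y \<or> x = 0 \<and> y = 1 \<or> x = 1 \<and> y = 0" using n xy by auto
    qed
    then have sp: "simple_path \<sigma>" using \<sigma>_cont by (simp add: simple_path_def path_def)
    have loop: "pathfinish \<sigma> = pathstart \<sigma>" using per[of 0] by (simp add: pathfinish_def pathstart_def)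
    have zo: "winding_number \<sigma> z = 0" if "z \<in> outside (path_image \<sigma>)" for z
      using winding_number_zero_in_outside sp loop that simple_path_imp_path by blast
    have "c \<notin> outside (path_image \<sigma>)" using zo[of c] c(2) by auto
    moreover have "c \<notin> path_image \<sigma>" using c(1) img by auto
    ultimately have "c \<in> inside (path_image \<sigma>)" using inside_Un_outside[of "path_image \<sigma>"] by blast
    then have "\<And>z. z \<in> inside (path_image \<sigma>) \<Longrightarrow> winding_number \<sigma> z = 1"
      using simple_closed_path_winding_number_inside[OF sp] c(2) by (metis one_neq_neg_one)
    moreover have "w \<in> inside (path_image \<sigma>) \<or> w \<in> outside (path_image \<sigma>)"
      using that img inside_Un_outside[of "path_image \<sigma>"] by blast
    ultimately show ?thesis using zo by auto
  qed
  have "0 < \<mu> * d / (K + \<mu>)" using \<mu> d K by auto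
  then have "0 < min 1 (\<mu> * d / (K + \<mu>))" by linarith
  then obtain \<epsilon> where "0 < \<epsilon>" "\<epsilon> < min 1 (\<mu> * d / (K + \<mu>))" using dense by blast
  then have \<epsilon>: "0 < \<epsilon>" "\<epsilon> < 1" "\<epsilon> < \<mu> * d / (K + \<mu>)" by linarith+
  have ecirc: "e = circlepath 0 1" by (auto simp: e_def circlepath)
  have "winding_number e (of_real (1 - \<epsilon>)) = 1"
    unfolding ecirc using \<epsilon> by (intro winding_number_circlepath) (simp add: norm_of_real del: of_real_diff)
  moreover have "\<epsilon> \<le> norm (e t - of_real (1 - \<epsilon>))" for t
    using norm_triangle_ineq2[of "e t" "of_real (1 - \<epsilon>)"] \<epsilon> unfolding e_norm norm_of_real by linarith
  ultimately have s1: "winding_number \<sigma> (\<sigma> 0 + M * (of_real (1 - \<epsilon>) - 1)) = m + 1 \<and> \<sigma> 0 + M * (of_real (1 - \<epsilon>) - 1) \<notin> range \<sigma>"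
    using side[of "of_real (1 - \<epsilon>)"] \<epsilon> by auto
  have "winding_number e (of_real (1 + \<epsilon>)) = 0"
    unfolding ecirc using \<epsilon> by (intro winding_number_zero_outside[where s = "cball 0 1"])
       (auto simp: path_image_circlepath_nonneg norm_of_real simp del: of_real_add)
  moreover have "\<epsilon> \<le> norm (e t - of_real (1 + \<epsilon>))" for t
    using norm_triangle_ineq3[of "e t" "of_real (1 + \<epsilon>)"] \<epsilon> unfolding e_norm norm_of_real by linarith
  ultimately have s2: "winding_number \<sigma> (\<sigma> 0 + M * (of_real (1 + \<epsilon>) - 1)) = m + 0 \<and> \<sigma> 0 + M * (of_real (1 + \<epsilon>) - 1) \<notin> range \<sigma>"
    using side[of "of_real (1 + \<epsilon>)"] \<epsilon> by auto
  have "m + 1 \<in> {0, 1}" using s1 pos by metis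
  moreover have "m + 0 \<in> {0, 1}" using s2 pos by metis
  ultimately have "m = 0 \<or> m = 1" "m + 1 = 0 \<or> m + 1 = 1" by auto
  then have "m = 0" by (auto simp: add_eq_0_iff)
  then show ?thesis using turn by simp
qed

section \<open>Homology classes of loops with a lift to a vector space\<close>

lemma homologous_rel_set_add:
  assumes "singular_relcycle p X S a" "singular_relcycle p X S b"
  shows "homologous_rel_set p X S a \<otimes>\<^bsub>relative_homology_group (int p) X S\<^esub> homologous_rel_set p X S b
    = homologous_rel_set p X S (a + b)"
  using normal.rcos_sum[OF normal_subgroup_singular_relboundary_relcycle[of p X S], of a b] assms
  by (simp add: nontrivial_relative_homology_group right_coset_singular_relboundary FactGroup_def)

lemma singular_cycle_euclidean_imp_boundary:
  assumes "singular_relcycle 1 (euclidean :: 'v::real_normed_vector topology) {} c"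
  shows "singular_relboundary 1 (euclidean :: 'v topology) {} c"
proof -
  have "contractible_space (euclidean :: 'v topology)"
    using contractible_space_top_of_set[of "UNIV :: 'v set"] by (simp add: convex_imp_contractible)
  then have "trivial_group (homology_group (int 1) (euclidean :: 'v topology))"
    using trivial_reduced_homology_group_contractible_space[of "euclidean :: 'v topology" 1]
    by (simp add: un_reduced_homology_group)
  then have "carrier (homology_group (int 1) (euclidean :: 'v topology)) = {\<one>\<^bsub>homology_group (int 1) (euclidean :: 'v topology)\<^esub>}"
    unfolding trivial_group_def by blast
  then have "carrier (homology_group (int 1) (euclidean :: 'v topology)) = {singular_relboundary_set 1 euclidean {}}"
    unfolding one_relative_homology_group .
  moreover have "homologous_rel_set 1 euclidean {} c \<in> carrier (homology_group (int 1) (euclidean :: 'v topology))"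
    unfolding carrier_relative_homology_group by (rule imageI) (use assms in simp)
  ultimately have "homologous_rel_set 1 euclidean {} c = singular_relboundary_set 1 (euclidean :: 'v topology) {}"
    by (simp only: singleton_iff)
  then show ?thesis by (simp add: homologous_rel_set_eq_relboundary)
qed

text \<open>Points of the standard 1-simplex are sequences \<open>x\<close> with \<open>x 0 + x 1 = 1\<close>; the entry \<open>x 1\<close> serves as the time
  parameter.\<close>

definition path_simplex :: "(real \<Rightarrow> 'a) \<Rightarrow> (nat \<Rightarrow> real) \<Rightarrow> 'a" where
  "path_simplex g = restrict (\<lambda>x. g (x 1)) (standard_simplex 1)"

definition point_simplex :: "'a \<Rightarrow> (nat \<Rightarrow> real) \<Rightarrow> 'a" where
  "point_simplex a = restrict (\<lambda>x. a) (standard_simplex 0)"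

abbreviation path_chain :: "(real \<Rightarrow> 'a) \<Rightarrow> 'a chain" where
  "path_chain g \<equiv> frag_of (path_simplex g)"

lemma standard_simplex_1_bounds: "x \<in> standard_simplex 1 \<Longrightarrow> x 1 \<in> {0..1}"
  by (auto simp: standard_simplex_def)

lemma path_simplex_cong: "(\<And>t. t \<in> {0..1} \<Longrightarrow> f t = g t) \<Longrightarrow> path_simplex f = path_simplex g"
  unfolding path_simplex_def by (intro restrict_ext) (use standard_simplex_1_bounds in blast)

lemma simplex_map_path_simplex: "simplex_map 1 F (path_simplex g) = path_simplex (F \<circ> g)"
  unfolding simplex_map_def path_simplex_def by (auto simp: restrict_def)

lemma singular_simplex_path_simplex:
  assumes "continuous_map (top_of_set {0..1}) X g"
  shows "singular_simplex 1 X (path_simplex g)"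
proof -
  let ?S = "subtopology (powertop_real UNIV) (standard_simplex 1)"
  have "continuous_map (powertop_real UNIV) euclideanreal (\<lambda>x. x (1::nat))"
    by (rule continuous_map_product_projection) auto
  then have "continuous_map ?S (top_of_set {0..1}) (\<lambda>x. x 1)"
    using standard_simplex_1_bounds
    by (auto simp: continuous_map_in_subtopology topspace_standard_simplex continuous_map_from_subtopology)
  then have "continuous_map ?S X (g \<circ> (\<lambda>x. x 1))" using assms by (rule continuous_map_compose)
  then have "continuous_map ?S X (path_simplex g)"
    by (rule continuous_map_eq) (auto simp: path_simplex_def)
  then show ?thesis by (simp add: singular_simplex_def path_simplex_def)
qed

lemma chain_boundary_path_chain:
  "chain_boundary 1 (path_chain g) = frag_of (point_simplex (g 1)) - frag_of (point_simplex (g 0))"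
proof -
  have face: "singular_face 1 k (path_simplex g) = point_simplex (g (if k = 0 then 1 else 0))" if "k \<le> 1" for k
    unfolding singular_face_def point_simplex_def One_nat_def[symmetric] diff_self_eq_0
  proof (rule restrict_ext)
    fix x :: "nat \<Rightarrow> real" assume x: "x \<in> standard_simplex 0"
    have "simplical_face k x \<in> standard_simplex 1"
      using simplical_face_in_standard_simplex[of 1 k x] that x by simp
    moreover have "simplical_face k x 1 = (if k = 0 then 1 else 0)"
      using x that by (auto simp: simplical_face_def standard_simplex_def)
    ultimately show "(path_simplex g \<circ> simplical_face k) x = g (if k = 0 then 1 else 0)"
      by (simp add: path_simplex_def del: One_nat_def)
  qed
  show ?thesis using face[of 0] face[of 1] by (simp add: chain_boundary_of)
qed

lemma singular_1_simplex_eq_path_simplex: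
  assumes "singular_simplex 1 X s"
  obtains g where "continuous_map (top_of_set {0..1}) X g" "s = path_simplex g"
proof
  define v :: "real \<Rightarrow> nat \<Rightarrow> real" where "v = (\<lambda>t i. if i = 0 then 1 - t else if i = 1 then t else 0)"
  have v: "v t \<in> standard_simplex 1" if "t \<in> {0..1}" for t
    using that by (auto simp: v_def standard_simplex_def)
  have "continuous_map (top_of_set {0..1}) (powertop_real UNIV) v"
    unfolding continuous_map_componentwise_UNIV
  proof
    fix k :: nat
    have "continuous_on {0..1} (\<lambda>x. v x k)" unfolding v_def
      by (cases "k = 0"; cases "k = 1"; simp; intro continuous_intros)
    then show "continuous_map (top_of_set {0..1}) euclideanreal (\<lambda>x. v x k)" by simp
  qed
  then have "continuous_map (top_of_set {0..1}) (subtopology (powertop_real UNIV) (standard_simplex 1)) v"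
    using v by (simp add: continuous_map_in_subtopology Pi_iff)
  then show "continuous_map (top_of_set {0..1}) X (s \<circ> v)"
    by (rule continuous_map_compose) (use assms in \<open>simp add: singular_simplex_def\<close>)
  have "v (x 1) = x" if x: "x \<in> standard_simplex 1" for x
  proof
    fix i
    have "x 0 + x 1 = 1" "\<And>i. i > 1 \<Longrightarrow> x i = 0" using x by (auto simp: standard_simplex_def)
    then show "v (x 1) i = x i" by (cases "i = 0"; cases "i = 1") (auto simp: v_def)
  qed
  then show "s = path_simplex (s \<circ> v)"
    using assms unfolding singular_simplex_def path_simplex_def
    by (intro extensionalityI[where A = "standard_simplex 1"]) auto
qed

lemma closed_path_chain_boundary:
  fixes p :: "'v::real_normed_vector \<Rightarrow> 'a"
  assumes p: "continuous_map euclidean X p"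
    and c: "singular_chain 1 (euclidean :: 'v topology) c" "chain_boundary 1 c = 0"
  shows "singular_relboundary 1 X {} (chain_map 1 p c)"
proof -
  have "singular_relcycle 1 (euclidean :: 'v topology) {} c" using c by (simp add: singular_cycle)
  then have "singular_relboundary 1 (euclidean :: 'v topology) {} c" by (rule singular_cycle_euclidean_imp_boundary)
  then show ?thesis by (rule singular_relboundary_chain_map[OF _ p]) auto
qed

lemma singular_chain_path_chain:
  fixes g :: "real \<Rightarrow> 'v::topological_space"
  shows "continuous_on {0..1} g \<Longrightarrow> singular_chain 1 euclidean (path_chain g)"
  by (simp add: singular_chain_of singular_simplex_path_simplex del: One_nat_def)

lemma chain_map_path_chain: "chain_map 1 p (path_chain g) = path_chain (p \<circ> g)"
  by (simp add: simplex_map_path_simplex del: One_nat_def)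

definition period :: "('v::real_vector \<Rightarrow> 'a) \<Rightarrow> 'v \<Rightarrow> bool" where
  "period p m \<longleftrightarrow> (\<forall>v. p (v + m) = p v)"

lemma period_0: "period p 0" by (simp add: period_def)
lemma period_add: "period p m \<Longrightarrow> period p m' \<Longrightarrow> period p (m + m')"
  by (simp add: period_def flip: add.assoc)
lemma period_minus: "period p m \<Longrightarrow> period p (- m)"
  unfolding period_def
proof
  fix v assume "\<forall>v. p (v + m) = p v"
  from spec[OF this, of "v + - m"] show "p (v + - m) = p v" by simp
qed

lemma period_shift_linepath: "period p m \<Longrightarrow> p \<circ> linepath (a + m) (b + m) = p \<circ> linepath a b"
proof
  fix t assume m: "period p m"
  have "linepath (a + m) (b + m) t = linepath a b t + m" by (simp add: linepath_def algebra_simps)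
  then show "(p \<circ> linepath (a + m) (b + m)) t = (p \<circ> linepath a b) t" using m by (simp add: period_def)
qed

text \<open>Let \<open>m = g 1 - g 0\<close>. In the vector space, the lift \<open>g\<close> and the segments from \<open>0\<close> to \<open>g 0\<close>,
  from \<open>0\<close> to \<open>m\<close> and from \<open>m\<close> to \<open>m + g 0\<close> form a cycle, which bounds as the space is contractible. Under
  \<open>p\<close> the first and the last segment have the same image and cancel.\<close>

lemma homologous_lifted_loop:
  fixes p :: "'v::real_normed_vector \<Rightarrow> 'a"
  assumes p: "continuous_map euclidean X p" and g: "continuous_on {0..1} g" and m: "period p (g 1 - g 0)"
  shows "homologous_rel 1 X {} (path_chain (p \<circ> g)) (path_chain (p \<circ> linepath 0 (g 1 - g 0)))"
proof -
  define m where "m = g 1 - g 0"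
  define c where "c = path_chain (linepath 0 (g 0)) + path_chain g - path_chain (linepath (0 + m) (g 0 + m)) - path_chain (linepath 0 m)"
  have "singular_relboundary 1 X {} (chain_map 1 p c)"
  proof (rule closed_path_chain_boundary[OF p])
    show "singular_chain 1 euclidean c" unfolding c_def
      by (intro singular_chain_add singular_chain_diff singular_chain_path_chain g continuous_on_linepath)
    show "chain_boundary 1 c = 0" unfolding c_def
      by (simp add: chain_boundary_add chain_boundary_diff chain_boundary_path_chain linepath_0' linepath_1' m_def
           del: One_nat_def)
  qed
  also have "chain_map 1 p c = path_chain (p \<circ> g) - path_chain (p \<circ> linepath 0 m)"
    unfolding c_def chain_map_add chain_map_diff chain_map_path_chain
    using period_shift_linepath[OF m, folded m_def, of 0 "g 0"] by simp
  finally show ?thesis by (simp add: homologous_rel_def m_def)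
qed

text \<open>The triangle with vertices \<open>0\<close>, \<open>m\<close> and \<open>m + m'\<close> bounds, and \<open>p\<close> does not distinguish its side from \<open>m\<close> to
  \<open>m + m'\<close> from the segment from \<open>0\<close> to \<open>m'\<close>.\<close>

lemma homologous_period_add:
  fixes p :: "'v::real_normed_vector \<Rightarrow> 'a"
  assumes p: "continuous_map euclidean X p" and m: "period p m"
  shows "homologous_rel 1 X {} (path_chain (p \<circ> linepath 0 (m + m'))) (path_chain (p \<circ> linepath 0 m) + path_chain (p \<circ> linepath 0 m'))"
proof -
  define c where "c = path_chain (linepath 0 (m + m')) - (path_chain (linepath 0 m) + path_chain (linepath (0 + m) (m' + m)))"
  have "singular_relboundary 1 X {} (chain_map 1 p c)"
  proof (rule closed_path_chain_boundary[OF p])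
    show "singular_chain 1 euclidean c" unfolding c_def
      by (intro singular_chain_add singular_chain_diff singular_chain_path_chain continuous_on_linepath)
    show "chain_boundary 1 c = 0" unfolding c_def
      by (simp add: chain_boundary_add chain_boundary_diff chain_boundary_path_chain linepath_0' linepath_1' add.commute
           del: One_nat_def)
  qed
  also have "chain_map 1 p c = path_chain (p \<circ> linepath 0 (m + m')) - (path_chain (p \<circ> linepath 0 m) + path_chain (p \<circ> linepath 0 m'))"
    unfolding c_def chain_map_add chain_map_diff chain_map_path_chain
    using period_shift_linepath[OF m, of 0 m'] by simp
  finally show ?thesis by (simp add: homologous_rel_def)
qed

lemma homologous_period_int:
  fixes p :: "real \<Rightarrow> 'a"
  assumes p: "continuous_map euclidean X p" and m: "period p 1"
  shows "homologous_rel 1 X {} (path_chain (p \<circ> linepath 0 (of_int n))) (frag_cmul n (path_chain (p \<circ> linepath 0 1)))"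
proof -
  let ?C = "\<lambda>m. path_chain (p \<circ> linepath 0 m)"
  show ?thesis
  proof (induction n rule: int_induct[where k=0])
    case base
    have "homologous_rel 1 X {} (?C (0 + 0)) (?C 0 + ?C 0)"
      by (rule homologous_period_add[OF p period_0])
    then have "singular_relboundary 1 X {} (- ?C 0)" by (simp add: homologous_rel_def)
    then show ?case
      by (simp only: homologous_rel_def singular_relboundary_minus of_int_0 frag_cmul_zero diff_zero)
  next
    case (step1 i)
    have "homologous_rel 1 X {} (?C (1 + of_int i)) (?C 1 + ?C (of_int i))"
      by (rule homologous_period_add[OF p m])
    moreover have "homologous_rel 1 X {} (?C 1 + ?C (of_int i)) (?C 1 + frag_cmul i (?C 1))"
      by (intro homologous_rel_add step1) auto
    ultimately have "homologous_rel 1 X {} (?C (1 + of_int i)) (?C 1 + frag_cmul i (?C 1))"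
      using homologous_rel_trans by blast
    moreover have "frag_cmul (i + 1) (?C 1) = ?C 1 + frag_cmul i (?C 1)" by (simp add: frag_cmul_distrib)
    moreover have "real_of_int (i + 1) = 1 + of_int i" by simp
    ultimately show ?case by (simp only:)
  next
    case (step2 i)
    have "homologous_rel 1 X {} (?C (1 + of_int (i - 1))) (?C 1 + ?C (of_int (i - 1)))"
      by (rule homologous_period_add[OF p m])
    then have "homologous_rel 1 X {} (?C (of_int i) - ?C 1) ((?C 1 + ?C (of_int (i - 1))) - ?C 1)"
      by (intro homologous_rel_diff) auto
    then have "homologous_rel 1 X {} (?C (of_int (i - 1))) (?C (of_int i) - ?C 1)"
      by (simp add: homologous_rel_sym)
    moreover have "homologous_rel 1 X {} (?C (of_int i) - ?C 1) (frag_cmul i (?C 1) - ?C 1)"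
      by (intro homologous_rel_diff step2) auto
    ultimately have "homologous_rel 1 X {} (?C (of_int (i - 1))) (frag_cmul i (?C 1) - ?C 1)"
      using homologous_rel_trans by blast
    moreover have "frag_cmul (i - 1) (?C 1) = frag_cmul i (?C 1) - ?C 1" by (simp add: frag_cmul_diff_distrib)
    ultimately show ?case by (simp only:)
  qed
qed

text \<open>The standard loop generates the first homology of the circle. A 1-simplex lifts to a path in the real line.
  Modulo boundaries it is a multiple of the standard loop plus the difference of two arcs that start at \<open>1\<close>,
  end at the two end points of the simplex and depend on nothing but these end points. In a cycle the arcs
  cancel.\<close>

lemma singular_cycle_circle_homologous_loop:
  fixes c :: "complex chain"
  assumes c: "singular_relcycle 1 (top_of_set (sphere 0 1)) {} c"
  obtains n where "homologous_rel 1 (top_of_set (sphere 0 1)) {} c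
     (frag_cmul n (path_chain (\<lambda>t. exp (2 * of_real pi * \<i> * of_real t))))"
proof -
  let ?X = "top_of_set (sphere 0 1 :: complex set)"
  define e :: "real \<Rightarrow> complex" where "e = (\<lambda>t. exp (2 * of_real pi * \<i> * of_real t))"
  have e: "continuous_map euclidean ?X e"
    unfolding continuous_map_in_subtopology
    by (auto simp: e_def norm_exp_eq_Re continuous_map_iff_continuous2 intro!: continuous_intros)
  have per: "e (t + of_int n) = e t" for t n
    using exp_integer_2pi[of "of_int n"] by (simp add: e_def distrib_left exp_add mult_ac)
  have per1: "period e 1" using per[of _ 1] by (simp add: period_def)
  have pern: "period e (of_int n)" for n :: int using per by (simp add: period_def)
  \<comment> \<open>\<open>A\<close> sends a point of the circle, as a 0-simplex, to the arc chosen for it; it extends linearly to chains.\<close>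
  define A where "A = (\<lambda>s :: (nat \<Rightarrow> real) \<Rightarrow> complex. path_chain (e \<circ> linepath 0 (SOME a. e a = s (\<lambda>j. if j = 0 then 1 else 0))))"
  let ?d = "\<lambda>c. c - frag_extend A (chain_boundary 1 c)"
  have "\<exists>n. homologous_rel 1 ?X {} (?d c) (frag_cmul n (path_chain (e \<circ> linepath 0 1)))"
    if "Poly_Mapping.keys c \<subseteq> singular_simplex_set 1 ?X" for c
    using that
  proof (induction rule: frag_induction)
    case zero
    show ?case by (rule exI[of _ 0]) simp
  next
    case (diff a b)
    then obtain n m where "homologous_rel 1 ?X {} (?d a) (frag_cmul n (path_chain (e \<circ> linepath 0 1)))"
       "homologous_rel 1 ?X {} (?d b) (frag_cmul m (path_chain (e \<circ> linepath 0 1)))" by blast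
    then have "homologous_rel 1 ?X {} (?d a - ?d b) (frag_cmul (n - m) (path_chain (e \<circ> linepath 0 1)))"
      unfolding frag_cmul_diff_distrib by (rule homologous_rel_diff)
    moreover have "?d a - ?d b = ?d (a - b)"
      unfolding chain_boundary_diff frag_extend_diff by (simp add: algebra_simps)
    ultimately show ?case by metis
  next
    case (one s)
    then have "singular_simplex 1 ?X s" by simp
    then obtain \<gamma> where \<gamma>: "continuous_map (top_of_set {0..1}) ?X \<gamma>" "s = path_simplex \<gamma>"
      by (rule singular_1_simplex_eq_path_simplex)
    have \<gamma>S: "continuous_on {0..1} \<gamma>" "\<gamma> ` {0..1} \<subseteq> sphere 0 1"
      using \<gamma>(1) unfolding continuous_map_in_subtopology by (auto simp: continuous_map_iff_continuous)
    then have norm1: "norm (\<gamma> t) = 1" if "t \<in> {0..1}" for t using that by (auto simp: image_subset_iff)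
    have "0 \<notin> path_image \<gamma>" using norm1 by (force simp: path_image_def)
    then obtain q where q: "path q" "\<And>t. t \<in> {0..1} \<Longrightarrow> \<gamma> t = 0 + exp (q t)"
      using winding_number_as_continuous_log[of \<gamma> 0] \<gamma>S(1) unfolding path_def by blast
    define \<theta> where "\<theta> = (\<lambda>t. Im (q t) / (2 * pi))"
    have \<theta>c: "continuous_on {0..1} \<theta>" using q(1) unfolding \<theta>_def path_def by (intro continuous_intros) auto
    have \<theta>: "\<gamma> t = e (\<theta> t)" if t: "t \<in> {0..1}" for t
    proof -
      have "exp (Re (q t)) = 1" using norm1[OF t] q(2)[OF t] by (simp add: norm_exp_eq_Re)
      then have "q t = \<i> * of_real (Im (q t))" by (simp add: complex_eq_iff)
      then have "q t = 2 * of_real pi * \<i> * of_real (\<theta> t)" by (simp add: \<theta>_def)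
      then show ?thesis using q(2)[OF t] by (simp add: e_def)
    qed
    define x where "x = (SOME a. e a = \<gamma> 0)"
    define y where "y = (SOME a. e a = \<gamma> 1)"
    have "e x = \<gamma> 0" unfolding x_def by (rule someI[of _ "\<theta> 0"]) (use \<theta>[of 0] in simp)
    then have "e (\<theta> 0) = e x" using \<theta>[of 0] by simp
    then have "\<theta> 0 - x \<in> \<int>" unfolding e_def by (simp only: exp_unit_eq_iff)
    then obtain i :: int where i: "\<theta> 0 = x + of_int i"
      by (auto elim!: Ints_cases simp: algebra_simps)
    have "e y = \<gamma> 1" unfolding y_def by (rule someI[of _ "\<theta> 1"]) (use \<theta>[of 1] in simp)
    then have "e (\<theta> 1) = e y" using \<theta>[of 1] by simp
    then have "\<theta> 1 - y \<in> \<int>" unfolding e_def by (simp only: exp_unit_eq_iff)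
    then obtain j :: int where j: "\<theta> 1 = y + of_int j"
      by (auto elim!: Ints_cases simp: algebra_simps)
    define z where "z = path_chain \<theta> - path_chain (linepath (0 + of_int j) (y + of_int j))
        + path_chain (linepath (0 + of_int i) (x + of_int i)) - path_chain (linepath (0 + of_int i) (of_int (j - i) + of_int i))"
    have "singular_relboundary 1 ?X {} (chain_map 1 e z)"
    proof (rule closed_path_chain_boundary[OF e])
      show "singular_chain 1 euclidean z" unfolding z_def
        by (intro singular_chain_add singular_chain_diff singular_chain_path_chain continuous_on_linepath \<theta>c)
      show "chain_boundary 1 z = 0" unfolding z_def
        by (simp add: chain_boundary_add chain_boundary_diff chain_boundary_path_chain linepath_0' linepath_1' i j
             del: One_nat_def)
    qed
    also have "chain_map 1 e z = path_chain (e \<circ> \<theta>) - path_chain (e \<circ> linepath 0 y) + path_chain (e \<circ> linepath 0 x)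
        - path_chain (e \<circ> linepath 0 (of_int (j - i)))"
      unfolding z_def chain_map_add chain_map_diff chain_map_path_chain period_shift_linepath[OF pern] ..
    also have "path_chain (e \<circ> \<theta>) = frag_of s" unfolding \<gamma>(2)
      by (intro arg_cong[of _ _ frag_of] path_simplex_cong) (use \<theta> in auto)
    also have "path_chain (e \<circ> linepath 0 y) = A (point_simplex (\<gamma> 1))"
      by (simp add: A_def y_def point_simplex_def standard_simplex_0)
    also have "path_chain (e \<circ> linepath 0 x) = A (point_simplex (\<gamma> 0))"
      by (simp add: A_def x_def point_simplex_def standard_simplex_0)
    also have "frag_of s - A (point_simplex (\<gamma> 1)) + A (point_simplex (\<gamma> 0)) = ?d (frag_of s)"
      unfolding \<gamma>(2) chain_boundary_path_chain by (simp add: frag_extend_diff)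
    finally have "homologous_rel 1 ?X {} (?d (frag_of s)) (path_chain (e \<circ> linepath 0 (of_int (j - i))))"
      by (simp only: homologous_rel_def)
    moreover have "homologous_rel 1 ?X {} (path_chain (e \<circ> linepath 0 (of_int (j - i)))) (frag_cmul (j - i) (path_chain (e \<circ> linepath 0 1)))"
      by (rule homologous_period_int[OF e per1])
    ultimately show ?case using homologous_rel_trans by blast
  qed
  moreover have "Poly_Mapping.keys c \<subseteq> singular_simplex_set 1 ?X" "chain_boundary 1 c = 0"
    using c by (auto simp: singular_cycle singular_chain_def)
  ultimately obtain n where "homologous_rel 1 ?X {} (?d c) (frag_cmul n (path_chain (e \<circ> linepath 0 1)))" by blast
  moreover have "?d c = c" using \<open>chain_boundary 1 c = 0\<close> by simp
  moreover have "e \<circ> linepath 0 1 = e" by (auto simp: linepath_def)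
  ultimately show thesis using that[of n] by (simp only: e_def)
qed

section \<open>Disks with boundary on a periodically parametrised set\<close>

lemma frag_cmul_diff_right: "frag_cmul n (a - b) = frag_cmul n a - frag_cmul n b"
  using frag_cmul_distrib2[of n "a - b" b] by simp

lemma homologous_rel_cmul:
  "homologous_rel p X S a b \<Longrightarrow> homologous_rel p X S (frag_cmul n a) (frag_cmul n b)"
  unfolding homologous_rel_def frag_cmul_diff_right[symmetric] by (rule singular_relboundary_cmul)

text \<open>The kernel of the boundary map is the image of the second homology of a contractible space.\<close>

lemma inj_on_hom_boundary_euclidean:
  "inj_on (hom_boundary 2 (euclidean :: 'v::real_normed_vector topology) L) (carrier (relative_homology_group 2 euclidean L))"
proof -
  let ?E = "euclidean :: 'v topology"
  have "contractible_space ?E"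
    using contractible_space_top_of_set[of "UNIV :: 'v set"] by (simp add: convex_imp_contractible)
  then have "trivial_group (homology_group 2 ?E)"
    using trivial_reduced_homology_group_contractible_space[of ?E 2] by (simp add: un_reduced_homology_group)
  then have "carrier (homology_group 2 ?E) = {\<one>\<^bsub>homology_group 2 ?E\<^esub>}"
    unfolding trivial_group_def by blast
  moreover have "hom_induced 2 ?E {} ?E L id ` carrier (homology_group 2 ?E)
      = kernel (relative_homology_group 2 ?E L) (homology_group (2 - 1) (subtopology ?E L)) (hom_boundary 2 ?E L)"
    using homology_exactness_axiom_1[of 2 ?E L] by simp
  moreover have "hom_induced 2 ?E {} ?E L id \<one>\<^bsub>homology_group 2 ?E\<^esub> = \<one>\<^bsub>relative_homology_group 2 ?E L\<^esub>"
    by (rule hom_one[OF hom_induced_hom]) auto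
  ultimately have ker: "kernel (relative_homology_group 2 ?E L) (homology_group (2 - 1) (subtopology ?E L)) (hom_boundary 2 ?E L)
     = {\<one>\<^bsub>relative_homology_group 2 ?E L\<^esub>}" by auto
  interpret group_hom "relative_homology_group 2 ?E L" "homology_group (2 - 1) (subtopology ?E L)" "hom_boundary 2 ?E L"
    using hom_boundary_hom[of 2 ?E L] by (auto simp: group_hom_def group_hom_axioms_def)
  show ?thesis using ker inj_iff_trivial_ker by simp
qed

text \<open>The boundary of \<open>\<iota>\<close> is some multiple \<open>n\<close> of the standard loop of the circle. Naturality carries this to the
  boundary loop of \<open>u\<close>, which may be replaced by the image of a straight segment between its lifted end points.
  The multiple \<open>n\<close> is the same for all disks.\<close>

lemma disk_boundary_class:
  fixes p :: "'v::real_normed_vector \<Rightarrow> 'a::real_normed_vector"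
  assumes \<iota>: "\<iota> \<in> carrier (relative_homology_group 2 (top_of_set (cball 0 1 :: complex set)) (sphere 0 1))"
    and p: "continuous_map euclidean (top_of_set L) p"
  obtains n where
    "\<And>u g. continuous_on (cball 0 1) u \<Longrightarrow> u ` sphere 0 1 \<subseteq> L \<Longrightarrow> continuous_on {0..1} g \<Longrightarrow> period p (g 1 - g 0) \<Longrightarrow>
       (\<And>t. t \<in> {0..1} \<Longrightarrow> u (exp (2 * of_real pi * \<i> * of_real t)) = p (g t)) \<Longrightarrow>
       hom_boundary 2 euclidean L (hom_induced 2 (top_of_set (cball 0 1)) (sphere 0 1) euclidean L u \<iota>)
        = homologous_rel_set 1 (top_of_set L) {} (frag_cmul n (path_chain (p \<circ> linepath 0 (g 1 - g 0))))"
proof -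
  let ?B = "top_of_set (cball 0 1 :: complex set)" and ?S = "top_of_set (sphere 0 1 :: complex set)"
  let ?e = "\<lambda>t::real. exp (2 * of_real pi * \<i> * of_real t)"
  have sub: "subtopology ?B (sphere 0 1) = ?S"
    by (simp add: subtopology_subtopology inf_absorb2)
  have "hom_boundary 2 ?B (sphere 0 1) \<iota> \<in> carrier (homology_group (int 1) ?S)"
    using hom_boundary_carrier[of 2 ?B "sphere 0 1" \<iota>] unfolding sub by simp
  then obtain c where c: "singular_relcycle 1 ?S {} c" "hom_boundary 2 ?B (sphere 0 1) \<iota> = homologous_rel_set 1 ?S {} c"
    unfolding carrier_relative_homology_group by blast
  obtain n where n: "homologous_rel 1 ?S {} c (frag_cmul n (path_chain ?e))"
    using singular_cycle_circle_homologous_loop[OF c(1)] by blast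
  have cn: "hom_boundary 2 ?B (sphere 0 1) \<iota> = homologous_rel_set 1 ?S {} (frag_cmul n (path_chain ?e))"
    unfolding c(2) homologous_rel_set_eq by (rule n)
  have cyc: "singular_relcycle 1 ?S {} (frag_cmul n (path_chain ?e))"
    using homologous_rel_singular_relcycle_1[OF n c(1)] .
  show thesis
  proof (rule that)
    fix u :: "complex \<Rightarrow> 'a" and g :: "real \<Rightarrow> 'v"
    assume u: "continuous_on (cball 0 1) u" "u ` sphere 0 1 \<subseteq> L" and g: "continuous_on {0..1} g" and per: "period p (g 1 - g 0)"
      and ug: "\<And>t. t \<in> {0..1} \<Longrightarrow> u (?e t) = p (g t)"
    have uB: "continuous_map ?B euclidean u" using u(1) by (simp add: continuous_map_iff_continuous)
    have uS: "u \<in> sphere 0 1 \<rightarrow> L" using u(2) by auto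
    have "continuous_on (sphere 0 1) u" by (rule continuous_on_subset[OF u(1)]) auto
    then have uSL: "continuous_map ?S (top_of_set L) u"
      unfolding continuous_map_in_subtopology using u(2) \<open>continuous_on (sphere 0 1) u\<close> by (auto simp: continuous_map_iff_continuous)
    have "hom_boundary 2 euclidean L (hom_induced 2 ?B (sphere 0 1) euclidean L u \<iota>)
       = hom_induced (2 - 1) (subtopology ?B (sphere 0 1)) {} (top_of_set L) {} u (hom_boundary 2 ?B (sphere 0 1) \<iota>)"
      using fun_cong[OF naturality_hom_induced[OF uB uS, of 2], of \<iota>] by (simp only: o_apply)
    also have "\<dots> = hom_induced (int 1) ?S {} (top_of_set L) {} u (homologous_rel_set 1 ?S {} (frag_cmul n (path_chain ?e)))"
      unfolding cn sub by simp
    also have "\<dots> = homologous_rel_set 1 (top_of_set L) {} (chain_map 1 u (frag_cmul n (path_chain ?e)))"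
      by (rule hom_induced_chain_map[OF uSL _ cyc]) auto
    also have "chain_map 1 u (frag_cmul n (path_chain ?e)) = frag_cmul n (path_chain (u \<circ> ?e))"
      by (simp only: chain_map_cmul chain_map_path_chain)
    also have "path_simplex (u \<circ> ?e) = path_simplex (p \<circ> g)"
      by (rule path_simplex_cong) (use ug in auto)
    also have "homologous_rel_set 1 (top_of_set L) {} (frag_cmul n (path_chain (p \<circ> g)))
       = homologous_rel_set 1 (top_of_set L) {} (frag_cmul n (path_chain (p \<circ> linepath 0 (g 1 - g 0))))"
      unfolding homologous_rel_set_eq by (rule homologous_rel_cmul[OF homologous_lifted_loop[OF p g per]])
    finally show "hom_boundary 2 euclidean L (hom_induced 2 ?B (sphere 0 1) euclidean L u \<iota>)
       = homologous_rel_set 1 (top_of_set L) {} (frag_cmul n (path_chain (p \<circ> linepath 0 (g 1 - g 0))))" .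
  qed
qed

text \<open>Relative classes are determined by their boundaries, and boundaries of disks by the period that separates
  the end points of a lift. The set \<open>D m\<close> consists of the class (there is at most one) with the boundary that
  belongs to the period \<open>m\<close>. Since periods add as the loops do, \<open>D\<close> behaves like a homomorphism, and a
  relation between classes of disks can be verified on the periods.\<close>

lemma disk_classes_by_period:
  fixes p :: "'v::real_normed_vector \<Rightarrow> 'a::real_normed_vector"
  assumes \<iota>: "\<iota> \<in> carrier (relative_homology_group 2 (top_of_set (cball 0 1 :: complex set)) (sphere 0 1))"
    and p: "continuous_on UNIV p" "range p \<subseteq> L"
  defines "G \<equiv> relative_homology_group 2 euclidean L"
  obtains D where
    "\<And>u g. continuous_on (cball 0 1) u \<Longrightarrow> u ` sphere 0 1 \<subseteq> L \<Longrightarrow> continuous_on {0..1} g \<Longrightarrow> period p (g 1 - g 0) \<Longrightarrow>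
       (\<And>t. t \<in> {0..1} \<Longrightarrow> u (exp (2 * of_real pi * \<i> * of_real t)) = p (g t)) \<Longrightarrow>
       hom_induced 2 (top_of_set (cball 0 1)) (sphere 0 1) euclidean L u \<iota> \<in> D (g 1 - g 0)"
    "\<And>m. D m \<subseteq> carrier G"
    "\<And>m m' a b. period p m \<Longrightarrow> period p m' \<Longrightarrow> a \<in> D m \<Longrightarrow> b \<in> D m' \<Longrightarrow> a \<otimes>\<^bsub>G\<^esub> b \<in> D (m + m')"
    "\<And>m a. period p m \<Longrightarrow> a \<in> D m \<Longrightarrow> inv\<^bsub>G\<^esub> a \<in> D (- m)"
    "\<And>m a (n::nat). period p m \<Longrightarrow> a \<in> D m \<Longrightarrow> a [^]\<^bsub>G\<^esub> n \<in> D (of_nat n *\<^sub>R m)"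
    "\<And>m a b. a \<in> D m \<Longrightarrow> b \<in> D m \<Longrightarrow> a = b"
proof -
  let ?XL = "top_of_set L"
  have pm: "continuous_map euclidean ?XL p"
    unfolding continuous_map_in_subtopology using p by (auto simp: continuous_map_iff_continuous2)
  obtain n where n: "\<And>u g. continuous_on (cball 0 1) u \<Longrightarrow> u ` sphere 0 1 \<subseteq> L \<Longrightarrow> continuous_on {0..1} g \<Longrightarrow> period p (g 1 - g 0) \<Longrightarrow>
       (\<And>t. t \<in> {0..1} \<Longrightarrow> u (exp (2 * of_real pi * \<i> * of_real t)) = p (g t)) \<Longrightarrow>
       hom_boundary 2 euclidean L (hom_induced 2 (top_of_set (cball 0 1)) (sphere 0 1) euclidean L u \<iota>)
        = homologous_rel_set 1 ?XL {} (frag_cmul n (path_chain (p \<circ> linepath 0 (g 1 - g 0))))"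
    using disk_boundary_class[OF \<iota> pm] by blast
  define C where "C m = frag_cmul n (path_chain (p \<circ> linepath 0 m))" for m
  define h where "h m = homologous_rel_set 1 ?XL {} (C m)" for m
  let ?H = "homology_group 1 ?XL"
  let ?\<Delta> = "hom_boundary 2 euclidean L"
  define D where "D m = {a \<in> carrier G. ?\<Delta> a = h m}" for m
  have cyc: "singular_relcycle 1 ?XL {} (C m)" if m: "period p m" for m
  proof -
    have "singular_chain 1 ?XL (chain_map 1 p (path_chain (linepath 0 m)))"
      by (rule singular_chain_chain_map[OF singular_chain_path_chain pm]) (rule continuous_on_linepath)
    moreover have "p m = p 0" using m unfolding period_def by (metis add_0)
    then have "chain_boundary 1 (path_chain (p \<circ> linepath 0 m)) = 0"
      unfolding chain_boundary_path_chain by (simp add: linepath_0' linepath_1')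
    ultimately have "singular_relcycle 1 ?XL {} (path_chain (p \<circ> linepath 0 m))"
      by (simp only: singular_cycle chain_map_path_chain)
    then show ?thesis unfolding C_def by (rule singular_relcycle_cmul)
  qed
  have h_add: "h (m + m') = h m \<otimes>\<^bsub>?H\<^esub> h m'" if m: "period p m" "period p m'" for m m'
  proof -
    have "homologous_rel 1 ?XL {} (C (m + m')) (C m + C m')"
      unfolding C_def frag_cmul_distrib2[symmetric] by (rule homologous_rel_cmul[OF homologous_period_add[OF pm m(1)]])
    then have "h (m + m') = homologous_rel_set 1 ?XL {} (C m + C m')"
      unfolding h_def homologous_rel_set_eq .
    then show ?thesis unfolding h_def using homologous_rel_set_add[OF cyc[OF m(1)] cyc[OF m(2)]] by simp
  qed
  interpret \<Delta>: group_hom G ?H ?\<Delta>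
    using hom_boundary_hom[of 2 euclidean L] by (auto simp: group_hom_def group_hom_axioms_def G_def)
  have h_carr: "h m \<in> carrier ?H" if "period p m" for m
    using cyc[OF that] carrier_relative_homology_group[of 1 ?XL "{}"] by (auto simp: h_def)
  have h0: "h 0 = \<one>\<^bsub>?H\<^esub>"
    using h_add[OF period_0 period_0] \<Delta>.H.l_cancel_one[OF h_carr[OF period_0] h_carr[OF period_0]] by simp
  have D_add: "a \<otimes>\<^bsub>G\<^esub> b \<in> D (m + m')" if "period p m" "period p m'" "a \<in> D m" "b \<in> D m'" for m m' a b
    using that by (auto simp: D_def h_add)
  show thesis
  proof (rule that[of D])
    show "hom_induced 2 (top_of_set (cball 0 1)) (sphere 0 1) euclidean L u \<iota> \<in> D (g 1 - g 0)"
      if "continuous_on (cball 0 1) u" "u ` sphere 0 1 \<subseteq> L" "continuous_on {0..1} g" "period p (g 1 - g 0)"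
       "\<And>t. t \<in> {0..1} \<Longrightarrow> u (exp (2 * of_real pi * \<i> * of_real t)) = p (g t)" for u g
      using n[OF that] hom_induced_carrier[of 2 "top_of_set (cball 0 1)" "sphere 0 1" euclidean L u \<iota>]
      by (simp add: D_def h_def C_def G_def)
    show "D m \<subseteq> carrier G" for m by (auto simp: D_def)
    show "inv\<^bsub>G\<^esub> a \<in> D (- m)" if m: "period p m" "a \<in> D m" for m a
    proof -
      have "h (- m) \<otimes>\<^bsub>?H\<^esub> h m = \<one>\<^bsub>?H\<^esub>" using h_add[OF period_minus[OF m(1)] m(1)] h0 by simp
      then have "inv\<^bsub>?H\<^esub> (h m) = h (- m)"
        by (rule \<Delta>.H.inv_equality) (use h_carr m(1) period_minus in auto)
      then show ?thesis using m(2) by (auto simp: D_def)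
    qed
    show "a [^]\<^bsub>G\<^esub> n \<in> D (of_nat n *\<^sub>R m)" if m: "period p m" "a \<in> D m" for m a and n :: nat
    proof -
      have "period p (of_nat n *\<^sub>R m) \<and> a [^]\<^bsub>G\<^esub> n \<in> D (of_nat n *\<^sub>R m)"
      proof (induction n)
        case 0
        show ?case using h0 by (simp add: D_def period_0)
      next
        case (Suc n)
        have "real (Suc n) *\<^sub>R m = real n *\<^sub>R m + m" by (simp add: algebra_simps)
        then show ?case using D_add[of "real n *\<^sub>R m" m] Suc m period_add[of p "real n *\<^sub>R m" m] by simp
      qed
      then show ?thesis ..
    qed
    show "a = b" if "a \<in> D m" "b \<in> D m" for a b m
      using inj_on_hom_boundary_euclidean[of L] that unfolding inj_on_def D_def G_def by auto
  qed (use D_add in auto)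
qed

section \<open>The squared phase of a tangent space\<close>

lemma span_columns:
  fixes A :: "complex^'n^'n"
  assumes "inj (\<lambda>j. column j A)"
  shows "span (columns A) = {A *v (\<chi> j. of_real (c j)) | c. True}"
proof -
  have cols: "columns A = range (\<lambda>j. column j A)" by (auto simp: columns_def)
  have "span (columns A) = range (\<lambda>u. \<Sum>v\<in>columns A. u v *\<^sub>R v)"
    by (rule real_vector.span_finite) (simp add: cols)
  also have "\<dots> = {A *v (\<chi> j. of_real (c j)) | c. True}"
  proof -
    let ?F = "\<lambda>u. \<Sum>v\<in>columns A. u v *\<^sub>R v" and ?H = "\<lambda>c. A *v (\<chi> j. of_real (c j))"
    have F: "?F u = ?H (\<lambda>j. u (column j A))" for u
      unfolding cols sum.reindex[OF assms] matrix_mult_sum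
      by (auto intro!: sum.cong simp: vec_eq_iff scaleR_conv_of_real[where 'a = complex])
    have K: "?F (\<lambda>v. c (inv_into UNIV (\<lambda>j. column j A) v)) = ?H c" for c :: "'n \<Rightarrow> real"
      unfolding F by (simp add: inv_f_f[OF assms])
    show ?thesis
    proof (intro subset_antisym subsetI)
      fix x assume "x \<in> range ?F"
      then obtain u where "x = ?F u" by (rule rangeE)
      then show "x \<in> {?H c | c. True}" unfolding F by (intro CollectI exI conjI) auto
    next
      fix x assume "x \<in> {?H c | c. True}"
      then obtain c where "x = ?H c" by (elim CollectE exE conjE)
      then have "x = ?F (\<lambda>v. c (inv_into UNIV (\<lambda>j. column j A) v))" unfolding K .
      then show "x \<in> range ?F" by simp
    qed
  qed
  finally show ?thesis .
qed

lemma det_of_real: "det (\<chi> i j. complex_of_real (R $ i $ j)) = of_real (det (R :: real^'n^'n))"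
  by (simp add: det_def)

lemma real_span_columns_subset_obtains_matrix:
  fixes A B :: "complex^'n^'n"
  assumes "inj (\<lambda>j. column j B)" "span (columns A) \<subseteq> span (columns B)"
  obtains R :: "real^'n^'n" where "A = B ** (\<chi> i j. of_real (R $ i $ j))"
proof -
  have "column j A \<in> span (columns B)" for j
    using assms(2) real_vector.span_base[of "column j A" "columns A"] by (auto simp: columns_def)
  then have "\<forall>j. \<exists>c. column j A = B *v (\<chi> i. of_real (c i))" unfolding span_columns[OF assms(1)] by blast
  then obtain c where c: "\<And>j. column j A = B *v (\<chi> i. of_real (c j i))" by metis
  have "A = B ** (\<chi> i j. of_real ((\<chi> i j. c j i :: real^'n^'n) $ i $ j))"
    using c by (simp add: vec_eq_iff matrix_matrix_mult_def matrix_vector_mult_def column_def)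
  then show thesis by (rule that)
qed

lemma tangent_frame_det_nonzero:
  fixes B :: "complex^'n^'n"
  assumes "det B \<noteq> 0" "span (columns B) = tangent_space L p"
  shows "tangent_frame L p B"
proof -
  have inj: "inj (\<lambda>j. column j B)"
    using assms(1) det_identical_columns by (metis injI)
  have cols: "columns B = range (\<lambda>j. column j B)" by (auto simp: columns_def)
  have "independent (columns B)"
  proof
    assume "dependent (columns B)"
    then obtain u where u: "\<exists>v\<in>columns B. u v \<noteq> 0" "(\<Sum>v\<in>columns B. u v *\<^sub>R v) = 0"
      using real_vector.dependent_finite[of "columns B"] by (auto simp: cols)
    have "(\<Sum>v\<in>columns B. u v *\<^sub>R v) = B *v (\<chi> j. of_real (u (column j B)))"
      unfolding cols sum.reindex[OF inj] matrix_mult_sum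
      by (auto intro!: sum.cong simp: vec_eq_iff scaleR_conv_of_real[where 'a = complex])
    then have "B *v (\<chi> j. of_real (u (column j B))) = 0" using u by simp
    moreover have "invertible B" using assms(1) invertible_det_nz by blast
    ultimately have "(\<chi> j. complex_of_real (u (column j B))) = 0"
      using matrix_left_invertible_ker[of B] unfolding invertible_def by blast
    then have "u (column j B) = 0" for j by (simp add: vec_eq_iff)
    then show False using u(1) by (auto simp: cols)
  qed
  then show ?thesis using inj assms by (simp add: tangent_frame_def)
qed

lemma sgn_of_real_squared: "d \<noteq> 0 \<Longrightarrow> (sgn (complex_of_real d))\<^sup>2 = 1"
  by (auto simp: sgn_of_real sgn_if)

text \<open>Two frames of the same tangent space differ by a real matrix, in both directions, so the determinant of this
  matrix is a nonzero real number and its sign disappears in the square. The phase can therefore be computed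
  from any frame.\<close>

lemma maslov_phase_eq:
  fixes B :: "complex^'n^'n"
  assumes B: "det B \<noteq> 0" "span (columns B) = tangent_space L p"
  shows "maslov_phase L p = (sgn (det B))\<^sup>2"
proof -
  define A where "A = (SOME A. tangent_frame L p A)"
  have A: "tangent_frame L p A"
    unfolding A_def by (rule someI) (rule tangent_frame_det_nonzero[OF B])
  have fB: "tangent_frame L p B" by (rule tangent_frame_det_nonzero[OF B])
  obtain R where R: "A = B ** (\<chi> i j. of_real (R $ i $ j))"
    using real_span_columns_subset_obtains_matrix[of B A] A fB by (auto simp: tangent_frame_def)
  obtain S where S: "B = A ** (\<chi> i j. of_real (S $ i $ j))"
    using real_span_columns_subset_obtains_matrix[of A B] A fB by (auto simp: tangent_frame_def)
  have dA: "det A = det B * of_real (det R)" by (subst R) (simp add: det_mul det_of_real)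
  moreover have "det B = det A * of_real (det S)" by (subst S) (simp add: det_mul det_of_real)
  ultimately have "det R \<noteq> 0" using B(1) by auto
  then show ?thesis
    by (simp add: maslov_phase_def A_def[symmetric] dA sgn_mult power_mult_distrib sgn_of_real_squared)
qed

section \<open>Velocities of curves in an embedded loop\<close>

lemma has_vector_derivative_vec:
  fixes f :: "real \<Rightarrow> complex^'n"
  assumes "\<And>i. ((\<lambda>t. f t $ i) has_vector_derivative f' $ i) F"
  shows "(f has_vector_derivative f') F"
proof -
  have bl: "bounded_linear (axis i :: complex \<Rightarrow> complex^'n)" for i
    by (intro linear_conv_bounded_linear[THEN iffD1] linearI) (auto simp: vec_eq_iff axis_def)
  have ax: "(\<Sum>i\<in>UNIV. axis i (x $ i)) = x" for x :: "complex^'n"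
    by (auto simp: vec_eq_iff axis_def if_distrib sum.If_cases cong del: if_weak_cong)
  have "((\<lambda>t. \<Sum>i\<in>UNIV. axis i (f t $ i)) has_vector_derivative (\<Sum>i\<in>UNIV. axis i (f' $ i))) F"
    by (intro has_vector_derivative_sum bounded_linear.has_vector_derivative[OF bl] assms)
  then show ?thesis by (simp only: ax)
qed

lemma has_vector_derivative_quotient_tendsto:
  "(f has_vector_derivative w) (at 0) \<Longrightarrow> ((\<lambda>t::real. (f t - f 0) /\<^sub>R t) \<longlongrightarrow> w) (at 0)"
  for f :: "real \<Rightarrow> complex"
proof -
  assume "(f has_vector_derivative w) (at 0)"
  then have "((\<lambda>h. norm (f (0 + h) - f 0 - h *\<^sub>R w) / norm h) \<longlongrightarrow> 0) (at 0)"
    unfolding has_vector_derivative_def has_derivative_at by simp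
  then have "((\<lambda>h. norm ((f h - f 0) /\<^sub>R h - w)) \<longlongrightarrow> 0) (at 0)"
  proof (rule Lim_transform_eventually)
    show "\<forall>\<^sub>F h in at 0. norm (f (0 + h) - f 0 - h *\<^sub>R w) / norm h = norm ((f h - f 0) /\<^sub>R h - w)"
      unfolding eventually_at_filter
    proof (rule always_eventually, intro allI impI)
      fix h :: real assume h: "h \<noteq> 0"
      have "(f h - f 0) /\<^sub>R h - w = (f h - f 0 - h *\<^sub>R w) /\<^sub>R h" using h by (simp add: scaleR_diff_right)
      then show "norm (f (0 + h) - f 0 - h *\<^sub>R w) / norm h = norm ((f h - f 0) /\<^sub>R h - w)"
        by (simp add: divide_inverse mult.commute)
    qed
  qed
  then show ?thesis by (subst LIM_zero_iff[symmetric]) (rule tendsto_norm_zero_cancel)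
qed

text \<open>Near the parameter \<open>0\<close> the curve has the form \<open>e \<tau> = \<sigma> (S \<tau>)\<close>, where \<open>S\<close> tends to \<open>t0\<close> because \<open>\<sigma>\<close> embeds the
  circle; differentiability of \<open>S\<close> is not clear beforehand. The difference quotients of \<open>e\<close> are real multiples
  of the secants \<open>D (t0, S \<tau>)\<close>, and these tend to \<open>\<sigma>' t0 \<noteq> 0\<close>. In the limit the imaginary part of \<open>w / \<sigma>' t0\<close>
  vanishes.\<close>

lemma velocity_in_embedded_loop:
  fixes \<sigma> \<sigma>' e :: "real \<Rightarrow> complex"
  assumes der: "\<And>t. (\<sigma> has_vector_derivative \<sigma>' t) (at t)" and cont: "continuous_on UNIV \<sigma>'"
    and per: "\<And>t. \<sigma> (t + 1) = \<sigma> t" and inj: "inj_on \<sigma> {0..<1}" and reg: "\<And>t. \<sigma>' t \<noteq> 0"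
    and e: "\<forall>\<^sub>F \<tau> in nhds 0. e \<tau> \<in> range \<sigma>" "e 0 = \<sigma> t0" "(e has_vector_derivative w) (at 0)"
  obtains \<mu> where "w = of_real \<mu> * \<sigma>' t0"
proof -
  obtain D where D: "continuous_on UNIV D" "\<And>s t. \<sigma> t - \<sigma> s = of_real (t - s) * D (s, t)" "\<And>t. D (t, t) = \<sigma>' t"
    using divided_difference[OF der cont] by blast
  have \<sigma>_eq: "\<sigma> t = \<sigma> s \<longleftrightarrow> t - s \<in> \<int>" for s t by (rule periodic_inj_eq_iff[OF per inj])
  have "\<exists>s. e \<tau> \<in> range \<sigma> \<longrightarrow> \<sigma> s = e \<tau> \<and> \<bar>s - t0\<bar> \<le> 1/2" for \<tau>
  proof (cases "e \<tau> \<in> range \<sigma>")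
    case True
    then obtain s where s: "e \<tau> = \<sigma> s" by auto
    have "\<sigma> (s - of_int (round (s - t0))) = \<sigma> s" by (simp add: \<sigma>_eq)
    moreover have "\<bar>s - of_int (round (s - t0)) - t0\<bar> \<le> 1/2"
      using of_int_round_abs_le[of "s - t0"] by linarith
    ultimately show ?thesis using s by metis
  qed auto
  then obtain S where S: "\<And>\<tau>. e \<tau> \<in> range \<sigma> \<Longrightarrow> \<sigma> (S \<tau>) = e \<tau>" "\<And>\<tau>. e \<tau> \<in> range \<sigma> \<Longrightarrow> \<bar>S \<tau> - t0\<bar> \<le> 1/2"
    by metis
  have e_cont: "(e \<longlongrightarrow> \<sigma> t0) (at 0)"
    using has_vector_derivative_continuous[OF e(3)] e(2) by (simp add: isCont_def)
  have e_ev: "\<forall>\<^sub>F \<tau> in at 0. e \<tau> \<in> range \<sigma>" using e(1) by (auto simp: eventually_at_filter elim: eventually_mono)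
  have \<sigma>_cont: "continuous_on A \<sigma>" for A
    using der by (meson continuous_at_imp_continuous_on has_vector_derivative_continuous)
  have S_lim: "(S \<longlongrightarrow> t0) (at 0)"
  proof (rule tendstoI)
    fix d :: real assume d: "d > 0"
    define K where "K = {s. d \<le> \<bar>s - t0\<bar> \<and> \<bar>s - t0\<bar> \<le> 1/2}"
    have "K = ({..t0 - d} \<union> {t0 + d..}) \<inter> {t0 - 1/2..t0 + 1/2}" using d by (auto simp: K_def abs_if split: if_splits)
    then have "compact K" by (auto intro!: closed_Int_compact)
    have nz: "0 < norm (\<sigma> s - \<sigma> t0)" if "s \<in> K" for s
    proof -
      have "s - t0 \<notin> \<int>"
      proof
        assume "s - t0 \<in> \<int>"
        then obtain n :: int where n: "s - t0 = of_int n" by (auto elim: Ints_cases)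
        then have "\<bar>real_of_int n\<bar> \<le> 1/2" "0 < \<bar>real_of_int n\<bar>" using that d by (auto simp: K_def)
        then have "real_of_int \<bar>n\<bar> < 1" "n \<noteq> 0" by auto
        then show False by linarith
      qed
      then show ?thesis by (simp add: \<sigma>_eq)
    qed
    obtain \<epsilon> where \<epsilon>: "0 < \<epsilon>" "\<And>s. s \<in> K \<Longrightarrow> \<epsilon> \<le> norm (\<sigma> s - \<sigma> t0)"
    proof (cases "K = {}")
      case True
      then show ?thesis using that[of 1] by simp
    next
      case False
      have "continuous_on K (\<lambda>s. norm (\<sigma> s - \<sigma> t0))" by (intro continuous_intros \<sigma>_cont)
      then obtain x where "x \<in> K" "\<forall>s\<in>K. norm (\<sigma> x - \<sigma> t0) \<le> norm (\<sigma> s - \<sigma> t0)"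
        using continuous_attains_inf[OF \<open>compact K\<close> False] by blast
      then show ?thesis using that[of "norm (\<sigma> x - \<sigma> t0)"] nz by auto
    qed
    have "\<forall>\<^sub>F \<tau> in at 0. dist (e \<tau>) (\<sigma> t0) < \<epsilon>" using tendstoD[OF e_cont \<epsilon>(1)] .
    then show "\<forall>\<^sub>F \<tau> in at 0. dist (S \<tau>) t0 < d"
      using e_ev
    proof eventually_elim
      case (elim \<tau>)
      then have "norm (\<sigma> (S \<tau>) - \<sigma> t0) < \<epsilon>" using S(1)[OF elim(2)] by (simp add: dist_norm)
      then have "S \<tau> \<notin> K" using \<epsilon>(2) by force
      then show ?case using S(2)[OF elim(2)] by (auto simp: K_def dist_real_def)
    qed
  qed
  have "isCont D (t0, t0)" using D(1) by (simp add: continuous_on_eq_continuous_at)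
  then have "((\<lambda>\<tau>. D (t0, S \<tau>)) \<longlongrightarrow> D (t0, t0)) (at 0)"
    by (rule isCont_tendsto_compose) (intro tendsto_Pair tendsto_const S_lim)
  then have D_lim: "((\<lambda>\<tau>. D (t0, S \<tau>)) \<longlongrightarrow> \<sigma>' t0) (at 0)" unfolding D(3) .
  have q_lim: "((\<lambda>\<tau>. Im (((e \<tau> - e 0) /\<^sub>R \<tau>) / D (t0, S \<tau>))) \<longlongrightarrow> Im (w / \<sigma>' t0)) (at 0)"
    by (intro tendsto_Im tendsto_divide has_vector_derivative_quotient_tendsto e(3) D_lim reg)
  have "\<forall>\<^sub>F \<tau> in at 0. Im (((e \<tau> - e 0) /\<^sub>R \<tau>) / D (t0, S \<tau>)) = 0"
    using e_ev
  proof eventually_elim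
    case (elim \<tau>)
    have "e \<tau> - e 0 = of_real (S \<tau> - t0) * D (t0, S \<tau>)" using S(1)[OF elim] e(2) D(2)[of "S \<tau>" t0] by simp
    then have "((e \<tau> - e 0) /\<^sub>R \<tau>) / D (t0, S \<tau>) = of_real ((S \<tau> - t0) / \<tau>)" if "D (t0, S \<tau>) \<noteq> 0"
      using that by (simp add: scaleR_conv_of_real divide_inverse mult_ac)
    then show ?case by (cases "D (t0, S \<tau>) = 0") simp_all
  qed
  then have "((\<lambda>\<tau>. Im (((e \<tau> - e 0) /\<^sub>R \<tau>) / D (t0, S \<tau>))) \<longlongrightarrow> 0) (at 0)"
    by (rule tendsto_eventually)
  with q_lim have "Im (w / \<sigma>' t0) = 0" by (rule tendsto_unique[OF at_neq_bot])
  then have "w / \<sigma>' t0 = of_real (Re (w / \<sigma>' t0))" by (simp add: complex_eq_iff)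
  then have "w = of_real (Re (w / \<sigma>' t0)) * \<sigma>' t0" using reg by (metis nonzero_eq_divide_eq)
  then show thesis by (rule that)
qed

section \<open>Lifting loops through a simple closed curve\<close>

lemma continuous_polar_lift:
  fixes f :: "real \<Rightarrow> complex"
  assumes "continuous_on {0..1} f" "\<And>s. s \<in> {0..1} \<Longrightarrow> f s \<noteq> 0"
  obtains x where "continuous_on {0..1} x" "\<And>s. s \<in> {0..1} \<Longrightarrow> f s = of_real (norm (f s)) * cis (2 * pi * x s)"
proof -
  have "path f" "0 \<notin> path_image f" using assms by (auto simp: path_def path_image_def)
  then obtain g where g: "path g" "\<And>s. s \<in> {0..1} \<Longrightarrow> f s = exp (g s)"
    using path_continuous_logarithm by blast
  show thesis
  proof (rule that)
    show "continuous_on {0..1} (\<lambda>s. Im (g s) / (2 * pi))"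
      using g(1) unfolding path_def by (intro continuous_intros) auto
    fix s :: real assume "s \<in> {0..1}"
    then show "f s = of_real (norm (f s)) * cis (2 * pi * (Im (g s) / (2 * pi)))"
      using g(2) by (simp add: exp_eq_polar norm_mult)
  qed
qed

text \<open>Sending \<open>\<gamma> t\<close> to the point with angle \<open>2 * pi * t\<close> identifies the curve with the unit circle. This map \<open>H\<close> is
  continuous by compactness: the preimage of a closed set is the image of a compact set under \<open>\<gamma>\<close>. A polar
  angle of \<open>H (v s)\<close>, divided by \<open>2 * pi\<close>, is the required lift.\<close>

lemma loop_lift_through_curve:
  fixes \<gamma> v :: "real \<Rightarrow> complex"
  assumes cont: "continuous_on UNIV \<gamma>" and per: "\<And>t. \<gamma> (t + 1) = \<gamma> t" and inj: "inj_on \<gamma> {0..<1}"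
    and v: "continuous_on {0..1} v" "\<And>s. s \<in> {0..1} \<Longrightarrow> v s \<in> range \<gamma>"
  obtains t where "continuous_on {0..1} t" "\<And>s. s \<in> {0..1} \<Longrightarrow> v s = \<gamma> (t s)"
proof -
  have eq: "\<gamma> s = \<gamma> t \<longleftrightarrow> s - t \<in> \<int>" for s t by (rule periodic_inj_eq_iff[OF per inj])
  define e :: "real \<Rightarrow> complex" where "e = (\<lambda>t. exp (2 * of_real pi * \<i> * of_real t))"
  have e_eq: "e s = e t \<longleftrightarrow> s - t \<in> \<int>" for s t unfolding e_def by (rule exp_unit_eq_iff)
  have e_norm: "norm (e t) = 1" for t by (simp add: e_def norm_exp_eq_Re)
  define H where "H = (\<lambda>w. e (SOME t. \<gamma> t = w))"
  have H: "H (\<gamma> t) = e t" for t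
  proof -
    have "\<gamma> (SOME s. \<gamma> s = \<gamma> t) = \<gamma> t" by (rule someI) simp
    then show ?thesis by (simp add: H_def eq e_eq)
  qed
  have per01: "\<gamma> t = \<gamma> (frac t)" for t by (simp add: eq frac_def)
  have "continuous_on (range \<gamma>) H"
    unfolding continuous_closedin_preimage_eq
  proof (intro allI impI)
    fix T :: "complex set" assume "closed T"
    have "range \<gamma> \<inter> H -` T = \<gamma> ` ({0..1} \<inter> e -` T)"
    proof
      show "range \<gamma> \<inter> H -` T \<subseteq> \<gamma> ` ({0..1} \<inter> e -` T)"
      proof
        fix w assume "w \<in> range \<gamma> \<inter> H -` T"
        then obtain t where t: "w = \<gamma> t" "e t \<in> T" using H by auto
        moreover have "e (frac t) = e t" by (simp add: e_eq frac_def)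
        ultimately have "w = \<gamma> (frac t)" "e (frac t) \<in> T" using per01[of t] by auto
        then show "w \<in> \<gamma> ` ({0..1} \<inter> e -` T)" by (auto simp: frac_lt_1 less_imp_le)
      qed
    qed (auto simp: H)
    moreover have "compact ({0..1} \<inter> e -` T)"
      by (intro closed_Int_compact[of "e -` T" "{0..1}", unfolded Int_commute[of "e -` T"]])
         (use \<open>closed T\<close> in \<open>auto intro!: closed_vimage continuous_intros simp: e_def\<close>)
    ultimately have "compact (range \<gamma> \<inter> H -` T)"
      by (metis compact_continuous_image cont continuous_on_subset subset_UNIV)
    then show "closedin (top_of_set (range \<gamma>)) (range \<gamma> \<inter> H -` T)"
      by (intro closed_subset compact_imp_closed) auto
  qed
  then have Hv: "continuous_on {0..1} (\<lambda>s. H (v s))"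
    by (rule continuous_on_compose2[OF _ v(1)]) (use v(2) in auto)
  have Hn: "norm (H w) = 1" for w by (simp add: H_def e_norm)
  then have "H w \<noteq> 0" for w by (metis norm_zero zero_neq_one)
  then obtain t where t: "continuous_on {0..1} t" "\<And>s. s \<in> {0..1} \<Longrightarrow> H (v s) = of_real (norm (H (v s))) * cis (2 * pi * t s)"
    using continuous_polar_lift[OF Hv] by blast
  show thesis
  proof (rule that[OF t(1)])
    fix s :: real assume s: "s \<in> {0..1}"
    obtain t0 where t0: "v s = \<gamma> t0" using v(2)[OF s] by auto
    have "e t0 = e (t s)" using t(2)[OF s] H t0 Hn by (simp add: e_def cis_conv_exp mult_ac)
    then show "v s = \<gamma> (t s)" using t0 by (simp add: eq e_eq)
  qed
qed

section \<open>The quotient of the coordinates on a Brendel torus\<close>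

lemma radial_factor_mono:
  assumes "0 \<le> x" "x \<le> y" "real k * y\<^sup>2 < 1"
  shows "x / sqrt (1 - real k * x\<^sup>2) ^ k \<le> y / sqrt (1 - real k * y\<^sup>2) ^ k"
proof -
  have "x\<^sup>2 \<le> y\<^sup>2" using assms by (intro power_mono) auto
  then have "real k * x\<^sup>2 \<le> real k * y\<^sup>2" by (intro mult_left_mono) auto
  then have "sqrt (1 - real k * y\<^sup>2) \<le> sqrt (1 - real k * x\<^sup>2)" "0 < sqrt (1 - real k * y\<^sup>2)" using assms by auto
  then show ?thesis using assms by (intro frac_le power_mono) auto
qed

text \<open>For \<open>s = 1\<close> this is the value of \<open>z\<^sub>2 * z\<^sub>3 / z\<^sub>1 ^ k\<close> at the points of the torus over \<open>z \<in> \<Gamma>\<close>; the parameter \<open>s\<close>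
  connects it with the identity.\<close>

definition radial_stretch :: "nat \<Rightarrow> real \<Rightarrow> complex \<Rightarrow> complex" where
  "radial_stretch k s z = of_real ((1 - s) + s * (cmod z / sqrt (1 - real k * (cmod z)\<^sup>2) ^ k)) * z"

text \<open>The map preserves rays, and the modulus is strictly increasing along each ray.\<close>

lemma radial_stretch_inj:
  assumes s: "0 \<le> s" "s \<le> 1" and z: "real k * (cmod z)\<^sup>2 < 1" and w: "real k * (cmod w)\<^sup>2 < 1"
    and eq: "radial_stretch k s z = radial_stretch k s w"
  shows "z = w"
proof -
  define f where "f = (\<lambda>x. (1 - s) + s * (x / sqrt (1 - real k * x\<^sup>2) ^ k))"
  have rs: "radial_stretch k s z = of_real (f (cmod z)) * z" for z by (simp add: radial_stretch_def f_def)
  have f_mono: "f x \<le> f y" if "0 \<le> x" "x \<le> y" "real k * y\<^sup>2 < 1" for x y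
    unfolding f_def by (intro add_mono mult_left_mono radial_factor_mono that s order_refl)
  have f_pos: "0 < f x" if "0 < x" "real k * x\<^sup>2 < 1" for x
  proof (cases "s = 0")
    case False
    then have "0 < s * (x / sqrt (1 - real k * x\<^sup>2) ^ k)" using that s by auto
    then show ?thesis using s by (auto simp: f_def)
  qed (simp add: f_def)
  have less: False if "cmod z < cmod w" "real k * (cmod w)\<^sup>2 < 1" "of_real (f (cmod z)) * z = of_real (f (cmod w)) * w" for z w
  proof -
    have w0: "0 < cmod w" using that(1) norm_ge_zero[of z] by linarith
    have "\<bar>f (cmod z)\<bar> * cmod z = \<bar>f (cmod w)\<bar> * cmod w" using arg_cong[OF that(3), of cmod] by (simp only: norm_mult norm_of_real)
    moreover have "f 0 \<le> f (cmod z)"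
    proof (rule f_mono)
      have "(cmod z)\<^sup>2 \<le> (cmod w)\<^sup>2" using that(1) by (intro power_mono) auto
      then have "real k * (cmod z)\<^sup>2 \<le> real k * (cmod w)\<^sup>2" by (intro mult_left_mono) auto
      then show "real k * (cmod z)\<^sup>2 < 1" using that(2) by linarith
    qed auto
    moreover have "0 \<le> f 0" using s by (simp add: f_def)
    moreover have "f (cmod z) \<le> f (cmod w)" using that by (intro f_mono) auto
    moreover have "f (cmod z) * cmod z \<le> f (cmod w) * cmod z" using calculation(4) by (intro mult_right_mono) auto
    moreover have "f (cmod w) * cmod z < f (cmod w) * cmod w" using f_pos[OF w0 that(2)] that(1) by (intro mult_strict_left_mono)
    ultimately show False by (auto simp: abs_if split: if_splits)
  qed
  have "\<not> cmod z < cmod w" using less[OF _ w eq[unfolded rs]] by blast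
  moreover have "\<not> cmod w < cmod z" using less[OF _ z eq[unfolded rs, symmetric]] by blast
  ultimately have "cmod z = cmod w" by linarith
  show "z = w"
  proof (cases "z = 0")
    case True
    then show ?thesis using \<open>cmod z = cmod w\<close> by simp
  next
    case False
    then have "complex_of_real (f (cmod w)) \<noteq> 0" using f_pos[of "cmod z"] z \<open>cmod z = cmod w\<close> by force
    moreover have "of_real (f (cmod w)) * z = of_real (f (cmod w)) * w"
      using eq unfolding rs \<open>cmod z = cmod w\<close> .
    ultimately show ?thesis by simp
  qed
qed

lemma DERIV_sqrt_comp:
  assumes "(f has_real_derivative 2 * d) (at t)" "0 < f t"
  shows "((\<lambda>t. sqrt (f t)) has_real_derivative d / sqrt (f t)) (at t)"
proof -
  have 1: "DERIV sqrt (f t) :> inverse (sqrt (f t)) / 2" using assms(2) by (rule DERIV_real_sqrt)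
  have 2: "((\<lambda>t. sqrt (f t)) has_real_derivative inverse (sqrt (f t)) / 2 * (2 * d)) (at t)"
    by (rule DERIV_chain'[OF assms(1) 1])
  have 3: "inverse (sqrt (f t)) / 2 * (2 * d) = d / sqrt (f t)"
    by (simp add: field_simps)
  show ?thesis using 2 unfolding 3 .
qed

lemma stretch_derivative_algebra:
  fixes r P p p' K :: real
  assumes "r \<noteq> 0" "P \<noteq> 0"
  shows "(p' * (r * P) - K * ((- K * p * p' / r) * P) * p) / (r * P) ^ Suc (Suc 0) = p' / (r * P) + K\<^sup>2 * p\<^sup>2 * p' / (r * P * r\<^sup>2)"
  using assms by (simp add: field_simps power2_eq_square)

text \<open>A counterclockwise parametrisation \<open>\<gamma>\<close> of the curve \<open>\<Gamma>\<close> together with a point \<open>c\<close> enclosed by it. The bound on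
  \<open>cmod c\<close> places \<open>c\<close> in the disk on which \<open>radial_stretch k\<close> is injective.\<close>

locale brendel_curve =
  fixes k :: nat and \<gamma> \<gamma>' :: "real \<Rightarrow> complex" and c :: complex
  assumes k: "k \<ge> 1"
    and der: "\<And>t. (\<gamma> has_vector_derivative \<gamma>' t) (at t)" and cont: "continuous_on UNIV \<gamma>'"
    and per: "\<And>t. \<gamma> (t + 1) = \<gamma> t" and inj: "inj_on \<gamma> {0..<1}" and reg: "\<And>t. \<gamma>' t \<noteq> 0"
    and punct: "range \<gamma> \<subseteq> punctured_disk k"
    and c: "c \<notin> range \<gamma>" "(cmod c)\<^sup>2 < 1 / real k" "winding_number \<gamma> c = 1"
begin

text \<open>Over \<open>\<gamma> t\<close> the coordinates of a point of the torus have moduli \<open>r t\<close>, \<open>\<rho> t\<close> and \<open>\<rho> t\<close>, and \<open>\<sigma> t\<close> is the value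
  of \<open>z\<^sub>2 * z\<^sub>3 / z\<^sub>1 ^ k\<close>. Primes denote derivatives, with \<open>g'\<close> that of \<open>\<rho> / r ^ k\<close>. The simple closed curve
  \<open>\<sigma>\<close> is the image of \<open>\<gamma>\<close> under \<open>radial_stretch k 1\<close>, and \<open>C\<close> is a point that it encloses.\<close>

definition "\<rho> t = cmod (\<gamma> t)"
definition "r t = sqrt (1 - real k * (\<rho> t)\<^sup>2)"
definition "\<rho>' t = Re (cnj (\<gamma> t) * \<gamma>' t) / \<rho> t"
definition "r' t = - real k * \<rho> t * \<rho>' t / r t"
definition "\<sigma> t = of_real (\<rho> t / r t ^ k) * \<gamma> t"
definition "g' t = \<rho>' t / r t ^ k + (real k)\<^sup>2 * (\<rho> t)\<^sup>2 * \<rho>' t / r t ^ (k + 2)"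
definition "\<sigma>' t = of_real (g' t) * \<gamma> t + of_real (\<rho> t / r t ^ k) * \<gamma>' t"
definition "C = radial_stretch k 1 c"

lemma \<rho>_pos: "0 < \<rho> t" and k\<rho>: "real k * (\<rho> t)\<^sup>2 < 1"
proof -
  have *: "0 < (\<rho> t)\<^sup>2" "(\<rho> t)\<^sup>2 < 1 / real k" using punct by (auto simp: punctured_disk_def \<rho>_def)
  show "0 < \<rho> t" using *(1) by (auto simp: \<rho>_def)
  show "real k * (\<rho> t)\<^sup>2 < 1" using *(2) k by (simp add: field_simps)
qed

lemma r_pos: "0 < r t" using k\<rho>[of t] by (simp add: r_def)
lemma \<gamma>_nz: "\<gamma> t \<noteq> 0" using \<rho>_pos[of t] by (auto simp: \<rho>_def)
lemma r_nz: "r t \<noteq> 0" using r_pos[of t] by simp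
lemma \<rho>_nz: "\<rho> t \<noteq> 0" using \<rho>_pos[of t] by simp
lemma r_sq: "(r t)\<^sup>2 = 1 - real k * (\<rho> t)\<^sup>2" using k\<rho>[of t] by (simp add: r_def)

lemma \<gamma>_cont: "continuous_on A \<gamma>"
  using der by (meson continuous_at_imp_continuous_on has_vector_derivative_continuous)
lemma \<rho>_cont: "continuous_on A \<rho>" unfolding \<rho>_def by (intro continuous_intros \<gamma>_cont)
lemma r_cont: "continuous_on A r" unfolding r_def by (intro continuous_intros \<rho>_cont)
lemma \<rho>'_cont: "continuous_on A \<rho>'"
  unfolding \<rho>'_def using \<rho>_nz by (intro continuous_intros \<rho>_cont \<gamma>_cont continuous_on_subset[OF cont]) auto
lemma \<sigma>_cont: "continuous_on A \<sigma>"
  unfolding \<sigma>_def using r_nz by (intro continuous_intros \<rho>_cont r_cont \<gamma>_cont) auto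
lemma \<sigma>'_cont: "continuous_on A \<sigma>'"
  unfolding \<sigma>'_def g'_def using r_nz
  by (intro continuous_intros \<rho>_cont r_cont \<rho>'_cont \<gamma>_cont continuous_on_subset[OF cont]) auto

lemma \<rho>_per: "\<rho> (t + 1) = \<rho> t" by (simp add: \<rho>_def per)
lemma r_per: "r (t + 1) = r t" by (simp add: r_def \<rho>_per)
lemma \<sigma>_per: "\<sigma> (t + 1) = \<sigma> t" by (simp add: \<sigma>_def per \<rho>_per r_per)

lemma \<rho>_der: "(\<rho> has_real_derivative \<rho>' t) (at t)"
proof -
  have "((\<lambda>t. Re (\<gamma> t)) has_real_derivative Re (\<gamma>' t)) (at t)" "((\<lambda>t. Im (\<gamma> t)) has_real_derivative Im (\<gamma>' t)) (at t)"
    unfolding has_real_derivative_iff_has_vector_derivative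
    by (auto intro: bounded_linear.has_vector_derivative[OF bounded_linear_Re der] bounded_linear.has_vector_derivative[OF bounded_linear_Im der])
  moreover have "0 < (Re (\<gamma> t))\<^sup>2 + (Im (\<gamma> t))\<^sup>2" using \<gamma>_nz[of t] by (metis complex_neq_0)
  ultimately have "((\<lambda>t. (Re (\<gamma> t))\<^sup>2 + (Im (\<gamma> t))\<^sup>2) has_real_derivative 2 * Re (cnj (\<gamma> t) * \<gamma>' t)) (at t)"
    and pos: "0 < (Re (\<gamma> t))\<^sup>2 + (Im (\<gamma> t))\<^sup>2"
    using DERIV_add[OF DERIV_power[of "\<lambda>t. Re (\<gamma> t)" "Re (\<gamma>' t)" t UNIV 2] DERIV_power[of "\<lambda>t. Im (\<gamma> t)" "Im (\<gamma>' t)" t UNIV 2]]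
    by (simp_all add: algebra_simps)
  from DERIV_sqrt_comp[OF this]
  have "((\<lambda>t. sqrt ((Re (\<gamma> t))\<^sup>2 + (Im (\<gamma> t))\<^sup>2)) has_real_derivative \<rho>' t) (at t)"
    by (simp only: \<rho>'_def \<rho>_def cmod_def)
  moreover have "\<rho> = (\<lambda>t. sqrt ((Re (\<gamma> t))\<^sup>2 + (Im (\<gamma> t))\<^sup>2))" by (simp add: fun_eq_iff \<rho>_def cmod_def)
  ultimately show ?thesis by simp
qed

lemma r_der: "(r has_real_derivative r' t) (at t)"
proof -
  have "0 < 1 - real k * (\<rho> t)\<^sup>2" using k\<rho>[of t] by simp
  moreover have "((\<lambda>t. 1 - real k * (\<rho> t)\<^sup>2) has_real_derivative 2 * (- real k * \<rho> t * \<rho>' t)) (at t)"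
    using DERIV_diff[OF DERIV_const DERIV_cmult[OF DERIV_power[OF \<rho>_der[of t], of 2]], of 1 "real k"] by (simp add: mult_ac)
  ultimately have "((\<lambda>t. sqrt (1 - real k * (\<rho> t)\<^sup>2)) has_real_derivative r' t) (at t)"
    unfolding r'_def r_def by (intro DERIV_sqrt_comp)
  moreover have "r = (\<lambda>t. sqrt (1 - real k * (\<rho> t)\<^sup>2))" by (simp add: fun_eq_iff r_def)
  ultimately show ?thesis by simp
qed

lemma of_real_der: "(f has_real_derivative d) F \<Longrightarrow> ((\<lambda>t. complex_of_real (f t)) has_vector_derivative of_real d) F"
  by (rule has_vector_derivative_of_real) (simp add: has_real_derivative_iff_has_vector_derivative)

lemma \<sigma>_der: "(\<sigma> has_vector_derivative \<sigma>' t) (at t)"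
proof -
  define P where "P = r t ^ (k - Suc 0)"
  have "Suc (k - Suc 0) = k" using k by simp
  then have P: "r t ^ k = r t * P" "P \<noteq> 0" using power_Suc[of "r t" "k - Suc 0"] r_nz[of t] by (simp_all add: P_def)
  have "((\<lambda>t. \<rho> t / r t ^ k) has_real_derivative
      (\<rho>' t * r t ^ k - of_nat k * (r' t * r t ^ (k - Suc 0)) * \<rho> t) / (r t ^ k) ^ Suc (Suc 0)) (at t)"
    by (rule DERIV_quotient[OF \<rho>_der DERIV_power[OF r_der]]) (simp add: r_nz)
  also have "(\<rho>' t * r t ^ k - of_nat k * (r' t * r t ^ (k - Suc 0)) * \<rho> t) / (r t ^ k) ^ Suc (Suc 0) = g' t"
    unfolding P(1) P_def[symmetric] r'_def g'_def power_add using stretch_derivative_algebra[OF r_nz P(2)] by simp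
  finally have "((\<lambda>t. \<rho> t / r t ^ k) has_real_derivative g' t) (at t)" .
  from has_vector_derivative_mult[OF of_real_der[OF this] der]
  show ?thesis unfolding \<sigma>_def[abs_def] \<sigma>'_def by (simp only: add.commute)
qed

text \<open>If \<open>\<sigma>' t\<close> vanished, \<open>\<gamma>' t\<close> would be a real multiple \<open>a\<close> of \<open>\<gamma> t\<close>. But the stretching has positive derivative in
  the radial direction, which forces \<open>a = 0\<close>.\<close>

lemma \<sigma>'_nz: "\<sigma>' t \<noteq> 0"
proof
  assume 0: "\<sigma>' t = 0"
  define a where "a = r t ^ k / \<rho> t * (- g' t)"
  have rk: "r t ^ k > 0" using r_pos by simp
  have e: "of_real (\<rho> t / r t ^ k) * \<gamma>' t = of_real (- g' t) * \<gamma> t"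
    using 0 unfolding \<sigma>'_def by (simp add: add_eq_0_iff)
  have "\<gamma>' t = of_real (r t ^ k / \<rho> t * (\<rho> t / r t ^ k)) * \<gamma>' t" using rk \<rho>_nz[of t] r_nz[of t] by simp
  also have "\<dots> = of_real (r t ^ k / \<rho> t) * (of_real (- g' t) * \<gamma> t)" by (simp only: of_real_mult mult.assoc e)
  finally have \<gamma>': "\<gamma>' t = of_real a * \<gamma> t" by (simp only: a_def of_real_mult mult.assoc)
  have "cnj (\<gamma> t) * \<gamma>' t = of_real (a * (\<rho> t)\<^sup>2)"
    unfolding \<gamma>' \<rho>_def using complex_norm_square[of "\<gamma> t"] by (simp add: mult_ac)
  then have \<rho>'a: "\<rho>' t = a * \<rho> t" unfolding \<rho>'_def using \<rho>_nz[of t] by (simp add: power2_eq_square)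
  have "g' t = (\<rho>' t + (real k)\<^sup>2 * (\<rho> t)\<^sup>2 * \<rho>' t / (r t)\<^sup>2) / r t ^ k"
    unfolding g'_def power_add add_divide_distrib divide_divide_eq_left by (simp only: mult.commute)
  then have "a = - ((\<rho>' t + (real k)\<^sup>2 * (\<rho> t)\<^sup>2 * \<rho>' t / (r t)\<^sup>2) / \<rho> t)"
    unfolding a_def using rk r_nz[of t] by simp
  moreover have "(\<rho>' t + (real k)\<^sup>2 * (\<rho> t)\<^sup>2 * \<rho>' t / (r t)\<^sup>2) / \<rho> t = a * (1 + (real k)\<^sup>2 * (\<rho> t)\<^sup>2 / (r t)\<^sup>2)"
    unfolding \<rho>'a using \<rho>_nz[of t] r_nz[of t] by (simp add: field_simps)
  ultimately have "a = - (a * (1 + (real k)\<^sup>2 * (\<rho> t)\<^sup>2 / (r t)\<^sup>2))" by linarith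
  then have "a * (2 + (real k)\<^sup>2 * (\<rho> t)\<^sup>2 / (r t)\<^sup>2) = 0" by (simp add: algebra_simps)
  moreover have "0 \<le> (real k)\<^sup>2 * (\<rho> t)\<^sup>2 / (r t)\<^sup>2" by simp
  ultimately have "a = 0" by (auto simp: add_nonneg_eq_0_iff)
  then show False using \<gamma>' reg by simp
qed

lemma kc: "real k * (cmod c)\<^sup>2 < 1" using c(2) k by (simp add: field_simps)

lemma \<sigma>_radial: "\<sigma> t = radial_stretch k 1 (\<gamma> t)" by (simp add: \<sigma>_def radial_stretch_def \<rho>_def r_def)

lemma \<sigma>_inj: "inj_on \<sigma> {0..<1}"
proof (rule inj_onI)
  fix x y assume xy: "x \<in> {0..<1}" "y \<in> {0..<1}" "\<sigma> x = \<sigma> y"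
  then have "\<gamma> x = \<gamma> y"
    using radial_stretch_inj[of 1 k "\<gamma> x" "\<gamma> y"] k\<rho> by (simp add: \<sigma>_radial \<rho>_def)
  then show "x = y" using inj xy by (auto dest: inj_onD)
qed

lemma C_out: "C \<notin> range \<sigma>"
proof
  assume "C \<in> range \<sigma>"
  then obtain t where "radial_stretch k 1 (\<gamma> t) = radial_stretch k 1 c" by (auto simp: C_def \<sigma>_radial)
  then have "\<gamma> t = c" using radial_stretch_inj[of 1 k "\<gamma> t" c] k\<rho>[of t] kc by (simp add: \<rho>_def)
  then show False using c(1) by auto
qed

text \<open>The maps \<open>radial_stretch k s\<close> are injective, so moving \<open>s\<close> from \<open>0\<close> to \<open>1\<close> deforms \<open>\<gamma> - c\<close> into \<open>\<sigma> - C\<close> without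
  passing through \<open>0\<close>.\<close>

lemma winding_\<sigma>_C: "winding_number \<sigma> C = 1"
proof -
  have per0: "\<gamma> 1 = \<gamma> 0" using per[of 0] by simp
  define F where "F = (\<lambda>p. (of_real ((1 - fst p) + fst p * (\<rho> (snd p) / r (snd p) ^ k)) * \<gamma> (snd p)) - radial_stretch k (fst p) c)"
  have F: "F (s, t) = radial_stretch k s (\<gamma> t) - radial_stretch k s c" for s t
    by (simp add: F_def radial_stretch_def \<rho>_def r_def)
  have "homotopic_loops (-{0}) (\<lambda>t. \<gamma> t - c) (\<lambda>t. \<sigma> t - C)"
    unfolding homotopic_loops
  proof (intro exI[of _ F] conjI ballI)
    show "continuous_on ({0..1} \<times> {0..1}) F" unfolding F_def radial_stretch_def
      using r_nz by (intro continuous_intros continuous_on_compose2[OF \<gamma>_cont[of UNIV]] continuous_on_compose2[OF \<rho>_cont[of UNIV]]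
          continuous_on_compose2[OF r_cont[of UNIV]]) auto
    show "F \<in> ({0..1} \<times> {0..1}) \<rightarrow> - {0}"
    proof
      fix p :: "real \<times> real" assume p: "p \<in> {0..1} \<times> {0..1}"
      show "F p \<in> - {0}"
      proof
        assume "F p \<in> {0}"
        then have "radial_stretch k (fst p) (\<gamma> (snd p)) = radial_stretch k (fst p) c" using F[of "fst p" "snd p"] by simp
        then have "\<gamma> (snd p) = c" using radial_stretch_inj[of "fst p" k "\<gamma> (snd p)" c] p k\<rho>[of "snd p"] kc by (auto simp: \<rho>_def)
        then show False using c(1) by auto
      qed
    qed
    show "F (0, t) = \<gamma> t - c" for t by (simp add: F radial_stretch_def)
    show "F (1, t) = \<sigma> t - C" for t by (simp add: F \<sigma>_radial C_def)
    show "pathfinish (F \<circ> Pair s) = pathstart (F \<circ> Pair s)" for s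
      by (simp add: pathfinish_def pathstart_def F per0)
  qed
  then have "winding_number (\<lambda>t. \<gamma> t - c) 0 = winding_number (\<lambda>t. \<sigma> t - C) 0"
    by (rule winding_number_homotopic_loops)
  then show ?thesis using c(3) by (simp flip: winding_number_offset)
qed

lemma winding_\<sigma>': "winding_number \<sigma>' 0 = 1"
  by (rule turning_number[OF \<sigma>_der \<sigma>'_cont \<sigma>_per \<sigma>_inj \<sigma>'_nz C_out winding_\<sigma>_C])

end

section \<open>Tangent spaces and Maslov phase of a Brendel torus\<close>

lemma has_vector_derivative_eventually_const:
  fixes f :: "real \<Rightarrow> complex"
  assumes "(f has_vector_derivative D) (at 0)" "\<forall>\<^sub>F \<tau> in nhds 0. f \<tau> = K"
  shows "D = 0"
proof -
  obtain S where S: "open S" "0 \<in> S" "\<And>\<tau>. \<tau> \<in> S \<Longrightarrow> f \<tau> = K"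
    using assms(2) unfolding eventually_nhds by blast
  have "((\<lambda>_. K) has_vector_derivative D) (at 0)"
    by (rule has_vector_derivative_transform_within_open[OF assms(1) S(1,2)]) (use S(3) in auto)
  then show ?thesis using vector_derivative_unique_at has_vector_derivative_const by blast
qed

lemma has_vector_derivative_cis_affine:
  "((\<lambda>\<tau>. cis (a + b * \<tau>)) has_vector_derivative \<i> * of_real b * cis a) (at 0)"
proof -
  have "((\<lambda>\<tau>. exp (\<i> * (of_real a + of_real b * \<tau>))) has_field_derivative \<i> * of_real b * cis a) (at (of_real 0))"
    by (auto intro!: derivative_eq_intros simp: cis_conv_exp)
  from has_vector_derivative_real_field[OF this] show ?thesis by (simp add: cis_conv_exp)
qed

lemma has_field_derivative_inverse_power:
  fixes z :: complex
  assumes "k \<ge> 1" "z \<noteq> 0"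
  shows "((\<lambda>z. inverse (z ^ k)) has_field_derivative - of_nat k * inverse (z ^ k) / z) (at z)"
proof -
  have "Suc (k - Suc 0) = k" using assms(1) by simp
  then have zk: "z ^ k = z * z ^ (k - Suc 0)" using power_Suc[of z "k - Suc 0"] by simp
  have "((\<lambda>z. inverse (z ^ k)) has_field_derivative - (inverse (z ^ k) * (of_nat k * (1 * z ^ (k - Suc 0))) * inverse (z ^ k))) (at z)"
    by (rule DERIV_inverse'[OF DERIV_power[OF DERIV_ident]]) (use assms in simp)
  moreover have "- (inverse (z ^ k) * (of_nat k * (1 * z ^ (k - Suc 0))) * inverse (z ^ k)) = - of_nat k * inverse (z ^ k) / z"
    unfolding zk using assms(2) by (simp add: field_simps)
  ultimately show ?thesis by simp
qed

context brendel_curve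
begin

definition torus_param :: "real \<times> real \<times> real \<Rightarrow> complex^3" where
  "torus_param = (\<lambda>(x, y, t). vector [of_real (r t) * cis (2 * pi * x), of_real (\<rho> t) * cis (2 * pi * y),
      cis (2 * pi * (real k * x - y)) * \<gamma> t])"

abbreviation "torus \<equiv> brendel_torus k (range \<gamma>)"

lemma torus_param_nth:
  "torus_param (x, y, t) $ 1 = of_real (r t) * cis (2 * pi * x)"
  "torus_param (x, y, t) $ 2 = of_real (\<rho> t) * cis (2 * pi * y)"
  "torus_param (x, y, t) $ 3 = cis (2 * pi * (real k * x - y)) * \<gamma> t"
  by (simp_all add: torus_param_def)

lemma range_torus_param: "range torus_param = torus"
  unfolding brendel_torus_def torus_param_def r_def \<rho>_def by (force simp: image_iff)

lemma cis_mult_pow: "cis (2 * pi * (real k * x - y)) * cis (2 * pi * y) = cis (2 * pi * x) ^ k"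
proof -
  have "2 * pi * (real k * x - y) + 2 * pi * y = real k * (2 * pi * x)" by (simp add: algebra_simps)
  then show ?thesis by (simp only: cis_mult Complex.DeMoivre)
qed

lemma torus_quotient: "torus_param (x, y, t) $ 2 * torus_param (x, y, t) $ 3 = \<sigma> t * torus_param (x, y, t) $ 1 ^ k"
proof -
  have "torus_param (x, y, t) $ 2 * torus_param (x, y, t) $ 3
     = of_real (\<rho> t) * \<gamma> t * (cis (2 * pi * (real k * x - y)) * cis (2 * pi * y))"
    by (simp add: torus_param_nth)
  also have "\<dots> = \<sigma> t * torus_param (x, y, t) $ 1 ^ k"
    unfolding cis_mult_pow by (simp add: torus_param_nth \<sigma>_def power_mult_distrib r_nz)
  finally show ?thesis .
qed

text \<open>The columns are the velocities of \<open>torus_param\<close> in the two angles, divided by \<open>2 * pi\<close>, and in the parameter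
  of the curve.\<close>

definition torus_frame :: "real \<Rightarrow> real \<Rightarrow> real \<Rightarrow> complex^3^3" where
  "torus_frame x y t = (let z = torus_param (x, y, t) in
     vector [vector [\<i> * z $ 1, 0, of_real (r' t) * cis (2 * pi * x)],
             vector [0, \<i> * z $ 2, of_real (\<rho>' t) * cis (2 * pi * y)],
             vector [\<i> * of_nat k * z $ 3, - \<i> * z $ 3, cis (2 * pi * (real k * x - y)) * \<gamma>' t]])"

lemma g'_eq: "r t ^ (k + 1) * g' t = r t * \<rho>' t - real k * \<rho> t * r' t"
  using r_nz[of t] by (simp add: g'_def r'_def power_add field_simps power2_eq_square)

text \<open>The phase of the torus thus has two sources: the rotation by the first angle, and the tangent of the plane
  curve \<open>\<sigma>\<close>.\<close>

lemma det_torus_frame: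
  "det (torus_frame x y t) = - cis (2 * pi * (real (k + 1) * x)) * of_real (r t ^ (k + 1)) * \<sigma>' t"
proof -
  define X where "X = cis (2 * pi * x)"
  define Y where "Y = cis (2 * pi * y)"
  define W where "W = cis (2 * pi * (real k * x - y))"
  have XYW: "cis (2 * pi * (real (k + 1) * x)) = X * Y * W" by (simp add: X_def Y_def W_def cis_mult algebra_simps)
  have "of_real (r t ^ (k + 1)) * \<sigma>' t = of_real (r t ^ (k + 1) * g' t) * \<gamma> t + of_real (r t ^ (k + 1) * (\<rho> t / r t ^ k)) * \<gamma>' t"
    unfolding \<sigma>'_def of_real_mult by (simp only: distrib_left mult.assoc)
  also have "r t ^ (k + 1) * (\<rho> t / r t ^ k) = r t * \<rho> t" using r_nz[of t] by simp
  finally have D: "of_real (r t ^ (k + 1)) * \<sigma>' t = of_real (r t * \<rho>' t - real k * \<rho> t * r' t) * \<gamma> t + of_real (r t * \<rho> t) * \<gamma>' t"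
    unfolding g'_eq .
  have "det (torus_frame x y t) = - (X * Y * W) * (of_real (r t * \<rho>' t - real k * \<rho> t * r' t) * \<gamma> t + of_real (r t * \<rho> t) * \<gamma>' t)"
    unfolding det_3 torus_frame_def Let_def torus_param_nth X_def[symmetric] Y_def[symmetric] W_def[symmetric]
    by (simp add: algebra_simps)
  then show ?thesis unfolding D[symmetric] XYW by (simp only: mult.assoc)
qed

lemma det_torus_frame_nz: "det (torus_frame x y t) \<noteq> 0"
  using r_nz[of t] \<sigma>'_nz[of t] by (simp add: det_torus_frame)

lemma torus_frame_mult:
  fixes b :: "3 \<Rightarrow> real"
  shows "(torus_frame x y t *v (\<chi> j. of_real (b j))) $ 1 = \<i> * of_real (b 1) * torus_param (x, y, t) $ 1 + of_real (b 3 * r' t) * cis (2 * pi * x)"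
    "(torus_frame x y t *v (\<chi> j. of_real (b j))) $ 2 = \<i> * of_real (b 2) * torus_param (x, y, t) $ 2 + of_real (b 3 * \<rho>' t) * cis (2 * pi * y)"
    "(torus_frame x y t *v (\<chi> j. of_real (b j))) $ 3 = \<i> * of_real (real k * b 1 - b 2) * torus_param (x, y, t) $ 3 + of_real (b 3) * cis (2 * pi * (real k * x - y)) * \<gamma>' t"
  unfolding matrix_vector_mult_def torus_frame_def Let_def
  by (simp_all add: sum_3 algebra_simps)

lemma torus_velocity_realised:
  fixes b :: "3 \<Rightarrow> real"
  shows "torus_frame x y t *v (\<chi> j. of_real (b j)) \<in> tangent_space torus (torus_param (x, y, t))"
proof -
  define d where "d = (\<lambda>\<tau>. torus_param (x + \<tau> * (b 1 / (2 * pi)), y + \<tau> * (b 2 / (2 * pi)), t + \<tau> * b 3))"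
  have shift: "((\<lambda>\<tau>. t + \<tau> * b 3) has_real_derivative b 3) (at 0)" by (auto intro!: derivative_eq_intros)
  have shiftv: "((\<lambda>\<tau>. t + \<tau> * b 3) has_vector_derivative b 3) (at 0)"
    using shift by (simp add: has_real_derivative_iff_has_vector_derivative)
  have rd: "((\<lambda>\<tau>. complex_of_real (r (t + \<tau> * b 3))) has_vector_derivative of_real (b 3 * r' t)) (at 0)"
    by (rule of_real_der) (use DERIV_chain'[OF shift, of r "r' t"] r_der[of t] in \<open>simp add: mult.commute\<close>)
  have \<rho>d: "((\<lambda>\<tau>. complex_of_real (\<rho> (t + \<tau> * b 3))) has_vector_derivative of_real (b 3 * \<rho>' t)) (at 0)"
    by (rule of_real_der) (use DERIV_chain'[OF shift, of \<rho> "\<rho>' t"] \<rho>_der[of t] in \<open>simp add: mult.commute\<close>)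
  have \<gamma>d: "((\<lambda>\<tau>. \<gamma> (t + \<tau> * b 3)) has_vector_derivative of_real (b 3) * \<gamma>' t) (at 0)"
    using vector_diff_chain_at[OF shiftv, of \<gamma> "\<gamma>' t"] der[of t] by (simp add: o_def scaleR_conv_of_real)
  have cisd: "((\<lambda>\<tau>. cis (2 * pi * (u + \<tau> * (v / (2 * pi))))) has_vector_derivative \<i> * of_real v * cis (2 * pi * u)) (at 0)" for u v
  proof -
    have "2 * pi * (u + \<tau> * (v / (2 * pi))) = 2 * pi * u + v * \<tau>" for \<tau> by (simp add: field_simps)
    then show ?thesis using has_vector_derivative_cis_affine[of "2 * pi * u" v] by simp
  qed
  have "(d has_vector_derivative torus_frame x y t *v (\<chi> j. of_real (b j))) (at 0)"
  proof (rule has_vector_derivative_vec)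
    fix i :: 3
    have "((\<lambda>\<tau>. d \<tau> $ 1) has_vector_derivative (torus_frame x y t *v (\<chi> j. of_real (b j))) $ 1) (at 0)"
      using has_vector_derivative_mult[OF rd cisd[of x "b 1"]]
      by (simp add: torus_frame_mult d_def torus_param_nth algebra_simps)
    moreover have "((\<lambda>\<tau>. d \<tau> $ 2) has_vector_derivative (torus_frame x y t *v (\<chi> j. of_real (b j))) $ 2) (at 0)"
      using has_vector_derivative_mult[OF \<rho>d cisd[of y "b 2"]]
      by (simp add: torus_frame_mult d_def torus_param_nth algebra_simps)
    moreover have "((\<lambda>\<tau>. d \<tau> $ 3) has_vector_derivative (torus_frame x y t *v (\<chi> j. of_real (b j))) $ 3) (at 0)"
    proof -
      have "real k * (x + \<tau> * (b 1 / (2 * pi))) - (y + \<tau> * (b 2 / (2 * pi))) = (real k * x - y) + \<tau> * ((real k * b 1 - b 2) / (2 * pi))" for \<tau>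
        by (simp add: field_simps)
      then have d3: "d \<tau> $ 3 = cis (2 * pi * ((real k * x - y) + \<tau> * ((real k * b 1 - b 2) / (2 * pi)))) * \<gamma> (t + \<tau> * b 3)" for \<tau>
        by (simp only: d_def torus_param_nth)
      show ?thesis
        unfolding d3 using has_vector_derivative_mult[OF cisd[of "real k * x - y" "real k * b 1 - b 2"] \<gamma>d]
        by (simp add: torus_frame_mult torus_param_nth mult_ac add.commute)
    qed
    ultimately show "((\<lambda>\<tau>. d \<tau> $ i) has_vector_derivative (torus_frame x y t *v (\<chi> j. of_real (b j))) $ i) (at 0)"
      using exhaust_3[of i] by auto
  qed
  moreover have "d 0 = torus_param (x, y, t)" by (simp add: d_def)
  moreover have "\<forall>\<^sub>F \<tau> in nhds 0. d \<tau> \<in> torus"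
    by (rule always_eventually) (auto simp: d_def range_torus_param[symmetric])
  ultimately show ?thesis unfolding tangent_space_def by blast
qed

text \<open>Three equations that hold on the torus and will be differentiated along curves in it. They are written
  without moduli, so that the product rule applies.\<close>

lemma torus_equations:
  fixes z :: "complex^3"
  assumes "z \<in> torus"
  shows "z $ 2 * cnj (z $ 2) - z $ 3 * cnj (z $ 3) = 0" "z $ 1 * cnj (z $ 1) + of_nat k * (z $ 2 * cnj (z $ 2)) = 1"
    "z $ 2 * z $ 3 * inverse (z $ 1 ^ k) \<in> range \<sigma>"
proof -
  obtain x y t where z: "z = torus_param (x, y, t)" using assms unfolding range_torus_param[symmetric] by auto
  have n: "cmod (z $ 1) = r t" "cmod (z $ 2) = \<rho> t" "cmod (z $ 3) = \<rho> t"
    using r_pos[of t] \<rho>_pos[of t] by (simp_all add: z torus_param_nth norm_mult \<rho>_def)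
  show "z $ 2 * cnj (z $ 2) - z $ 3 * cnj (z $ 3) = 0" by (simp add: n flip: complex_norm_square)
  have "z $ 1 * cnj (z $ 1) + of_nat k * (z $ 2 * cnj (z $ 2)) = of_real ((r t)\<^sup>2 + real k * (\<rho> t)\<^sup>2)"
    by (simp add: n flip: complex_norm_square)
  then show "z $ 1 * cnj (z $ 1) + of_nat k * (z $ 2 * cnj (z $ 2)) = 1" by (simp add: r_sq)
  have "z $ 1 \<noteq> 0" using n(1) r_nz[of t] by auto
  then have "z $ 2 * z $ 3 * inverse (z $ 1 ^ k) = \<sigma> t" using torus_quotient[of x y t] by (simp add: z)
  then show "z $ 2 * z $ 3 * inverse (z $ 1 ^ k) \<in> range \<sigma>" by simp
qed

lemma \<sigma>'_log: "\<sigma>' t = \<sigma> t * (of_real (\<rho>' t / \<rho> t) + \<gamma>' t / \<gamma> t - of_nat k * of_real (r' t / r t))"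
proof -
  have "of_real (\<rho> t / r t ^ k) * of_real (\<rho>' t / \<rho> t - real k * r' t / r t) = complex_of_real (g' t)"
  proof -
    have "r t ^ (k + 1) * (\<rho> t / r t ^ k * (\<rho>' t / \<rho> t - real k * r' t / r t)) = r t ^ (k + 1) * g' t"
      unfolding g'_eq using r_nz[of t] \<rho>_nz[of t] by (simp add: field_simps)
    then have "\<rho> t / r t ^ k * (\<rho>' t / \<rho> t - real k * r' t / r t) = g' t" using r_nz[of t] by simp
    then show ?thesis unfolding of_real_mult[symmetric] by (rule arg_cong)
  qed
  moreover have "\<sigma> t * (of_real (\<rho>' t / \<rho> t) + \<gamma>' t / \<gamma> t - of_nat k * of_real (r' t / r t))
     = (of_real (\<rho> t / r t ^ k) * of_real (\<rho>' t / \<rho> t - real k * r' t / r t)) * \<gamma> t + of_real (\<rho> t / r t ^ k) * \<gamma>' t"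
    using \<gamma>_nz[of t] by (simp add: \<sigma>_def algebra_simps)
  ultimately show ?thesis by (simp only: \<sigma>'_def)
qed

lemma Re_log_\<gamma>: "Re (\<gamma>' t / \<gamma> t) = \<rho>' t / \<rho> t"
proof -
  have "\<gamma>' t / \<gamma> t = (cnj (\<gamma> t) * \<gamma>' t) / of_real ((\<rho> t)\<^sup>2)"
    unfolding \<rho>_def complex_norm_square using \<gamma>_nz[of t] by (simp add: field_simps)
  then have "Re (\<gamma>' t / \<gamma> t) = Re (cnj (\<gamma> t) * \<gamma>' t) / (\<rho> t)\<^sup>2" by (simp only: Re_divide_of_real)
  then show ?thesis by (simp add: \<rho>'_def power2_eq_square)
qed

text \<open>Let \<open>a1\<close>, \<open>a2\<close>, \<open>a3\<close> be the logarithmic derivatives of the coordinates along a curve in the torus. The equations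
  for the moduli give two linear relations between their real parts. As \<open>z\<^sub>2 * z\<^sub>3 / z\<^sub>1 ^ k\<close> moves along \<open>\<sigma>\<close>, the
  number \<open>a2 + a3 - k * a1\<close> is a real multiple \<open>\<mu>\<close> of \<open>\<sigma>' t / \<sigma> t\<close>. After subtraction of \<open>\<mu>\<close> times the third
  column of the frame all three relations are homogeneous; they leave only imaginary logarithmic derivatives,
  which are combinations of the first two columns.\<close>

lemma torus_velocity_in_frame:
  fixes w :: "complex^3"
  assumes "w \<in> tangent_space torus (torus_param (x, y, t))"
  obtains b where "w = torus_frame x y t *v (\<chi> j. of_real (b j))"
proof -
  define z where "z = torus_param (x, y, t)"
  obtain d where d: "d 0 = z" "\<forall>\<^sub>F \<tau> in nhds 0. d \<tau> \<in> torus" "(d has_vector_derivative w) (at 0)"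
    using assms unfolding tangent_space_def z_def by blast
  have dd: "((\<lambda>\<tau>. d \<tau> $ i) has_vector_derivative w $ i) (at 0)" for i
    by (rule bounded_linear.has_vector_derivative[OF bounded_linear_vec_nth d(3)])
  have z1: "z $ 1 = of_real (r t) * cis (2 * pi * x)" and z2: "z $ 2 = of_real (\<rho> t) * cis (2 * pi * y)"
    and z3: "z $ 3 = cis (2 * pi * (real k * x - y)) * \<gamma> t" by (simp_all add: z_def torus_param_nth)
  have nz: "z $ 1 \<noteq> 0" "z $ 2 \<noteq> 0" "z $ 3 \<noteq> 0" using r_nz[of t] \<rho>_nz[of t] \<gamma>_nz[of t] by (auto simp: z1 z2 z3)
  have sq: "z $ 1 * cnj (z $ 1) = of_real ((r t)\<^sup>2)" "z $ 2 * cnj (z $ 2) = of_real ((\<rho> t)\<^sup>2)" "z $ 3 * cnj (z $ 3) = of_real ((\<rho> t)\<^sup>2)"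
    using r_pos[of t] \<rho>_pos[of t] unfolding complex_norm_square[symmetric] z1 z2 z3
    by (simp_all add: norm_mult \<rho>_def)
  define a1 where "a1 = w $ 1 / z $ 1"
  define a2 where "a2 = w $ 2 / z $ 2"
  define a3 where "a3 = w $ 3 / z $ 3"
  have w: "w $ 1 = a1 * z $ 1" "w $ 2 = a2 * z $ 2" "w $ 3 = a3 * z $ 3" using nz by (auto simp: a1_def a2_def a3_def)
  have sqd: "((\<lambda>\<tau>. d \<tau> $ i * cnj (d \<tau> $ i)) has_vector_derivative z $ i * cnj (w $ i) + w $ i * cnj (z $ i)) (at 0)" for i
    using has_vector_derivative_mult[OF dd has_vector_derivative_cnj[OF dd], of i i] by (simp add: d(1))
  have re: "a * u * cnj u + u * cnj (a * u) = of_real (2 * Re a) * (u * cnj u)" for a u :: complex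
    by (simp add: complex_eq_iff algebra_simps)
  have "z $ 2 * cnj (w $ 2) + w $ 2 * cnj (z $ 2) - (z $ 3 * cnj (w $ 3) + w $ 3 * cnj (z $ 3)) = 0"
    by (rule has_vector_derivative_eventually_const[OF has_vector_derivative_diff[OF sqd sqd]])
       (use d(2) in \<open>auto elim!: eventually_mono simp: torus_equations\<close>)
  then have "of_real (2 * Re a2) * complex_of_real ((\<rho> t)\<^sup>2) - of_real (2 * Re a3) * of_real ((\<rho> t)\<^sup>2) = 0"
    unfolding w using re[of a2 "z $ 2"] re[of a3 "z $ 3"] by (simp add: sq add.commute)
  then have R23: "Re a2 = Re a3"
    unfolding of_real_mult[symmetric] of_real_diff[symmetric] of_real_eq_0_iff using \<rho>_nz[of t] by simp
  have "z $ 1 * cnj (w $ 1) + w $ 1 * cnj (z $ 1) + of_nat k * (z $ 2 * cnj (w $ 2) + w $ 2 * cnj (z $ 2)) = 0"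
    by (rule has_vector_derivative_eventually_const[OF has_vector_derivative_add[OF sqd has_vector_derivative_mult_right[OF sqd]]])
       (use d(2) in \<open>auto elim!: eventually_mono simp: torus_equations\<close>)
  then have "of_real (2 * Re a1) * complex_of_real ((r t)\<^sup>2) + of_real (real k) * (of_real (2 * Re a2) * of_real ((\<rho> t)\<^sup>2)) = 0"
    unfolding w using re[of a1 "z $ 1"] re[of a2 "z $ 2"] by (simp add: sq add.commute)
  then have R12: "Re a1 * (r t)\<^sup>2 + real k * (Re a2 * (\<rho> t)\<^sup>2) = 0"
    unfolding of_real_mult[symmetric] of_real_add[symmetric] of_real_eq_0_iff by simp
  define E where "E = (\<lambda>\<tau>. d \<tau> $ 2 * d \<tau> $ 3 * inverse (d \<tau> $ 1 ^ k))"
  have E0: "E 0 = \<sigma> t" using torus_quotient[of x y t] nz(1) by (simp add: E_def d(1) z_def)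
  have "((\<lambda>\<tau>. inverse (d \<tau> $ 1 ^ k)) has_vector_derivative w $ 1 * (- of_nat k * inverse (z $ 1 ^ k) / z $ 1)) (at 0)"
  proof -
    have "((\<lambda>z. inverse (z ^ k)) has_field_derivative - of_nat k * inverse (z $ 1 ^ k) / z $ 1) (at (d 0 $ 1))"
      unfolding d(1) by (rule has_field_derivative_inverse_power[OF k nz(1)])
    from field_vector_diff_chain_at[OF dd[of 1] this] show ?thesis by (simp only: o_def)
  qed
  from has_vector_derivative_mult[OF has_vector_derivative_mult[OF dd[of 2] dd[of 3]] this]
  have "(E has_vector_derivative E 0 * (a2 + a3 - of_nat k * a1)) (at 0)"
    unfolding E_def d(1) w using nz by (simp add: algebra_simps)
  moreover have "\<forall>\<^sub>F \<tau> in nhds 0. E \<tau> \<in> range \<sigma>"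
    using d(2) unfolding E_def by (rule eventually_mono) (rule torus_equations(3))
  ultimately obtain \<mu> where "E 0 * (a2 + a3 - of_nat k * a1) = of_real \<mu> * \<sigma>' t"
    using velocity_in_embedded_loop[where \<sigma> = \<sigma> and \<sigma>' = \<sigma>' and e = E and ?t0.0 = t,
        OF \<sigma>_der \<sigma>'_cont \<sigma>_per \<sigma>_inj \<sigma>'_nz _ E0] by metis
  moreover have "\<sigma> t \<noteq> 0" using \<gamma>_nz r_nz \<rho>_nz by (simp add: \<sigma>_def)
  ultimately have \<mu>: "a2 + a3 - of_nat k * a1 = of_real \<mu> * (of_real (\<rho>' t / \<rho> t) + \<gamma>' t / \<gamma> t - of_nat k * of_real (r' t / r t))"
    unfolding \<sigma>'_log E0 by simp
  \<comment> \<open>The real parts of the logarithmic derivatives of the third column are \<open>q\<close>, \<open>p\<close> and \<open>p\<close>.\<close>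
  define p where "p = \<rho>' t / \<rho> t"
  define q where "q = r' t / r t"
  have qp: "q * (r t)\<^sup>2 + real k * (p * (\<rho> t)\<^sup>2) = 0"
    unfolding p_def q_def using r_nz[of t] \<rho>_nz[of t] by (simp add: r'_def power2_eq_square)
  have "Re a2 + Re a3 - real k * Re a1 = \<mu> * (2 * p - real k * q)"
    using arg_cong[OF \<mu>, of Re] Re_log_\<gamma>[of t] by (simp add: p_def q_def)
  then have uv: "2 * (Re a2 - \<mu> * p) = real k * (Re a1 - \<mu> * q)" using R23 by (simp add: algebra_simps)
  then have uv': "Re a2 - \<mu> * p = real k * (Re a1 - \<mu> * q) / 2" by simp
  have "(Re a1 - \<mu> * q) * (r t)\<^sup>2 + real k * ((Re a2 - \<mu> * p) * (\<rho> t)\<^sup>2) = 0"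
    using R12 arg_cong[OF qp, of "\<lambda>v. \<mu> * v"] by (simp add: algebra_simps)
  then have "(Re a1 - \<mu> * q) * (r t)\<^sup>2 + real k * ((real k * (Re a1 - \<mu> * q) / 2) * (\<rho> t)\<^sup>2) = 0"
    unfolding uv' .
  then have "(Re a1 - \<mu> * q) * ((r t)\<^sup>2 + (real k)\<^sup>2 * (\<rho> t)\<^sup>2 / 2) = 0"
    by (simp add: algebra_simps power2_eq_square)
  moreover have "(r t)\<^sup>2 + (real k)\<^sup>2 * (\<rho> t)\<^sup>2 / 2 > 0" using r_nz[of t] by (intro add_pos_nonneg) auto
  ultimately have "Re a1 = \<mu> * q" by (auto simp: less_imp_neq[symmetric])
  with uv have "Re a2 = \<mu> * p" by simp
  have a1: "a1 = of_real (\<mu> * q) + \<i> * of_real (Im a1)" using \<open>Re a1 = \<mu> * q\<close> by (simp add: complex_eq_iff)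
  have a2: "a2 = of_real (\<mu> * p) + \<i> * of_real (Im a2)" using \<open>Re a2 = \<mu> * p\<close> by (simp add: complex_eq_iff)
  have "a3 = of_nat k * a1 - a2 + of_real \<mu> * (of_real p + \<gamma>' t / \<gamma> t - of_nat k * of_real q)"
    using \<mu> by (simp add: p_def q_def algebra_simps)
  then have a3: "a3 = \<i> * of_real (real k * Im a1 - Im a2) + of_real \<mu> * (\<gamma>' t / \<gamma> t)"
    using a1 a2 by (simp add: complex_eq_iff algebra_simps)
  define b :: "3 \<Rightarrow> real" where "b = (\<lambda>j. if j = 1 then Im a1 else if j = 2 then Im a2 else \<mu>)"
  have b: "b 1 = Im a1" "b 2 = Im a2" "b 3 = \<mu>" by (simp_all add: b_def)
  have "w $ 1 = (torus_frame x y t *v (\<chi> j. of_real (b j))) $ 1"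
    unfolding torus_frame_mult b z_def[symmetric] w(1) using r_nz[of t] by (subst a1) (simp add: z1 q_def distrib_right)
  moreover have "w $ 2 = (torus_frame x y t *v (\<chi> j. of_real (b j))) $ 2"
    unfolding torus_frame_mult b z_def[symmetric] w(2) using \<rho>_nz[of t] by (subst a2) (simp add: z2 p_def distrib_right)
  moreover have "w $ 3 = (torus_frame x y t *v (\<chi> j. of_real (b j))) $ 3"
    unfolding torus_frame_mult b z_def[symmetric] w(3) a3 using \<gamma>_nz[of t] by (simp add: z3 distrib_right)
  ultimately have "w = torus_frame x y t *v (\<chi> j. of_real (b j))" by (simp add: vec_eq_iff forall_3)
  then show thesis by (rule that)
qed

lemma maslov_phase_torus:
  "maslov_phase torus (torus_param (x, y, t)) = cis (2 * pi * (real (k + 1) * x)) ^ 2 * (sgn (\<sigma>' t))\<^sup>2"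
proof -
  have inj: "inj (\<lambda>j. column j (torus_frame x y t))"
    using det_torus_frame_nz det_identical_columns by (metis injI)
  have "span (columns (torus_frame x y t)) = tangent_space torus (torus_param (x, y, t))"
    unfolding span_columns[OF inj]
  proof (intro subset_antisym subsetI)
    fix w assume "w \<in> {torus_frame x y t *v (\<chi> j. of_real (b j)) | b. True}"
    then obtain b where "w = torus_frame x y t *v (\<chi> j. of_real (b j))" by (elim CollectE exE conjE)
    then show "w \<in> tangent_space torus (torus_param (x, y, t))" by (simp only: torus_velocity_realised)
  next
    fix w assume "w \<in> tangent_space torus (torus_param (x, y, t))"
    then obtain b where "w = torus_frame x y t *v (\<chi> j. of_real (b j))" by (rule torus_velocity_in_frame)
    then show "w \<in> {torus_frame x y t *v (\<chi> j. of_real (b j)) | b. True}" by (intro CollectI exI conjI TrueI)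
  qed
  then have "maslov_phase torus (torus_param (x, y, t)) = (sgn (det (torus_frame x y t)))\<^sup>2"
    by (intro maslov_phase_eq det_torus_frame_nz)
  also have "sgn (det (torus_frame x y t)) = - cis (2 * pi * (real (k + 1) * x)) * sgn (\<sigma>' t)"
  proof -
    have "0 < r t ^ (k + 1)" using r_pos by simp
    then show ?thesis unfolding det_torus_frame sgn_mult sgn_minus sgn_cis sgn_of_real by simp
  qed
  finally show ?thesis by (simp add: power_mult_distrib)
qed

end

section \<open>Loops on a Brendel torus\<close>

lemma cis_exp: "cis (2 * pi * x) = exp (2 * of_real pi * \<i> * of_real x)"
  by (simp add: cis_conv_exp mult_ac)

lemma cis_eq_iff: "cis (2 * pi * x) = cis (2 * pi * y) \<longleftrightarrow> x - y \<in> \<int>"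
  unfolding cis_exp by (rule exp_unit_eq_iff)

lemma circlepath_unit: "circlepath 0 1 = (\<lambda>s. cis (2 * pi * s))"
  by (simp add: fun_eq_iff circlepath cis_exp)

lemma continuous_on_vector_3:
  assumes "continuous_on S a" "continuous_on S b" "continuous_on S c"
  shows "continuous_on S (\<lambda>x. vector [a x, b x, c x] :: complex^3)"
proof -
  have eq: "(\<lambda>x. vector [a x, b x, c x] :: complex^3) = (\<lambda>x. \<chi> i. if i = 1 then a x else if i = 2 then b x else c x)"
    by (simp add: fun_eq_iff vec_eq_iff forall_3)
  show ?thesis unfolding eq
  proof (rule continuous_on_vec_lambda)
    fix i :: 3
    show "continuous_on S (\<lambda>x. if i = 1 then a x else if i = 2 then b x else c x)"
      using exhaust_3[of i] assms by auto
  qed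
qed

context brendel_curve
begin

lemma \<gamma>_eq_iff: "\<gamma> s = \<gamma> t \<longleftrightarrow> s - t \<in> \<int>" by (rule periodic_inj_eq_iff[OF per inj])

lemma torus_param_cont: "continuous_on UNIV torus_param"
  unfolding torus_param_def case_prod_unfold
  by (intro continuous_on_vector_3 continuous_intros continuous_on_compose2[OF r_cont[of UNIV]]
       continuous_on_compose2[OF \<rho>_cont[of UNIV]] continuous_on_compose2[OF \<gamma>_cont[of UNIV]]) auto

lemma period_torus_param: "period torus_param (of_int q, of_int n, of_int p)"
proof -
  have "torus_param (x + of_int q, y + of_int n, t + of_int p) = torus_param (x, y, t)" for x y t
  proof -
    have "\<gamma> (t + of_int p) = \<gamma> t" by (simp add: \<gamma>_eq_iff)
    moreover have "cis (2 * pi * (x + of_int q)) = cis (2 * pi * x)" "cis (2 * pi * (y + of_int n)) = cis (2 * pi * y)"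
      by (simp_all add: cis_eq_iff)
    moreover have "cis (2 * pi * (real k * (x + of_int q) - (y + of_int n))) = cis (2 * pi * (real k * x - y))"
    proof -
      have "real k * (x + of_int q) - (y + of_int n) - (real k * x - y) = of_int (int k * q - n)"
        by (simp add: algebra_simps)
      then show ?thesis unfolding cis_eq_iff by (metis Ints_of_int)
    qed
    ultimately show ?thesis by (simp add: torus_param_def r_def \<rho>_def)
  qed
  then show ?thesis by (auto simp: period_def)
qed

text \<open>The first two parameters are polar angles of the first two coordinates. When the third coordinate is rotated
  back by these angles, it moves on the curve itself, and \<open>loop_lift_through_curve\<close> applies.\<close>

lemma torus_path_lift:
  fixes l :: "real \<Rightarrow> complex^3"
  assumes l: "continuous_on {0..1} l" "\<And>s. s \<in> {0..1} \<Longrightarrow> l s \<in> torus"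
  obtains x y t where "continuous_on {0..1} x" "continuous_on {0..1} y" "continuous_on {0..1} t"
    "\<And>s. s \<in> {0..1} \<Longrightarrow> l s = torus_param (x s, y s, t s)"
proof -
  have lc: "continuous_on {0..1} (\<lambda>s. l s $ i)" for i using l(1) by (intro continuous_intros)
  have ex: "\<exists>x y t. l s = torus_param (x, y, t)" if "s \<in> {0..1}" for s
    using l(2)[OF that] unfolding range_torus_param[symmetric] by auto
  have nz: "l s $ 1 \<noteq> 0" "l s $ 2 \<noteq> 0" if "s \<in> {0..1}" for s
    using ex[OF that] r_nz \<rho>_nz by (auto simp: torus_param_nth)
  obtain x where x: "continuous_on {0..1} x" "\<And>s. s \<in> {0..1} \<Longrightarrow> l s $ 1 = of_real (norm (l s $ 1)) * cis (2 * pi * x s)"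
    using continuous_polar_lift[OF lc nz(1)] by blast
  obtain y where y: "continuous_on {0..1} y" "\<And>s. s \<in> {0..1} \<Longrightarrow> l s $ 2 = of_real (norm (l s $ 2)) * cis (2 * pi * y s)"
    using continuous_polar_lift[OF lc nz(2)] by blast
  define v where "v = (\<lambda>s. l s $ 3 * cis (- (2 * pi * (real k * x s - y s))))"
  have vc: "continuous_on {0..1} v" unfolding v_def by (intro continuous_intros lc x(1) y(1))
  have key: "\<exists>t. l s = torus_param (x s, y s, t) \<and> v s = \<gamma> t" if s: "s \<in> {0..1}" for s
  proof -
    obtain x0 y0 t0 where 0: "l s = torus_param (x0, y0, t0)" using ex[OF s] by blast
    have n1: "norm (l s $ 1) = r t0" and n2: "norm (l s $ 2) = \<rho> t0"
      using r_pos[of t0] \<rho>_pos[of t0] by (simp_all add: 0 torus_param_nth norm_mult)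
    have "cis (2 * pi * x0) = cis (2 * pi * x s)"
      using x(2)[OF s] unfolding n1 using r_nz[of t0] by (simp add: 0 torus_param_nth)
    then have xi: "x0 - x s \<in> \<int>" by (simp only: cis_eq_iff)
    have "cis (2 * pi * y0) = cis (2 * pi * y s)"
      using y(2)[OF s] unfolding n2 using \<rho>_nz[of t0] by (simp add: 0 torus_param_nth)
    then have yi: "y0 - y s \<in> \<int>" by (simp only: cis_eq_iff)
    obtain q n :: int where qn: "x0 = x s + of_int q" "y0 = y s + of_int n"
      using xi yi by (auto elim!: Ints_cases simp: algebra_simps)
    then have "l s = torus_param ((x s, y s, t0) + (of_int q, of_int n, of_int 0))" by (simp add: 0)
    also have "\<dots> = torus_param (x s, y s, t0)" using period_torus_param[of q n 0] unfolding period_def by blast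
    finally have ls: "l s = torus_param (x s, y s, t0)" .
    have "v s = \<gamma> t0 * (cis (2 * pi * (real k * x s - y s)) * cis (- (2 * pi * (real k * x s - y s))))"
      unfolding v_def ls torus_param_nth by (simp only: mult_ac)
    also have "\<dots> = \<gamma> t0" unfolding cis_mult by simp
    finally show ?thesis using ls by blast
  qed
  then have "v s \<in> range \<gamma>" if "s \<in> {0..1}" for s using that by (metis rangeI)
  then obtain t where t: "continuous_on {0..1} t" "\<And>s. s \<in> {0..1} \<Longrightarrow> v s = \<gamma> (t s)"
    using loop_lift_through_curve[OF \<gamma>_cont per inj vc] by blast
  have "l s = torus_param (x s, y s, t s)" if s: "s \<in> {0..1}" for s
  proof -
    obtain t0 where t0: "l s = torus_param (x s, y s, t0)" "v s = \<gamma> t0" using key[OF s] by blast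
    then show ?thesis using t(2)[OF s] by (simp add: torus_param_def r_def \<rho>_def)
  qed
  then show thesis using that x(1) y(1) t(1) by blast
qed

lemma torus_loop_lift:
  fixes l :: "real \<Rightarrow> complex^3"
  assumes l: "continuous_on {0..1} l" "\<And>s. s \<in> {0..1} \<Longrightarrow> l s \<in> torus" "l 1 = l 0"
  obtains x y t and q n p :: int where "continuous_on {0..1} x" "continuous_on {0..1} y" "continuous_on {0..1} t"
    "\<And>s. s \<in> {0..1} \<Longrightarrow> l s = torus_param (x s, y s, t s)"
    "x 1 = x 0 + of_int q" "y 1 = y 0 + of_int n" "t 1 = t 0 + of_int p"
proof -
  obtain x y t where c: "continuous_on {0..1} x" "continuous_on {0..1} y" "continuous_on {0..1} t"
    and eq: "\<And>s. s \<in> {0..1} \<Longrightarrow> l s = torus_param (x s, y s, t s)" using torus_path_lift[OF l(1,2)] by blast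
  have e: "torus_param (x 1, y 1, t 1) = torus_param (x 0, y 0, t 0)" using l(3) eq[of 0] eq[of 1] by simp
  have norms: "norm (torus_param (x, y, t) $ 1) = r t" "norm (torus_param (x, y, t) $ 2) = \<rho> t" for x y t
    using r_pos[of t] \<rho>_pos[of t] by (simp_all add: torus_param_nth norm_mult)
  have "r (t 1) = r (t 0)" "\<rho> (t 1) = \<rho> (t 0)" using norms e by metis+
  then have "cis (2 * pi * x 1) = cis (2 * pi * x 0)" "cis (2 * pi * y 1) = cis (2 * pi * y 0)"
    using arg_cong[OF e, of "\<lambda>z :: complex^3. z $ 1"] arg_cong[OF e, of "\<lambda>z :: complex^3. z $ 2"] r_nz[of "t 0"] \<rho>_nz[of "t 0"]
    by (auto simp: torus_param_nth)
  then have "x 1 - x 0 \<in> \<int>" "y 1 - y 0 \<in> \<int>" by (simp_all only: cis_eq_iff)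
  then obtain q n :: int where qn: "x 1 = x 0 + of_int q" "y 1 = y 0 + of_int n"
    by (auto elim!: Ints_cases simp: algebra_simps)
  have "torus_param (x 1, y 1, t 1) = torus_param ((x 0, y 0, t 1) + (of_int q, of_int n, of_int 0))" by (simp add: qn)
  also have "\<dots> = torus_param (x 0, y 0, t 1)" using period_torus_param[of q n 0] unfolding period_def by blast
  finally have "torus_param (x 0, y 0, t 1) $ 3 = torus_param (x 0, y 0, t 0) $ 3" using e by simp
  then have "\<gamma> (t 1) = \<gamma> (t 0)" by (simp add: torus_param_nth)
  then have "t 1 - t 0 \<in> \<int>" by (simp only: \<gamma>_eq_iff)
  then obtain p :: int where "t 1 = t 0 + of_int p" by (auto elim!: Ints_cases simp: algebra_simps)
  then show thesis using that c eq qn by blast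
qed

lemma winding_along_curve:
  assumes "continuous_on UNIV f" "\<And>t. f t \<noteq> 0" "\<And>t. f (t + 1) = f t"
    and "continuous_on {0..1} x" "x 1 = x 0 + of_int q" "continuous_on {0..1} t" "t 1 = t 0 + of_int p"
  shows "winding_number (\<lambda>s. cis (2 * pi * x s) * f (t s)) 0 = of_int q + of_int p * winding_number f 0"
proof -
  have cf: "continuous_on {0..1} (\<lambda>s. f (t s))" by (rule continuous_on_compose2[OF assms(1,6)]) auto
  have "winding_number (\<lambda>s. cis (2 * pi * x s) * f (t s)) 0
     = winding_number (\<lambda>s. cis (2 * pi * x s)) 0 + winding_number (\<lambda>s. f (t s)) 0"
    by (rule winding_number_times) (use assms(2,4) cf in \<open>auto simp: path_def path_image_def intro!: continuous_intros\<close>)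
  also have "winding_number (\<lambda>s. cis (2 * pi * x s)) 0 = of_int q"
    unfolding cis_exp by (subst winding_number_unit_exp[OF assms(4)]) (simp add: assms(5))
  also have "winding_number (\<lambda>s. f (t s)) 0 = of_int p * winding_number f 0"
    by (rule winding_number_reparametrized_loop[OF assms(1,2,3,6,7)])
  finally show ?thesis .
qed

lemma \<sigma>_neq_C: "\<sigma> t \<noteq> C"
  using C_out by (metis rangeI)

text \<open>The winding numbers attached to a loop \<open>l\<close> on the torus, in terms of the increments \<open>q\<close>, \<open>n\<close>, \<open>p\<close> of its lifted
  parameters.\<close>

context
  fixes x y t :: "real \<Rightarrow> real" and q n p :: int and l :: "real \<Rightarrow> complex^3"
  assumes x: "continuous_on {0..1} x" "x 1 = x 0 + of_int q"
    and y: "continuous_on {0..1} y" "y 1 = y 0 + of_int n"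
    and t: "continuous_on {0..1} t" "t 1 = t 0 + of_int p"
    and l: "\<And>s. s \<in> {0..1} \<Longrightarrow> l s = torus_param (x s, y s, t s)"
begin

lemma winding_coordinate_1: "winding_number (\<lambda>s. l s $ 1) 0 = of_int q"
proof -
  have "winding_number (\<lambda>s. l s $ 1) 0 = winding_number (\<lambda>s. cis (2 * pi * x s) * complex_of_real (r (t s))) 0"
    by (rule winding_number_cong) (simp add: l torus_param_nth)
  also have "\<dots> = of_int q + of_int p * winding_number (\<lambda>t. complex_of_real (r t)) 0"
    by (rule winding_along_curve) (use x t r_nz r_per in \<open>auto intro!: continuous_intros r_cont\<close>)
  also have "winding_number (\<lambda>t. complex_of_real (r t)) 0 = 0"
    by (rule winding_number_positive_real) (use r_per[of 0] r_pos in \<open>auto intro: r_cont\<close>)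
  finally show ?thesis by simp
qed

lemma winding_coordinate_2: "winding_number (\<lambda>s. l s $ 2) 0 = of_int n"
proof -
  have "winding_number (\<lambda>s. l s $ 2) 0 = winding_number (\<lambda>s. cis (2 * pi * y s) * complex_of_real (\<rho> (t s))) 0"
    by (rule winding_number_cong) (simp add: l torus_param_nth)
  also have "\<dots> = of_int n + of_int p * winding_number (\<lambda>t. complex_of_real (\<rho> t)) 0"
    by (rule winding_along_curve) (use y t \<rho>_nz \<rho>_per in \<open>auto intro!: continuous_intros \<rho>_cont\<close>)
  also have "winding_number (\<lambda>t. complex_of_real (\<rho> t)) 0 = 0"
    by (rule winding_number_positive_real) (use \<rho>_per[of 0] \<rho>_pos in \<open>auto intro: \<rho>_cont\<close>)
  finally show ?thesis by simp
qed

lemma winding_coordinate_3: "winding_number (\<lambda>s. l s $ 3) 0 = of_int (int k * q - n) + of_int p * winding_number \<gamma> 0"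
proof -
  have "winding_number (\<lambda>s. l s $ 3) 0 = winding_number (\<lambda>s. cis (2 * pi * (real k * x s - y s)) * \<gamma> (t s)) 0"
    by (rule winding_number_cong) (simp add: l torus_param_nth)
  also have "\<dots> = of_int (int k * q - n) + of_int p * winding_number \<gamma> 0"
    by (rule winding_along_curve) (use x y t \<gamma>_nz per in \<open>auto intro!: continuous_intros \<gamma>_cont simp: algebra_simps\<close>)
  finally show ?thesis .
qed

text \<open>On the torus the function \<open>z\<^sub>2 * z\<^sub>3 - C * z\<^sub>1 ^ k\<close> equals \<open>z\<^sub>1 ^ k * (\<sigma> - C)\<close>, and \<open>\<sigma>\<close> winds once around \<open>C\<close>.\<close>

lemma winding_fibration_value:
  "winding_number (\<lambda>s. l s $ 2 * l s $ 3 - C * l s $ 1 ^ k) 0 = of_int (int k * q + p)"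
proof -
  have kx: "cis (2 * pi * x s) ^ k = cis (2 * pi * (real k * x s))" for s
    unfolding Complex.DeMoivre by (simp add: mult_ac)
  have "winding_number (\<lambda>s. l s $ 2 * l s $ 3 - C * l s $ 1 ^ k) 0
     = winding_number (\<lambda>s. cis (2 * pi * (real k * x s)) * (of_real (r (t s) ^ k) * (\<sigma> (t s) - C))) 0"
  proof (rule winding_number_cong)
    fix s :: real assume "0 \<le> s" "s \<le> 1"
    then have ls: "l s = torus_param (x s, y s, t s)" by (simp add: l)
    have e1: "l s $ 2 * l s $ 3 - C * l s $ 1 ^ k = (\<sigma> (t s) - C) * l s $ 1 ^ k"
      unfolding ls torus_quotient by (simp only: left_diff_distrib)
    have e2: "l s $ 1 ^ k = of_real (r (t s) ^ k) * cis (2 * pi * (real k * x s))"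
      unfolding ls torus_param_nth power_mult_distrib kx by simp
    show "l s $ 2 * l s $ 3 - C * l s $ 1 ^ k = cis (2 * pi * (real k * x s)) * (of_real (r (t s) ^ k) * (\<sigma> (t s) - C))"
      by (subst e1, subst e2) (simp only: mult_ac)
  qed
  also have "\<dots> = of_int (int k * q) + of_int p * winding_number (\<lambda>t. of_real (r t ^ k) * (\<sigma> t - C)) 0"
    by (rule winding_along_curve)
       (use x t r_nz r_per \<sigma>_per \<sigma>_neq_C in \<open>auto intro!: continuous_intros r_cont \<sigma>_cont simp: algebra_simps\<close>)
  also have "winding_number (\<lambda>t. of_real (r t ^ k) * (\<sigma> t - C)) 0
     = winding_number (\<lambda>t. complex_of_real (r t ^ k)) 0 + winding_number (\<lambda>t. \<sigma> t - C) 0"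
    by (rule winding_number_times)
       (use r_nz \<sigma>_neq_C in \<open>auto simp: path_def path_image_def intro!: continuous_intros r_cont \<sigma>_cont\<close>)
  also have "winding_number (\<lambda>t. complex_of_real (r t ^ k)) 0 = 0"
    by (rule winding_number_positive_real) (use r_per[of 0] r_pos in \<open>auto intro!: continuous_intros r_cont\<close>)
  also have "winding_number (\<lambda>t. \<sigma> t - C) 0 = 1" using winding_\<sigma>_C by (simp flip: winding_number_offset)
  finally show ?thesis by simp
qed

lemma winding_maslov_phase: "winding_number (\<lambda>s. maslov_phase torus (l s)) 0 = of_int (2 * (int k + 1) * q + 2 * p)"
proof -
  have \<sigma>'_per: "\<sigma>' (t + 1) = \<sigma>' t" for t by (rule has_vector_derivative_periodic[OF \<sigma>_der \<sigma>_per])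
  have sc: "continuous_on A (\<lambda>t. sgn (\<sigma>' t))" for A
    unfolding sgn_div_norm using \<sigma>'_nz by (intro continuous_intros \<sigma>'_cont) auto
  have "winding_number (\<lambda>s. maslov_phase torus (l s)) 0
     = winding_number (\<lambda>s. cis (2 * pi * (2 * real (k + 1) * x s)) * (sgn (\<sigma>' (t s)))\<^sup>2) 0"
  proof (rule winding_number_cong)
    fix s :: real assume "0 \<le> s" "s \<le> 1"
    then have ls: "l s = torus_param (x s, y s, t s)" by (simp add: l)
    have "cis (2 * pi * (real (k + 1) * x s)) ^ 2 = cis (2 * pi * (2 * real (k + 1) * x s))"
      unfolding Complex.DeMoivre by (simp add: algebra_simps)
    then show "maslov_phase torus (l s) = cis (2 * pi * (2 * real (k + 1) * x s)) * (sgn (\<sigma>' (t s)))\<^sup>2"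
      unfolding ls maslov_phase_torus by (simp only:)
  qed
  also have "\<dots> = of_int (2 * (int k + 1) * q) + of_int p * winding_number (\<lambda>t. (sgn (\<sigma>' t))\<^sup>2) 0"
    by (rule winding_along_curve)
       (use x t \<sigma>'_nz \<sigma>'_per in \<open>auto intro!: continuous_intros sc simp: algebra_simps sgn_eq_0_iff\<close>)
  also have "winding_number (\<lambda>t. (sgn (\<sigma>' t))\<^sup>2) 0 = of_nat 2 * winding_number (\<lambda>t. sgn (\<sigma>' t)) 0"
    by (rule winding_number_power) (use sc \<sigma>'_nz in \<open>auto simp: path_def path_image_def sgn_eq_0_iff\<close>)
  also have "winding_number (\<lambda>t. sgn (\<sigma>' t)) 0 = winding_number \<sigma>' 0"
    by (rule winding_number_sgn) (use \<sigma>'_cont \<sigma>'_nz \<sigma>'_per[of 0] in \<open>auto simp: path_def path_image_def\<close>)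
  finally show ?thesis by (simp add: winding_\<sigma>')
qed

end

end

section \<open>Disks of Maslov index two\<close>

text \<open>The winding number around enclosed points is \<open>1\<close> or \<open>-1\<close>; in the second case the parametrisation is reversed.\<close>

lemma smooth_simple_closed_curve_ccw:
  assumes "smooth_simple_closed_curve \<Gamma>"
  obtains \<gamma> \<gamma>' :: "real \<Rightarrow> complex" and c where
    "\<And>t. (\<gamma> has_vector_derivative \<gamma>' t) (at t)" "continuous_on UNIV \<gamma>'" "\<And>t. \<gamma> (t + 1) = \<gamma> t"
    "inj_on \<gamma> {0..<1}" "\<And>t. \<gamma>' t \<noteq> 0" "\<Gamma> = range \<gamma>" "simple_path \<gamma>" "path_image \<gamma> = \<Gamma>"
    "c \<in> inside \<Gamma>" "winding_number \<gamma> c = 1"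
proof -
  obtain g :: "nat \<Rightarrow> real \<Rightarrow> complex" where g: "\<And>n t. (g n has_vector_derivative g (Suc n) t) (at t)"
      "\<And>t. g 0 (t + 1) = g 0 t" "inj_on (g 0) {0..<1}" "\<And>t. g 1 t \<noteq> 0" "\<Gamma> = range (g 0)"
    using assms unfolding smooth_simple_closed_curve_def by blast
  have cont: "continuous_on A (g n)" for A n
    using g(1) by (meson continuous_at_imp_continuous_on has_vector_derivative_continuous)
  have eq: "g 0 s = g 0 t \<longleftrightarrow> s - t \<in> \<int>" for s t by (rule periodic_inj_eq_iff[OF g(2,3)])
  have "loop_free (g 0)" unfolding loop_free_def
  proof (intro ballI impI)
    fix x y :: real assume xy: "x \<in> {0..1}" "y \<in> {0..1}" "g 0 x = g 0 y"
    then obtain n :: int where n: "x - y = of_int n" using eq by (auto elim: Ints_cases)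
    then have "real_of_int n \<le> 1" "real_of_int n \<ge> -1" using xy by auto
    then have "n = 0 \<or> n = 1 \<or> n = -1" by linarith
    then show "x = y \<or> x = 0 \<and> y = 1 \<or> x = 1 \<and> y = 0" using n xy by auto
  qed
  then have sp: "simple_path (g 0)" using cont by (simp add: simple_path_def path_def)
  have loop: "pathfinish (g 0) = pathstart (g 0)" using g(2)[of 0] by (simp add: pathfinish_def pathstart_def)
  have img: "path_image (g 0) = \<Gamma>"
  proof
    show "\<Gamma> \<subseteq> path_image (g 0)"
    proof
      fix w assume "w \<in> \<Gamma>"
      then obtain t where "w = g 0 t" unfolding g(5) by auto
      then have "w = g 0 (frac t)" by (simp add: eq frac_def)
      then show "w \<in> path_image (g 0)" by (auto simp: path_image_def frac_lt_1 less_imp_le)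
    qed
  qed (auto simp: path_image_def g(5))
  obtain c where c: "c \<in> inside \<Gamma>"
    using Jordan_inside_outside[OF sp loop] unfolding img by blast
  have wc: "winding_number (g 0) c = 1 \<or> winding_number (g 0) c = -1"
    using simple_closed_path_winding_number_inside[OF sp] c unfolding img by metis
  then show thesis
  proof
    assume w1: "winding_number (g 0) c = 1"
    show thesis
      by (rule that[of "g 0" "g 1" c]) (use g cont sp img c w1 g(1)[of 0] in simp_all)
  next
    assume wm: "winding_number (g 0) c = -1"
    define h where "h = (\<lambda>t. g 0 (- t))"
    have refl: "h t = reversepath (g 0) t" for t
      unfolding h_def reversepath_def by (simp add: eq)
    have hr: "h = reversepath (g 0)" using refl by auto
    show thesis
    proof (rule that[of h "\<lambda>t. - g 1 (- t)" c])
      show "(h has_vector_derivative - g 1 (- t)) (at t)" for t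
      proof -
        have "((\<lambda>t::real. - t) has_vector_derivative - 1) (at t)"
          by (auto intro!: derivative_eq_intros)
        from vector_diff_chain_at[OF this, of "g 0" "g 1 (- t)"] g(1)[of 0 "- t"]
        show ?thesis by (simp add: o_def h_def)
      qed
      show "continuous_on UNIV (\<lambda>t. - g 1 (- t))"
        by (intro continuous_intros continuous_on_compose2[OF cont[of UNIV 1]]) auto
      show "h (t + 1) = h t" for t using g(2)[of "- t - 1"] by (simp add: h_def)
      show "inj_on h {0..<1}"
      proof (rule inj_onI)
        fix x y :: real assume xy: "x \<in> {0..<1}" "y \<in> {0..<1}" "h x = h y"
        then obtain n :: int where n: "y - x = of_int n" using eq[of "- x" "- y"] by (auto simp: h_def elim: Ints_cases)
        then have "\<bar>real_of_int n\<bar> < 1" using xy by auto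
        then have "n = 0" by linarith
        then show "x = y" using n by simp
      qed
      show "\<Gamma> = range h"
      proof -
        have "g 0 t \<in> range h" for t by (rule range_eqI[of _ _ "- t"]) (simp add: h_def)
        moreover have "h t \<in> range (g 0)" for t by (simp add: h_def)
        ultimately show ?thesis unfolding g(5) by blast
      qed
      show "winding_number h c = 1"
      proof -
        have "c \<notin> path_image (g 0)" using c inside_no_overlap[of \<Gamma>] unfolding img by blast
        then show ?thesis using winding_number_reversepath[OF simple_path_imp_path[OF sp]] wm by (simp add: hr)
      qed
    qed (use g c sp img hr in \<open>auto simp: simple_path_reversepath\<close>)
  qed
qed

lemma contractible_loop_winding_number_0:
  fixes \<gamma> :: "real \<Rightarrow> complex"
  assumes "contractible_in S T" "z \<notin> T" "path \<gamma>" "path_image \<gamma> \<subseteq> S" "pathfinish \<gamma> = pathstart \<gamma>"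
  shows "winding_number \<gamma> z = 0"
proof -
  obtain a where "homotopic_with_canon (\<lambda>_. True) S T id (\<lambda>_. a)" using assms(1) by (auto simp: contractible_in_def)
  then obtain h where h: "continuous_on ({0..1::real} \<times> S) h" "h ` ({0..1} \<times> S) \<subseteq> T"
      "\<And>x. x \<in> S \<Longrightarrow> h (0, x) = x" "\<And>x. x \<in> S \<Longrightarrow> h (1, x) = a"
    by (auto simp: homotopic_with)
  have g: "\<gamma> s \<in> S" if "s \<in> {0..1}" for s using assms(4) that by (auto simp: path_image_def)
  have gc: "continuous_on {0..1} \<gamma>" using assms(3) by (simp add: path_def)
  have "homotopic_loops (- {z}) \<gamma> (\<lambda>_. a)"
    unfolding homotopic_loops
  proof (intro exI[of _ "\<lambda>p. h (fst p, \<gamma> (snd p))"] conjI ballI)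
    show "continuous_on ({0..1} \<times> {0..1}) (\<lambda>p. h (fst p, \<gamma> (snd p)))"
      by (intro continuous_on_compose2[OF h(1)] continuous_intros continuous_on_compose2[OF gc]) (use g in auto)
    show "(\<lambda>p. h (fst p, \<gamma> (snd p))) \<in> ({0..1} \<times> {0..1}) \<rightarrow> - {z}"
      using h(2) g assms(2) by (force simp: image_subset_iff)
  qed (use g h assms(5) in \<open>auto simp: pathfinish_def pathstart_def\<close>)
  then have "winding_number \<gamma> z = winding_number (\<lambda>_. a) z" by (rule winding_number_homotopic_loops)
  also have "\<dots> = 0"
  proof (rule winding_number_zero_const)
    have "\<gamma> 0 \<in> S" using g[of 0] by simp
    then have "a \<in> T" using h(2,4) by (force simp: image_subset_iff)
    then show "a \<noteq> z" using assms(2) by auto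
  qed
  finally show ?thesis .
qed

text \<open>Otherwise \<open>\<psi>\<close> would map the open set \<open>inside \<Gamma>\<close> onto an open subset of the closed disk that contains the
  boundary point \<open>z\<close>, by invariance of domain.\<close>

lemma disk_param_boundary:
  assumes h: "homeomorphism (cball 0 1) (bounded_disk \<Gamma>) \<phi> \<psi>" and op: "open (inside \<Gamma>)"
    and z: "z \<in> sphere (0::complex) 1"
  shows "\<phi> z \<in> \<Gamma>"
proof (rule ccontr)
  assume "\<phi> z \<notin> \<Gamma>"
  have "\<phi> z \<in> bounded_disk \<Gamma>" using h z by (auto simp: homeomorphism_def)
  then have "\<phi> z \<in> inside \<Gamma>" using \<open>\<phi> z \<notin> \<Gamma>\<close> by (auto simp: bounded_disk_def)
  have sub: "inside \<Gamma> \<subseteq> bounded_disk \<Gamma>" by (auto simp: bounded_disk_def)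
  have "continuous_on (inside \<Gamma>) \<psi>" using h sub by (meson continuous_on_subset homeomorphism_def)
  moreover have "inj_on \<psi> (inside \<Gamma>)"
    using h sub by (metis (no_types, lifting) homeomorphism_apply2 inj_on_inverseI subsetD)
  ultimately have "open (\<psi> ` inside \<Gamma>)" using op by (intro invariance_of_domain)
  moreover have "z \<in> \<psi> ` inside \<Gamma>"
    using h z \<open>\<phi> z \<in> inside \<Gamma>\<close> by (force simp: homeomorphism_def image_iff)
  moreover have "\<psi> ` inside \<Gamma> \<subseteq> cball 0 1" using h image_mono[OF sub, of \<psi>] by (simp add: homeomorphism_def)
  ultimately have "z \<in> interior (cball 0 1)" by (rule interiorI)
  then show False using z by simp
qed

theorem proposition4p4:
  fixes k :: nat and a :: real and \<Gamma> :: "complex set" and w\<^sub>0 :: complex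
    and \<phi> :: "complex \<Rightarrow> complex" and \<iota> and u :: "complex \<Rightarrow> complex^3"
  defines "\<Upsilon> \<equiv> brendel_torus k \<Gamma>"
  defines "\<alpha> \<equiv> disk_class \<iota> \<Upsilon> (alpha_disk k \<circ> \<phi>)"
    and "\<beta>\<^sub>1 \<equiv> disk_class \<iota> \<Upsilon> (beta1_disk k w\<^sub>0)"
    and "\<beta>\<^sub>2 \<equiv> disk_class \<iota> \<Upsilon> (beta2_disk k w\<^sub>0)"
  assumes "k \<ge> 2" and "pi / (real k + 1) \<le> a" and "a < pi / real k"
    and "smooth_simple_closed_curve \<Gamma>"
    and "\<Gamma> \<subseteq> punctured_disk k" and "contractible_in \<Gamma> (punctured_disk k)"
    and "measure lebesgue (bounded_disk \<Gamma>) = a"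
    and "w\<^sub>0 \<in> \<Gamma>"
    and "oriented_disk_param \<Gamma> \<phi>"
    and "fundamental_class \<iota>"
    and "holomorphic_disk \<Upsilon> u"
    and "maslov_index \<Upsilon> u = 2"
  shows "disk_class \<iota> \<Upsilon> u \<in>
           {\<alpha>} \<union> {\<beta>\<^sub>1 \<otimes>\<^bsub>H2 \<Upsilon>\<^esub> inv\<^bsub>H2 \<Upsilon>\<^esub> (\<alpha> [^]\<^bsub>H2 \<Upsilon>\<^esub> k) \<otimes>\<^bsub>H2 \<Upsilon>\<^esub> (\<beta>\<^sub>2 [^]\<^bsub>H2 \<Upsilon>\<^esub> n) | n :: nat. n \<le> k}"
proof -
  obtain \<gamma> \<gamma>' c where \<gamma>: "\<And>t. (\<gamma> has_vector_derivative \<gamma>' t) (at t)" "continuous_on UNIV \<gamma>'" "\<And>t. \<gamma> (t + 1) = \<gamma> t"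
    "inj_on \<gamma> {0..<1}" "\<And>t. \<gamma>' t \<noteq> 0" "\<Gamma> = range \<gamma>" "simple_path \<gamma>" "path_image \<gamma> = \<Gamma>"
    "c \<in> inside \<Gamma>" "winding_number \<gamma> c = 1"
    using smooth_simple_closed_curve_ccw[OF assms(8)] by blast
  have loop: "pathfinish \<gamma> = pathstart \<gamma>" using \<gamma>(3)[of 0] by (simp add: pathfinish_def pathstart_def)
  have k1: "k \<ge> 1" using assms(5) by simp
  have c_out: "c \<notin> range \<gamma>" using \<gamma>(9) inside_no_overlap[of \<Gamma>] unfolding \<gamma>(6)[symmetric] by blast
  have c_small: "(cmod c)\<^sup>2 < 1 / real k"
  proof -
    have ball: "z \<in> ball 0 (1 / sqrt (real k)) \<longleftrightarrow> (cmod z)\<^sup>2 < 1 / real k" for z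
      using k1 real_less_rsqrt real_less_lsqrt real_sqrt_less_iff[of "(cmod z)\<^sup>2" "1 / real k"]
      by (simp add: real_sqrt_divide)
    then have "\<Gamma> \<subseteq> ball 0 (1 / sqrt (real k))" using assms(9) by (auto simp: punctured_disk_def)
    then have "- ball 0 (1 / sqrt (real k)) \<subseteq> outside \<Gamma>" by (intro outside_subset_convex convex_ball)
    moreover have "c \<notin> outside \<Gamma>" using \<gamma>(9) inside_Int_outside[of \<Gamma>] by blast
    ultimately show ?thesis using ball by blast
  qed
  interpret brendel_curve k \<gamma> \<gamma>' c
    by unfold_locales (use \<gamma> k1 c_out c_small assms(9) in auto)
  have \<Upsilon>: "\<Upsilon> = torus" by (simp add: \<Upsilon>_def \<gamma>(6))
  have w0: "winding_number \<gamma> 0 = 0"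
    by (rule contractible_loop_winding_number_0[OF assms(10)])
       (use \<gamma>(7,8) loop in \<open>auto simp: punctured_disk_def simple_path_imp_path\<close>)
  have \<iota>: "\<iota> \<in> carrier H2_disk" using assms(14) by (simp add: fundamental_class_def)
  have param_sub: "range torus_param \<subseteq> \<Upsilon>" by (simp add: \<Upsilon> range_torus_param)
  obtain D where D:
    "\<And>u g. continuous_on (cball 0 1) u \<Longrightarrow> u ` sphere 0 1 \<subseteq> \<Upsilon> \<Longrightarrow> continuous_on {0..1} g \<Longrightarrow> period torus_param (g 1 - g 0) \<Longrightarrow>
       (\<And>t. t \<in> {0..1} \<Longrightarrow> u (exp (2 * of_real pi * \<i> * of_real t)) = torus_param (g t)) \<Longrightarrow>
       hom_induced 2 (top_of_set (cball 0 1)) (sphere 0 1) euclidean \<Upsilon> u \<iota> \<in> D (g 1 - g 0)"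
    "\<And>m. D m \<subseteq> carrier (H2 \<Upsilon>)"
    "\<And>m m' a b. period torus_param m \<Longrightarrow> period torus_param m' \<Longrightarrow> a \<in> D m \<Longrightarrow> b \<in> D m' \<Longrightarrow> a \<otimes>\<^bsub>H2 \<Upsilon>\<^esub> b \<in> D (m + m')"
    "\<And>m a. period torus_param m \<Longrightarrow> a \<in> D m \<Longrightarrow> inv\<^bsub>H2 \<Upsilon>\<^esub> a \<in> D (- m)"
    "\<And>m a (n::nat). period torus_param m \<Longrightarrow> a \<in> D m \<Longrightarrow> a [^]\<^bsub>H2 \<Upsilon>\<^esub> n \<in> D (of_nat n *\<^sub>R m)"
    "\<And>m a b. a \<in> D m \<Longrightarrow> b \<in> D m \<Longrightarrow> a = b"
    using disk_classes_by_period[OF \<iota> torus_param_cont param_sub] by blast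
  have lifted_class: "disk_class \<iota> \<Upsilon> v \<in> D (of_int q, of_int n, of_int p)"
    if v: "continuous_on (cball 0 1) v" "v ` sphere 0 1 \<subseteq> \<Upsilon>"
      and g: "continuous_on {0..1} x" "continuous_on {0..1} y" "continuous_on {0..1} t"
        "x 1 = x 0 + of_int q" "y 1 = y 0 + of_int n" "t 1 = t 0 + of_int p"
        "\<And>s. s \<in> {0..1} \<Longrightarrow> v (cis (2 * pi * s)) = torus_param (x s, y s, t s)" for v x y t q n p
  proof -
    have m: "(x 1, y 1, t 1) - (x 0, y 0, t 0) = (of_int q, of_int n, of_int p)" using g(4-6) by simp
    show ?thesis
      unfolding disk_class_def m[symmetric]
      by (rule D(1)[OF v, of "\<lambda>s. (x s, y s, t s)"])
         (use g period_torus_param[of q n p] in \<open>auto simp flip: cis_exp intro!: continuous_intros\<close>)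
  qed
  have sphere: "cis (2 * pi * s) \<in> sphere 0 1" for s by simp
  have sphere_eq: "v ` sphere 0 1 \<subseteq> S" if "\<And>s. v (cis (2 * pi * s)) \<in> S" for v :: "complex \<Rightarrow> complex^3" and S
  proof
    fix w assume "w \<in> v ` sphere 0 1"
    then obtain z where z: "norm z = 1" "w = v z" by auto
    then have "z = cis (2 * pi * (Arg z / (2 * pi)))" using rcis_cmod_Arg[of z] by (simp add: rcis_def)
    then show "w \<in> S" using that z(2) by metis
  qed

  \<comment> \<open>The three basic disks belong to the unit periods; for \<open>\<alpha>\<close> this is the orientation of \<open>\<phi>\<close>.\<close>
  obtain \<psi> where \<psi>: "homeomorphism (cball 0 1) (bounded_disk \<Gamma>) \<phi> \<psi>"
    and \<phi>w: "\<And>w. w \<in> inside \<Gamma> \<Longrightarrow> winding_number (\<phi> \<circ> circlepath 0 1) w = 1"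
    using assms(13) unfolding oriented_disk_param_def by blast
  have op: "open (inside \<Gamma>)" using Jordan_inside_outside[OF \<gamma>(7) loop] \<gamma>(8) by simp
  have \<phi>c: "continuous_on (cball 0 1) \<phi>" using \<psi> by (simp add: homeomorphism_def)
  have \<phi>b: "\<phi> (cis (2 * pi * s)) \<in> range \<gamma>" for s
    using disk_param_boundary[OF \<psi> op sphere] \<gamma>(6) by simp
  have \<phi>sc: "continuous_on {0..1} (\<lambda>s. \<phi> (cis (2 * pi * s)))"
    by (intro continuous_on_compose2[OF \<phi>c] continuous_intros) auto
  obtain t where t: "continuous_on {0..1} t" "\<And>s. s \<in> {0..1} \<Longrightarrow> \<phi> (cis (2 * pi * s)) = \<gamma> (t s)"
    using loop_lift_through_curve[OF \<gamma>_cont per inj \<phi>sc \<phi>b] by blast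
  have "\<gamma> (t 1) = \<gamma> (t 0)" using t(2)[of 0] t(2)[of 1] by simp
  then obtain p where p: "t 1 = t 0 + of_int p" by (auto simp: \<gamma>_eq_iff algebra_simps elim!: Ints_cases)
  have "1 = winding_number (\<lambda>s. \<phi> (cis (2 * pi * s)) - c) 0"
    using \<phi>w[OF \<gamma>(9)] unfolding winding_number_offset[of _ c] circlepath_unit by (simp add: o_def)
  also have "\<dots> = winding_number (\<lambda>s. \<gamma> (t s) - c) 0"
    by (rule winding_number_cong) (simp add: t(2))
  also have "\<dots> = of_int p * winding_number (\<lambda>t. \<gamma> t - c) 0"
    by (rule winding_number_reparametrized_loop[OF _ _ _ t(1) p]) (use c_out per in \<open>auto intro!: continuous_intros \<gamma>_cont\<close>)
  also have "winding_number (\<lambda>t. \<gamma> t - c) 0 = 1" using \<gamma>(10) by (simp flip: winding_number_offset)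
  finally have "p = 1" by (metis mult.right_neutral of_int_1 of_int_eq_iff)
  have alpha_eq: "(alpha_disk k \<circ> \<phi>) (cis (2 * pi * s)) = torus_param (0, 0, t s)" if "s \<in> {0..1}" for s
    using t(2)[OF that] by (simp add: alpha_disk_def torus_param_def r_def \<rho>_def)
  have \<alpha>: "\<alpha> \<in> D (of_int 0, of_int 0, of_int 1)"
    unfolding \<alpha>_def
  proof (rule lifted_class[of _ "\<lambda>_. 0" "\<lambda>_. 0" t])
    show "continuous_on (cball 0 1) (alpha_disk k \<circ> \<phi>)"
      unfolding alpha_disk_def o_def by (intro continuous_on_vector_3 continuous_intros \<phi>c)
    show "(alpha_disk k \<circ> \<phi>) ` sphere 0 1 \<subseteq> \<Upsilon>"
    proof (rule sphere_eq)
      fix s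
      obtain t0 where "\<phi> (cis (2 * pi * s)) = \<gamma> t0" using \<phi>b[of s] by auto
      then have "(alpha_disk k \<circ> \<phi>) (cis (2 * pi * s)) = torus_param (0, 0, t0)"
        by (simp add: alpha_disk_def torus_param_def r_def \<rho>_def)
      then show "(alpha_disk k \<circ> \<phi>) (cis (2 * pi * s)) \<in> \<Upsilon>" using param_sub by auto
    qed
  qed (use t(1) p \<open>p = 1\<close> alpha_eq in auto)

  obtain t0 where t0: "w\<^sub>0 = \<gamma> t0" using assms(12) \<gamma>(6) by auto
  have beta1_eq: "beta1_disk k w\<^sub>0 (cis (2 * pi * s)) = torus_param (s, 0, t0)" for s
    by (simp add: beta1_disk_def torus_param_def r_def \<rho>_def t0 Complex.DeMoivre mult_ac)
  have \<beta>1: "\<beta>\<^sub>1 \<in> D (of_int 1, of_int 0, of_int 0)"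
    unfolding \<beta>\<^sub>1_def
  proof (rule lifted_class[of _ "\<lambda>s. s" "\<lambda>_. 0" "\<lambda>_. t0"])
    show "continuous_on (cball 0 1) (beta1_disk k w\<^sub>0)"
      unfolding beta1_disk_def by (intro continuous_on_vector_3 continuous_intros)
    show "beta1_disk k w\<^sub>0 ` sphere 0 1 \<subseteq> \<Upsilon>" by (rule sphere_eq) (use beta1_eq param_sub in auto)
  qed (use beta1_eq in auto)
  have beta2_eq: "beta2_disk k w\<^sub>0 (cis (2 * pi * s)) = torus_param (0, s, t0)" for s
    by (simp add: beta2_disk_def torus_param_def r_def \<rho>_def t0 cis_cnj mult_ac)
  have \<beta>2: "\<beta>\<^sub>2 \<in> D (of_int 0, of_int 1, of_int 0)"
    unfolding \<beta>\<^sub>2_def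
  proof (rule lifted_class[of _ "\<lambda>_. 0" "\<lambda>s. s" "\<lambda>_. t0"])
    show "continuous_on (cball 0 1) (beta2_disk k w\<^sub>0)"
      unfolding beta2_disk_def by (intro continuous_on_vector_3 continuous_intros)
    show "beta2_disk k w\<^sub>0 ` sphere 0 1 \<subseteq> \<Upsilon>" by (rule sphere_eq) (use beta2_eq param_sub in auto)
  qed (use beta2_eq in auto)

  have uc: "continuous_on (cball 0 1) u" and uh: "\<And>i. (\<lambda>z. u z $ i) holomorphic_on ball 0 1"
    and ub: "u ` sphere 0 1 \<subseteq> \<Upsilon>" using assms(15) by (auto simp: holomorphic_disk_def)
  define l where "l = (\<lambda>s. u (cis (2 * pi * s)))"
  have lc: "continuous_on {0..1} l" unfolding l_def
    by (intro continuous_on_compose2[OF uc] continuous_intros) auto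
  have lt: "l s \<in> torus" for s using ub sphere[of s] by (auto simp: l_def \<Upsilon>)
  have l01: "l 1 = l 0" by (simp add: l_def)
  obtain x y t and q n p :: int where
    c: "continuous_on {0..1} x" "continuous_on {0..1} y" "continuous_on {0..1} t"
    and eq: "\<And>s. s \<in> {0..1} \<Longrightarrow> l s = torus_param (x s, y s, t s)"
    and inc: "x 1 = x 0 + of_int q" "y 1 = y 0 + of_int n" "t 1 = t 0 + of_int p"
    using torus_loop_lift[OF lc lt l01] by blast
  have uD: "disk_class \<iota> \<Upsilon> u \<in> D (of_int q, of_int n, of_int p)"
    by (rule lifted_class[OF uc ub c inc]) (use eq in \<open>simp add: l_def\<close>)

  have nonneg: "0 \<le> m" if f: "continuous_on (cball 0 1) f" "f holomorphic_on ball 0 1" "\<And>s. f (cis (2 * pi * s)) \<noteq> 0"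
      and m: "winding_number (\<lambda>s. f (cis (2 * pi * s))) 0 = of_int m" for f :: "complex \<Rightarrow> complex" and m :: int
  proof -
    have "f z \<noteq> 0" if "z \<in> sphere 0 1" for z
    proof -
      have "z = cis (2 * pi * (Arg z / (2 * pi)))" using that rcis_cmod_Arg[of z] by (simp add: rcis_def)
      then show ?thesis using f(3) by metis
    qed
    from winding_number_holomorphic_nonneg[OF f(1,2) this] show ?thesis
      unfolding circlepath_unit o_def m by simp
  qed
  have uci: "continuous_on (cball 0 1) (\<lambda>z. u z $ i)" for i by (intro continuous_intros uc)
  have coord_nz: "u (cis (2 * pi * s)) $ 1 \<noteq> 0" "u (cis (2 * pi * s)) $ 2 \<noteq> 0" "u (cis (2 * pi * s)) $ 3 \<noteq> 0"
      "u (cis (2 * pi * s)) $ 2 * u (cis (2 * pi * s)) $ 3 - C * u (cis (2 * pi * s)) $ 1 ^ k \<noteq> 0" for s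
  proof -
    obtain x y t where e: "u (cis (2 * pi * s)) = torus_param (x, y, t)"
      using lt[of s] unfolding l_def range_torus_param[symmetric] by auto
    show 1: "u (cis (2 * pi * s)) $ 1 \<noteq> 0" "u (cis (2 * pi * s)) $ 2 \<noteq> 0" "u (cis (2 * pi * s)) $ 3 \<noteq> 0"
      using r_nz[of t] \<rho>_nz[of t] \<gamma>_nz[of t] by (simp_all add: e torus_param_nth)
    have "\<sigma> t \<noteq> C" by (rule \<sigma>_neq_C)
    then show "u (cis (2 * pi * s)) $ 2 * u (cis (2 * pi * s)) $ 3 - C * u (cis (2 * pi * s)) $ 1 ^ k \<noteq> 0"
      using 1(1) unfolding e torus_quotient by (simp flip: left_diff_distrib)
  qed
  note wind = c(1) inc(1) c(2) inc(2) c(3) inc(3) eq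
  have q0: "0 \<le> q"
    using nonneg[OF uci uh coord_nz(1)] winding_coordinate_1[OF wind] by (simp add: l_def)
  have n0: "0 \<le> n"
    using nonneg[OF uci uh coord_nz(2)] winding_coordinate_2[OF wind] by (simp add: l_def)
  have nk: "0 \<le> int k * q - n"
    by (rule nonneg[OF uci uh coord_nz(3)]) (use winding_coordinate_3[OF wind] w0 in \<open>simp add: l_def\<close>)
  \<comment> \<open>Together with the Maslov index this is the inequality that bounds \<open>q\<close> from above.\<close>
  have kqp: "0 \<le> int k * q + p"
    by (rule nonneg[where f = "\<lambda>z. u z $ 2 * u z $ 3 - C * u z $ 1 ^ k", OF _ _ coord_nz(4)])
       (use winding_fibration_value[OF wind] in \<open>auto simp: l_def intro!: continuous_intros uci holomorphic_intros uh\<close>)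
  have "maslov_index \<Upsilon> u = winding_number (\<lambda>s. maslov_phase torus (l s)) 0"
    unfolding maslov_index_def \<Upsilon> circlepath_unit by (simp add: o_def l_def)
  then have "complex_of_int (2 * (int k + 1) * q + 2 * p) = of_int 2"
    using winding_maslov_phase[OF wind] assms(16) by simp
  then have mas: "2 * (int k + 1) * q + 2 * p = 2" by (simp only: of_int_eq_iff)
  then have p_eq: "p = 1 - (int k + 1) * q" by (simp add: algebra_simps)
  then have "q \<le> 1" using kqp by (simp add: algebra_simps)
  then consider "q = 0" | "q = 1" using q0 by linarith
  then show ?thesis
  proof cases
    case 1
    then have "n = 0" "p = 1" using n0 nk p_eq by auto
    then have "disk_class \<iota> \<Upsilon> u = \<alpha>" using D(6)[OF uD] \<alpha> 1 by simp
    then show ?thesis by simp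
  next
    case 2
    define N where "N = nat n"
    have N: "n = int N" "N \<le> k" using n0 nk 2 by (auto simp: N_def)
    have p2: "p = - int k" using p_eq 2 by simp
    note per1 = period_torus_param[of 1 0 0] and per2 = period_torus_param[of 0 1 0] and per3 = period_torus_param[of 0 0 1]
    have 31: "inv\<^bsub>H2 \<Upsilon>\<^esub> (\<alpha> [^]\<^bsub>H2 \<Upsilon>\<^esub> k) \<in> D (of_int 0, of_int 0, of_int (- int k))"
      using D(4)[OF _ D(5)[OF per3 \<alpha>, of k]] period_torus_param[of 0 0 "int k"] by simp
    have 32: "\<beta>\<^sub>2 [^]\<^bsub>H2 \<Upsilon>\<^esub> N \<in> D (of_int 0, of_int n, of_int 0)"
      using D(5)[OF per2 \<beta>2, of N] by (simp add: N(1))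
    have 33: "\<beta>\<^sub>1 \<otimes>\<^bsub>H2 \<Upsilon>\<^esub> inv\<^bsub>H2 \<Upsilon>\<^esub> (\<alpha> [^]\<^bsub>H2 \<Upsilon>\<^esub> k) \<in> D (of_int 1, of_int 0, of_int (- int k))"
      using D(3)[OF per1 period_torus_param \<beta>1 31] by simp
    have 34: "\<beta>\<^sub>1 \<otimes>\<^bsub>H2 \<Upsilon>\<^esub> inv\<^bsub>H2 \<Upsilon>\<^esub> (\<alpha> [^]\<^bsub>H2 \<Upsilon>\<^esub> k) \<otimes>\<^bsub>H2 \<Upsilon>\<^esub> (\<beta>\<^sub>2 [^]\<^bsub>H2 \<Upsilon>\<^esub> N) \<in> D (of_int q, of_int n, of_int p)"
      using D(3)[OF period_torus_param period_torus_param 33 32] by (simp add: 2 p2)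
    show ?thesis using D(6)[OF uD 34] N(2) by blast
  qed
qed

end
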